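(* Let $X$ be a finite connected directed tree (possibly with external edges) with $n\geq 1$ vertices of in-degrees $m_1,\dots,m_n$, carrying a logic circuit, and let $\mathcal{S}$ be the associated switching sheaf over $X$. Then $H^1(X;\mathcal{S})=0$ and $$\dim H^0(X;\mathcal{S})=\sum_{i=1}^n 2^{m_i}-2(n-1).$$
   Context: Graphs: $X$ has its usual topology. External edges are allowed, i.e. edges with a vertex at only one end, the other end being open (external inputs and outputs). "Tree" means that the underlying undirected graph is connected and has no cycles; the directions on the edges are arbitrary. In-degrees count both external and internal incoming edges. Logic circuit: an assignment to each vertex $v$ of a function $f_v:\mathbb{F}_2^{m(v)}\to\mathbb{F}_2^{n(v)}$ (the logic gate at $v$), where $m(v)$ and $n(v)$ are the in-degree and out-degree of $v$; the incoming edges and outgoing edges at $v$ are ordered. One-hot encoding: $T:\mathbb{F}_2\to\mathbb{F}_2^2$ with $T(0)=\begin{pmatrix}1\\0\end{pmatrix}$, $T(1)=\begin{pmatrix}0\\1\end{pmatrix}$. For the $j$-th component $f_{v,j}$ of $f_v$, let $\phi_{v,j}:(\mathbb{F}_2^2)^{\otimes m(v)}\to\mathbb{F}_2^2$ be the $\mathbb{F}_2$-linear map determined by $\phi_{v,j}(Ta_1\otimes\cdots\otimes Ta_{m(v)})=T(f_{v,j}(a_1,\dots,a_{m(v)}))$ for $a_i\in\mathbb{F}_2$. An empty tensor product is $\mathbb{F}_2$. Contraction onto the $i$-th factor is the linear map $(\mathbb{F}_2^2)^{\otimes m(v)}\to\mathbb{F}_2^2$ sending $Ta_1\otimes\cdots\otimes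 Ta_{m(v)}$ to $Ta_i$. Switching sheaf $\mathcal{S}$: the sheafification of the presheaf $S$ of $\mathbb{F}_2$-vector spaces defined on a base of the topology consisting of contractible open sets $U$ containing exactly one vertex (small neighborhoods of that vertex) and connected open sets $V$ contained in the interior of a single edge. If $U$ contains $v$, then $S(U)=(\mathbb{F}_2^2)^{\otimes m(v)}$, one factor for each incoming edge of $v$; and $S(V)=\mathbb{F}_2^2$. For $V\subset U$ with $V$ in the part of $U$ lying on the $i$-th incoming edge of $v$, the restriction is the contraction onto the $i$-th factor; for $V$ in the part of $U$ lying on the $j$-th outgoing edge of $v$, the restriction is $\phi_{v,j}$. Restrictions between basic sets of the same type (same vertex, or same edge) are identities. $H^k(X;\mathcal{S})$ denotes sheaf cohomology; dimensions are over $\mathbb{F}_2$. *)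

theory Defs
  imports
    "HOL-Analysis.Analysis"
    "HOL-Library.Z2"
    "HOL-Algebra.AbelCoset"
    "Jordan_Normal_Form.Missing_VectorSpace"
begin

section \<open>Sheaves of modules and their cohomology\<close>

subsection \<open>Products and quotients of modules\<close>

text \<open>A \<^type>\<open>module\<close> record extends the ring record; the fields \<open>mult\<close> and \<open>one\<close>
  play no role for a module.\<close>

definition prod_module :: "'i set \<Rightarrow> ('i \<Rightarrow> ('k, 'a) module) \<Rightarrow> ('k, 'i \<Rightarrow> 'a) module" where
  "prod_module I M =
    \<lparr>carrier = (\<Pi>\<^sub>E i\<in>I. carrier (M i)), mult = undefined, one = undefined,
     zero = (\<lambda>i\<in>I. \<zero>\<^bsub>M i\<^esub>), add = (\<lambda>f g. \<lambda>i\<in>I. f i \<oplus>\<^bsub>M i\<^esub> g i),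
     smult = (\<lambda>c f. \<lambda>i\<in>I. c \<odot>\<^bsub>M i\<^esub> f i)\<rparr>"

definition quot_module :: "('k, 'a) module \<Rightarrow> 'a set \<Rightarrow> ('k, 'a set) module" where
  "quot_module M N =
    \<lparr>carrier = a_rcosets\<^bsub>M\<^esub> N, mult = undefined, one = undefined,
     zero = N, add = (\<lambda>A B. A <+>\<^bsub>M\<^esub> B),
     smult = (\<lambda>c A. \<Union>a\<in>A. N +>\<^bsub>M\<^esub> (c \<odot>\<^bsub>M\<^esub> a))\<rparr>"

subsection \<open>Presheaves on a base, stalks, sheafification\<close>

text \<open>\<open>restr F U V\<close> is the restriction from \<open>U\<close> to \<open>V \<subseteq> U\<close>. The family \<open>opens F\<close> is a base of
  the topology, or the family of all open sets.\<close>

record ('p, 'k, 'a) presheaf =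
  opens :: "'p set set"
  sect :: "'p set \<Rightarrow> ('k, 'a) module"
  restr :: "'p set \<Rightarrow> 'p set \<Rightarrow> 'a \<Rightarrow> 'a"

definition germ :: "('p, 'k, 'a) presheaf \<Rightarrow> 'p \<Rightarrow> 'p set \<Rightarrow> 'a \<Rightarrow> ('p set \<times> 'a) set" where
  "germ F x U s =
    {(W, t). W \<in> opens F \<and> x \<in> W \<and> t \<in> carrier (sect F W) \<and>
      (\<exists>B\<in>opens F. x \<in> B \<and> B \<subseteq> U \<inter> W \<and> restr F U B s = restr F W B t)}"

text \<open>The operations on germs do not depend on the representatives; the unions below are over
  families of equal germs.\<close>

definition stalk :: "('p, 'k, 'a) presheaf \<Rightarrow> 'p \<Rightarrow> ('k, ('p set \<times> 'a) set) module" where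
  "stalk F x =
    \<lparr>carrier = {germ F x U s | U s. U \<in> opens F \<and> x \<in> U \<and> s \<in> carrier (sect F U)},
     mult = undefined, one = undefined,
     zero = \<Union> {germ F x B \<zero>\<^bsub>sect F B\<^esub> | B. B \<in> opens F \<and> x \<in> B},
     add = (\<lambda>g h. \<Union> {germ F x B (restr F U B s \<oplus>\<^bsub>sect F B\<^esub> restr F U' B s') | B U s U' s'.
                        (U, s) \<in> g \<and> (U', s') \<in> h \<and> B \<in> opens F \<and> x \<in> B \<and> B \<subseteq> U \<inter> U'}),
     smult = (\<lambda>c g. \<Union> {germ F x U (c \<odot>\<^bsub>sect F U\<^esub> s) | U s. (U, s) \<in> g})\<rparr>"

definition germs :: "('p, 'k, 'a) presheaf \<Rightarrow> 'p set \<Rightarrow> 'a \<Rightarrow> 'p \<Rightarrow> ('p set \<times> 'a) set" where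
  "germs F U s = (\<lambda>x\<in>U. germ F x U s)"

definition sheafify ::
  "'p topology \<Rightarrow> ('p, 'k, 'a) presheaf \<Rightarrow> ('p, 'k, 'p \<Rightarrow> ('p set \<times> 'a) set) presheaf" where
  "sheafify X F =
    \<lparr>opens = {U. openin X U},
     sect = (\<lambda>U. (prod_module U (stalk F))
       \<lparr>carrier := {\<sigma> \<in> (\<Pi>\<^sub>E x\<in>U. carrier (stalk F x)).
          \<forall>x\<in>U. \<exists>B\<in>opens F. x \<in> B \<and> B \<subseteq> U \<and>
            (\<exists>s\<in>carrier (sect F B). \<forall>y\<in>B. \<sigma> y = germ F y B s)}\<rparr>),
     restr = (\<lambda>U V \<sigma>. restrict \<sigma> V)\<rparr>"

subsection \<open>Cohomology by the canonical flasque (Godement) resolution\<close>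

text \<open>\<open>C0 X F\<close> is the sheaf \<open>U \<mapsto> \<Prod>\<^sub>x\<^sub>\<in>\<^sub>U F\<^sub>x\<close> of discontinuous sections. The resolution is built from
  the short exact sequences \<open>0 \<rightarrow> F \<rightarrow> C0 F \<rightarrow> Z1 F \<rightarrow> 0\<close>, that is, \<open>C\<^sup>0 = C0 F\<close>, \<open>C\<^sup>1 = C0 (Z1 F)\<close>,
  \<open>C\<^sup>2 = C0 (Z1 (Z1 F))\<close>, and so on. The type of the sections grows with the degree, which is why
  each degree has its own constant below.\<close>

definition C0 ::
  "'p topology \<Rightarrow> ('p, 'k, 'a) presheaf \<Rightarrow> ('p, 'k, 'p \<Rightarrow> ('p set \<times> 'a) set) presheaf" where
  "C0 X F =
    \<lparr>opens = {U. openin X U}, sect = (\<lambda>U. prod_module U (stalk F)),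
     restr = (\<lambda>U V \<sigma>. restrict \<sigma> V)\<rparr>"

abbreviation C0_image :: "('p, 'k, 'a) presheaf \<Rightarrow> 'p set \<Rightarrow> ('p \<Rightarrow> ('p set \<times> 'a) set) set" where
  "C0_image F U \<equiv> germs F U ` carrier (sect F U)"

definition C0_quot ::
  "'p topology \<Rightarrow> ('p, 'k, 'a) presheaf \<Rightarrow> ('p, 'k, ('p \<Rightarrow> ('p set \<times> 'a) set) set) presheaf" where
  "C0_quot X F =
    \<lparr>opens = {U. openin X U},
     sect = (\<lambda>U. quot_module (sect (C0 X F) U) (C0_image F U)),
     restr = (\<lambda>U V A. \<Union>\<sigma>\<in>A. C0_image F V +>\<^bsub>sect (C0 X F) V\<^esub> restr (C0 X F) U V \<sigma>)\<rparr>"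

definition Z1 ::
  "'p topology \<Rightarrow> ('p, 'k, 'a) presheaf \<Rightarrow>
   ('p, 'k, 'p \<Rightarrow> ('p set \<times> ('p \<Rightarrow> ('p set \<times> 'a) set) set) set) presheaf" where
  "Z1 X F = sheafify X (C0_quot X F)"

text \<open>The map \<open>\<Gamma>(X, C0 F) \<rightarrow> \<Gamma>(X, C0 (Z1 F))\<close> is the composition of the projection to
  \<open>\<Gamma>(X, C0 F) / \<Gamma>(X, F)\<close>, the unit of sheafification, and the embedding of \<open>Z1 F\<close> in \<open>C0 (Z1 F)\<close>.\<close>

definition godement_d ::
  "'p topology \<Rightarrow> ('p, 'k, 'a) presheaf \<Rightarrow> ('p \<Rightarrow> ('p set \<times> 'a) set) \<Rightarrow>
   'p \<Rightarrow> ('p set \<times> ('p \<Rightarrow> ('p set \<times> ('p \<Rightarrow> ('p set \<times> 'a) set) set) set)) set" where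
  "godement_d X F \<sigma> =
    (let S = topspace X in
      germs (Z1 X F) S (germs (C0_quot X F) S (C0_image F S +>\<^bsub>sect (C0 X F) S\<^esub> \<sigma>)))"

definition godement_cocycles ::
  "'p topology \<Rightarrow> ('p, 'k, 'a) presheaf \<Rightarrow> ('k, 'p \<Rightarrow> ('p set \<times> 'a) set) module" where
  "godement_cocycles X F =
    (let S = topspace X in
      (sect (C0 X F) S)
        \<lparr>carrier := {\<sigma> \<in> carrier (sect (C0 X F) S). godement_d X F \<sigma> = \<zero>\<^bsub>sect (C0 X (Z1 X F)) S\<^esub>}\<rparr>)"

text \<open>\<open>H\<^sup>0\<close> and \<open>H\<^sup>1\<close> of the complex
  \<open>0 \<rightarrow> \<Gamma>(X, C0 F) \<rightarrow> \<Gamma>(X, C0 (Z1 F)) \<rightarrow> \<Gamma>(X, C0 (Z1 (Z1 F))) \<rightarrow> \<dots>\<close>.\<close>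

definition sheaf_H0 ::
  "'p topology \<Rightarrow> ('p, 'k, 'a) presheaf \<Rightarrow> ('k, 'p \<Rightarrow> ('p set \<times> 'a) set) module" where
  "sheaf_H0 X F = godement_cocycles X F"

definition sheaf_H1 ::
  "'p topology \<Rightarrow> ('p, 'k, 'a) presheaf \<Rightarrow>
   ('k, ('p \<Rightarrow> ('p set \<times> ('p \<Rightarrow> ('p set \<times> ('p \<Rightarrow> ('p set \<times> 'a) set) set) set)) set) set) module" where
  "sheaf_H1 X F =
    quot_module (godement_cocycles X (Z1 X F))
      (godement_d X F ` carrier (sect (C0 X F) (topspace X)))"


section \<open>Directed graphs with external edges\<close>

text \<open>An end of an edge is \<^term>\<open>None\<close> if it is open.\<close>

record ('v, 'e) ext_digraph =
  verts :: "'v set"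
  edges :: "'e set"
  src :: "'e \<Rightarrow> 'v option"
  tgt :: "'e \<Rightarrow> 'v option"

definition finite_ext_digraph :: "('v, 'e) ext_digraph \<Rightarrow> bool" where
  "finite_ext_digraph G \<longleftrightarrow>
    finite (verts G) \<and> finite (edges G) \<and>
    (\<forall>e\<in>edges G. set_option (src G e) \<subseteq> verts G \<and> set_option (tgt G e) \<subseteq> verts G \<and>
      (src G e \<noteq> None \<or> tgt G e \<noteq> None))"

definition in_edges :: "('v, 'e) ext_digraph \<Rightarrow> 'v \<Rightarrow> 'e set" where
  "in_edges G v = {e \<in> edges G. tgt G e = Some v}"

definition out_edges :: "('v, 'e) ext_digraph \<Rightarrow> 'v \<Rightarrow> 'e set" where
  "out_edges G v = {e \<in> edges G. src G e = Some v}"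

abbreviation in_degree :: "('v, 'e) ext_digraph \<Rightarrow> 'v \<Rightarrow> nat" where
  "in_degree G v \<equiv> card (in_edges G v)"

definition joins :: "('v, 'e) ext_digraph \<Rightarrow> 'e \<Rightarrow> 'v \<Rightarrow> 'v \<Rightarrow> bool" where
  "joins G e u w \<longleftrightarrow> e \<in> edges G \<and>
    (src G e = Some u \<and> tgt G e = Some w \<or> src G e = Some w \<and> tgt G e = Some u)"

definition connected_graph :: "('v, 'e) ext_digraph \<Rightarrow> bool" where
  "connected_graph G \<longleftrightarrow>
    (\<forall>u\<in>verts G. \<forall>w\<in>verts G. (u, w) \<in> {(a, b). \<exists>e. joins G e a b}\<^sup>*)"

text \<open>Loops are cycles of length 1, and two parallel or antiparallel edges form a cycle of length 2.\<close>

definition is_cycle :: "('v, 'e) ext_digraph \<Rightarrow> 'v list \<Rightarrow> 'e list \<Rightarrow> bool" where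
  "is_cycle G vs es \<longleftrightarrow>
    es \<noteq> [] \<and> length vs = length es \<and> distinct vs \<and> distinct es \<and>
    (\<forall>i<length es. joins G (es ! i) (vs ! i) (vs ! (Suc i mod length es)))"

definition is_tree :: "('v, 'e) ext_digraph \<Rightarrow> bool" where
  "is_tree G \<longleftrightarrow> connected_graph G \<and> (\<nexists>vs es. is_cycle G vs es)"

subsection \<open>The topological space of a graph\<close>

datatype ('v, 'e) point = Vert 'v | Inner 'e real

definition graph_space :: "('v, 'e) ext_digraph \<Rightarrow> ('v, 'e) point set" where
  "graph_space G = Vert ` verts G \<union> (\<Union>e\<in>edges G. Inner e ` {0<..<1})"

definition edge_dom :: "('v, 'e) ext_digraph \<Rightarrow> 'e \<Rightarrow> real set" where
  "edge_dom G e = {t \<in> {0..1}. (t = 0 \<longrightarrow> src G e \<noteq> None) \<and> (t = 1 \<longrightarrow> tgt G e \<noteq> None)}"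

definition edge_param :: "('v, 'e) ext_digraph \<Rightarrow> 'e \<Rightarrow> real \<Rightarrow> ('v, 'e) point" where
  "edge_param G e t =
    (if t = 0 then Vert (the (src G e)) else if t = 1 then Vert (the (tgt G e)) else Inner e t)"

text \<open>The quotient (CW) topology: the finest one in which the edges are parametrized continuously.\<close>

definition graph_top :: "('v, 'e) ext_digraph \<Rightarrow> ('v, 'e) point topology" where
  "graph_top G = topology (\<lambda>U. U \<subseteq> graph_space G \<and>
    (\<forall>e\<in>edges G. openin (top_of_set (edge_dom G e)) {t \<in> edge_dom G e. edge_param G e t \<in> U}))"

lemma openin_graph_top:
  "openin (graph_top G) U \<longleftrightarrow> U \<subseteq> graph_space G \<and>
    (\<forall>e\<in>edges G. openin (top_of_set (edge_dom G e)) {t \<in> edge_dom G e. edge_param G e t \<in> U})"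
proof -
  have "istopology (\<lambda>U. U \<subseteq> graph_space G \<and>
    (\<forall>e\<in>edges G. openin (top_of_set (edge_dom G e)) {t \<in> edge_dom G e. edge_param G e t \<in> U}))"
    (is "istopology ?P")
    unfolding istopology_def
  proof (intro conjI allI impI)
    fix S T assume "?P S" "?P T"
    moreover have "{t \<in> edge_dom G e. edge_param G e t \<in> S \<inter> T} =
        {t \<in> edge_dom G e. edge_param G e t \<in> S} \<inter> {t \<in> edge_dom G e. edge_param G e t \<in> T}" for e
      by auto
    ultimately show "S \<inter> T \<subseteq> graph_space G" "\<forall>e\<in>edges G. openin (top_of_set (edge_dom G e))
        {t \<in> edge_dom G e. edge_param G e t \<in> S \<inter> T}"
      by auto
  next
    fix K assume K: "\<forall>U\<in>K. ?P U"
    show "\<Union>K \<subseteq> graph_space G"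
      using K by auto
    have "{t \<in> edge_dom G e. edge_param G e t \<in> \<Union>K} =
        \<Union> ((\<lambda>U. {t \<in> edge_dom G e. edge_param G e t \<in> U}) ` K)" for e
      by auto
    then show "\<forall>e\<in>edges G. openin (top_of_set (edge_dom G e))
        {t \<in> edge_dom G e. edge_param G e t \<in> \<Union>K}"
      using K by auto
  qed
  then show ?thesis
    unfolding graph_top_def by (simp add: topology_inverse')
qed


section \<open>Logic circuits and the switching sheaf\<close>

text \<open>\<open>ins C v\<close> and \<open>outs C v\<close> list the incoming and outgoing edges of \<open>v\<close> in order.\<close>

record ('v, 'e) circuit =
  ins :: "'v \<Rightarrow> 'e list"
  outs :: "'v \<Rightarrow> 'e list"
  gate :: "'v \<Rightarrow> bit list \<Rightarrow> bit list"

definition logic_circuit :: "('v, 'e) ext_digraph \<Rightarrow> ('v, 'e) circuit \<Rightarrow> bool" where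
  "logic_circuit G C \<longleftrightarrow> (\<forall>v\<in>verts G.
    distinct (ins C v) \<and> set (ins C v) = in_edges G v \<and>
    distinct (outs C v) \<and> set (outs C v) = out_edges G v \<and>
    (\<forall>a. length a = length (ins C v) \<longrightarrow> length (gate C v a) = length (outs C v)))"

definition F2 :: "bit ring" where
  "F2 = \<lparr>carrier = UNIV, mult = (*), one = 1, zero = 0, add = (+)\<rparr>"

text \<open>An element of the \<open>m\<close>-th tensor power of \<open>\<bbbF>\<^sub>2\<^sup>2\<close> is given by its coordinates with respect to the
  basis \<open>T a\<^sub>1 \<otimes> \<cdots> \<otimes> T a\<^sub>m\<close>, as a function on bit lists that vanishes outside the lists of length \<open>m\<close>.
  In particular \<open>\<bbbF>\<^sub>2\<^sup>2\<close> is \<open>tens 1\<close>, and \<open>tens 0\<close> is a copy of \<open>\<bbbF>\<^sub>2\<close>.\<close>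

definition tens :: "nat \<Rightarrow> (bit, bit list \<Rightarrow> bit) module" where
  "tens m =
    \<lparr>carrier = {x. \<forall>a. length a \<noteq> m \<longrightarrow> x a = 0}, mult = undefined, one = undefined,
     zero = (\<lambda>a. 0), add = (\<lambda>x y a. x a + y a), smult = (\<lambda>c x a. c * x a)\<rparr>"

definition onehot :: "bit \<Rightarrow> bit list \<Rightarrow> bit" where
  "onehot b = (\<lambda>a. if a = [b] then 1 else 0)"

definition pure_tensor :: "(bit list \<Rightarrow> bit) list \<Rightarrow> bit list \<Rightarrow> bit" where
  "pure_tensor xs a = (if length a = length xs then \<Prod>i<length xs. (xs ! i) [a ! i] else 0)"

text \<open>The linear map on \<open>tens m\<close> that sends \<open>T a\<^sub>1 \<otimes> \<cdots> \<otimes> T a\<^sub>m\<close> to \<open>g [a\<^sub>1, \<dots>, a\<^sub>m]\<close>; see the lemmas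
  below.\<close>

definition lin_ext :: "nat \<Rightarrow> (bit list \<Rightarrow> bit list \<Rightarrow> bit) \<Rightarrow> (bit list \<Rightarrow> bit) \<Rightarrow> bit list \<Rightarrow> bit" where
  "lin_ext m g x = (\<lambda>b. \<Sum>a | length a = m. x a * g a b)"

lemma finite_bit_lists: "finite {a :: bit list. length a = m}"
proof -
  have "finite (UNIV :: bit set)"
  proof (rule finite_subset)
    show "UNIV \<subseteq> {0, 1 :: bit}"
    proof
      fix b :: bit
      show "b \<in> {0, 1}" by (cases b) simp_all
    qed
  qed simp
  then show ?thesis
    using finite_lists_length_eq[of "UNIV :: bit set" m] by auto
qed

lemma pure_tensor_onehot: "pure_tensor (map onehot as) = (\<lambda>a. if a = as then 1 else 0)"
proof
  fix a
  have "\<exists>i<length as. a ! i \<noteq> as ! i" if "length a = length as" "a \<noteq> as"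
    using that by (metis nth_equalityI)
  then show "pure_tensor (map onehot as) a = (if a = as then 1 else 0)"
    by (auto simp: pure_tensor_def onehot_def)
qed

lemma lin_ext_pure:
  assumes "length as = m"
  shows "lin_ext m g (pure_tensor (map onehot as)) = g as"
proof
  fix b
  have "lin_ext m g (pure_tensor (map onehot as)) b =
      (\<Sum>a | length a = m. if a = as then g a b else 0)"
    unfolding lin_ext_def pure_tensor_onehot by (rule sum.cong) auto
  also have "\<dots> = g as b"
    using assms by (subst sum.delta[OF finite_bit_lists]) simp
  finally show "lin_ext m g (pure_tensor (map onehot as)) b = g as b" .
qed

lemma lin_ext_add: "lin_ext m g (x \<oplus>\<^bsub>tens m\<^esub> y) = lin_ext m g x \<oplus>\<^bsub>tens n\<^esub> lin_ext m g y"
  unfolding lin_ext_def tens_def by (simp only: ring_record_simps distrib_right sum.distrib)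

lemma lin_ext_smult: "lin_ext m g (c \<odot>\<^bsub>tens m\<^esub> x) = c \<odot>\<^bsub>tens n\<^esub> lin_ext m g x"
  unfolding lin_ext_def tens_def by (simp only: module.simps mult.assoc sum_distrib_left)

definition contract :: "nat \<Rightarrow> nat \<Rightarrow> (bit list \<Rightarrow> bit) \<Rightarrow> bit list \<Rightarrow> bit" where
  "contract m i = lin_ext m (\<lambda>a. onehot (a ! i))"

definition gate_map :: "('v, 'e) circuit \<Rightarrow> 'v \<Rightarrow> nat \<Rightarrow> (bit list \<Rightarrow> bit) \<Rightarrow> bit list \<Rightarrow> bit" where
  "gate_map C v j = lin_ext (length (ins C v)) (\<lambda>a. onehot (gate C v a ! j))"

definition index_of :: "'e list \<Rightarrow> 'e \<Rightarrow> nat" where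
  "index_of es e = (THE i. i < length es \<and> es ! i = e)"

definition vertex_basic :: "('v, 'e) ext_digraph \<Rightarrow> 'v \<Rightarrow> ('v, 'e) point set \<Rightarrow> bool" where
  "vertex_basic G v U \<longleftrightarrow>
    openin (graph_top G) U \<and> contractible_space (subtopology (graph_top G) U) \<and>
    {w. Vert w \<in> U} = {v}"

definition edge_basic :: "('v, 'e) ext_digraph \<Rightarrow> 'e \<Rightarrow> ('v, 'e) point set \<Rightarrow> bool" where
  "edge_basic G e V \<longleftrightarrow>
    openin (graph_top G) V \<and> connectedin (graph_top G) V \<and> V \<noteq> {} \<and> V \<subseteq> Inner e ` {0<..<1}"

text \<open>In the restriction from a neighbourhood of \<open>v\<close> to an interval \<open>V\<close> on the edge \<open>e\<close>, exactly one of
  the two cases ``incoming'' and ``outgoing'' applies if the graph has no loops.\<close>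

definition switching_presheaf ::
  "('v, 'e) ext_digraph \<Rightarrow> ('v, 'e) circuit \<Rightarrow> (('v, 'e) point, bit, bit list \<Rightarrow> bit) presheaf" where
  "switching_presheaf G C =
    \<lparr>opens = {U. (\<exists>v\<in>verts G. vertex_basic G v U) \<or> (\<exists>e\<in>edges G. edge_basic G e U)},
     sect = (\<lambda>U. if \<exists>v\<in>verts G. vertex_basic G v U
                 then tens (length (ins C (THE v. vertex_basic G v U)))
                 else tens 1),
     restr = (\<lambda>U V x.
       if (\<exists>v\<in>verts G. vertex_basic G v U) \<and> (\<exists>e\<in>edges G. edge_basic G e V) then
         let v = (THE v. vertex_basic G v U); e = (THE e. edge_basic G e V) in
           if e \<in> in_edges G v
           then contract (length (ins C v)) (index_of (ins C v) e) x
           else gate_map C v (index_of (outs C v) e) x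
       else x)\<rparr>"

definition switching_sheaf ::
  "('v, 'e) ext_digraph \<Rightarrow> ('v, 'e) circuit \<Rightarrow>
   (('v, 'e) point, bit, ('v, 'e) point \<Rightarrow> (('v, 'e) point set \<times> (bit list \<Rightarrow> bit)) set) presheaf" where
  "switching_sheaf G C = sheafify (graph_top G) (switching_presheaf G C)"

end

theory Submission
  imports Defs
begin

text \<open>Two cochains which represent the same section \<open>z\<close> of \<open>Z1 F\<close> differ by a section of \<open>F\<close>, so
  \<open>H\<^sup>1\<close> vanishes if every such \<open>z\<close> is represented by a global cochain. Over an open edge the
  switching sheaf is constant, and \<open>z\<close> is represented there because an interval is connected and
  compact subintervals suffice. Near a vertex \<open>z\<close> is represented by definition. To make these
  representatives fit together one has to solve, for prescribed right-hand sides \<open>h\<^sub>e\<close>, the equations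
  ``contraction at the target of \<open>e\<close>'' = ``gate at the source of \<open>e\<close>'' + \<open>h\<^sub>e\<close> over all internal edges.

  All maps involved preserve the sum of the coordinates of a tensor. The sums of the unknown tensors
  are found first, as a potential on the undirected tree. Then the tensors are chosen one vertex after
  the other along the directions of the edges: a tensor with prescribed contractions exists as soon as
  these have equal sums. The homogeneous system describes the global sections, so the
  dimension formula follows by counting, since a tree with \<open>n\<close> vertices has \<open>n - 1\<close> internal edges.\<close>

section \<open>Modules\<close>

text \<open>In degree 1 the Godement cocycles are exactly the global sections of
  \<open>Z1 F\<close>, so the vanishing of H^1 is the surjectivity of one map on global sections.
  Working with the lifts of one given section replaces a comparison with Cech cohomology. The
  obstacle is that a gate is an arbitrary function: at a vertex nothing can be arranged about the
  outgoing values, only the values on incoming edges can be prescribed. The sum of the coordinates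
  is the sole constraint there, since it is the linear form with value 1 on every basis tensor and
  all contractions of one tensor share it. Settling the sums beforehand guarantees that no later
  choice meets an obstruction. The absence of undirected cycles enters through one lemma on
  potentials, used three times: for the sums, with increment 1 to order the vertices, and with
  coefficients in the field of two elements to count the internal edges. Over this field the size of
  a finite space determines its dimension. So the global sections only have to be matched
  bijectively with families of tensors.\<close>

lemma module_homI:
  assumes "\<And>a. a \<in> carrier M \<Longrightarrow> f a \<in> carrier N"
    and "\<And>a b. a \<in> carrier M \<Longrightarrow> b \<in> carrier M \<Longrightarrow> f (a \<oplus>\<^bsub>M\<^esub> b) = f a \<oplus>\<^bsub>N\<^esub> f b"
    and "\<And>c a. c \<in> carrier R \<Longrightarrow> a \<in> carrier M \<Longrightarrow> f (c \<odot>\<^bsub>M\<^esub> a) = c \<odot>\<^bsub>N\<^esub> f a"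
  shows "f \<in> module_hom R M N"
  using assms unfolding module_hom_def by auto

lemma module_hom_mem: "f \<in> module_hom R M N \<Longrightarrow> a \<in> carrier M \<Longrightarrow> f a \<in> carrier N"
  unfolding module_hom_def by auto

lemma module_hom_zero:
  assumes "module R M" "module R N" "f \<in> module_hom R M N"
  shows "f \<zero>\<^bsub>M\<^esub> = \<zero>\<^bsub>N\<^esub>"
  using assms by (intro mod_hom.f0_is_0[of R]) (auto intro!: mod_hom.intro mod_hom_axioms.intro)

lemma module_hom_minus:
  assumes "module R M" "module R N" "f \<in> module_hom R M N" "a \<in> carrier M" "b \<in> carrier M"
  shows "f (a \<ominus>\<^bsub>M\<^esub> b) = f a \<ominus>\<^bsub>N\<^esub> f b"
  using assms by (intro mod_hom.f_minus[of R]) (auto intro!: mod_hom.intro mod_hom_axioms.intro)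

lemma module_hom_comp:
  assumes "f \<in> module_hom R M N" "g \<in> module_hom R N P"
  shows "(\<lambda>a. g (f a)) \<in> module_hom R M P"
  using assms
  by (intro module_homI) (simp_all add: module_hom_mem module_hom_add[OF assms(1)]
      module_hom_smult[OF assms(1)] module_hom_add[OF assms(2)] module_hom_smult[OF assms(2)])

lemma module_image_submodule:
  assumes "module R M" "module R N" "f \<in> module_hom R M N"
  shows "submodule R (f ` carrier M) N"
proof -
  interpret mod_hom R M N f
    using assms by (auto intro!: mod_hom.intro mod_hom_axioms.intro)
  show ?thesis
    using im_is_submodule by (simp add: im_def)
qed

text \<open>Stalks and quotients are both covered by homomorphic images of modules, so that the module
  axioms can be checked there.\<close>

lemma module_by_charts:
  fixes R :: "('k, 'm) ring_scheme" and Q :: "('k, 'b) module"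
  assumes R: "cring R" and zero: "\<zero>\<^bsub>Q\<^esub> \<in> carrier Q"
    and chart: "\<And>x y z. x \<in> carrier Q \<Longrightarrow> y \<in> carrier Q \<Longrightarrow> z \<in> carrier Q \<Longrightarrow>
      \<exists>(M :: ('k, 'a) module) q. module R M \<and> q \<in> module_hom R M Q \<and> q \<zero>\<^bsub>M\<^esub> = \<zero>\<^bsub>Q\<^esub> \<and>
        x \<in> q ` carrier M \<and> y \<in> q ` carrier M \<and> z \<in> q ` carrier M"
  shows "module R Q"
proof -
  \<comment> \<open>Each module axiom involves at most three elements, so one chart whose image
    contains all three transports the axiom from \<open>M\<close>.\<close>
  have laws: "x \<oplus>\<^bsub>Q\<^esub> y \<in> carrier Q \<and> x \<oplus>\<^bsub>Q\<^esub> y \<oplus>\<^bsub>Q\<^esub> z = x \<oplus>\<^bsub>Q\<^esub> (y \<oplus>\<^bsub>Q\<^esub> z) \<and> x \<oplus>\<^bsub>Q\<^esub> y = y \<oplus>\<^bsub>Q\<^esub> x \<and>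
      \<zero>\<^bsub>Q\<^esub> \<oplus>\<^bsub>Q\<^esub> x = x \<and> (\<exists>w\<in>carrier Q. w \<oplus>\<^bsub>Q\<^esub> x = \<zero>\<^bsub>Q\<^esub>) \<and> \<one>\<^bsub>R\<^esub> \<odot>\<^bsub>Q\<^esub> x = x \<and>
      (\<forall>k\<in>carrier R. k \<odot>\<^bsub>Q\<^esub> x \<in> carrier Q \<and> k \<odot>\<^bsub>Q\<^esub> (x \<oplus>\<^bsub>Q\<^esub> y) = k \<odot>\<^bsub>Q\<^esub> x \<oplus>\<^bsub>Q\<^esub> k \<odot>\<^bsub>Q\<^esub> y) \<and>
      (\<forall>k\<in>carrier R. \<forall>l\<in>carrier R. (k \<oplus>\<^bsub>R\<^esub> l) \<odot>\<^bsub>Q\<^esub> x = k \<odot>\<^bsub>Q\<^esub> x \<oplus>\<^bsub>Q\<^esub> l \<odot>\<^bsub>Q\<^esub> x \<and>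
        (k \<otimes>\<^bsub>R\<^esub> l) \<odot>\<^bsub>Q\<^esub> x = k \<odot>\<^bsub>Q\<^esub> (l \<odot>\<^bsub>Q\<^esub> x))"
    if xyz: "x \<in> carrier Q" "y \<in> carrier Q" "z \<in> carrier Q" for x y z
  proof -
    obtain M :: "('k, 'a) module" and q a b c where M: "module R M" and q: "q \<in> module_hom R M Q"
      and q0: "q \<zero>\<^bsub>M\<^esub> = \<zero>\<^bsub>Q\<^esub>" and abc: "a \<in> carrier M" "b \<in> carrier M" "c \<in> carrier M"
      and x: "x = q a" and y: "y = q b" and z: "z = q c"
      using chart[OF xyz] by blast
    interpret M: Module.module R M by fact
    have "q (\<ominus>\<^bsub>M\<^esub> a) \<in> carrier Q" "q (\<ominus>\<^bsub>M\<^esub> a) \<oplus>\<^bsub>Q\<^esub> q a = \<zero>\<^bsub>Q\<^esub>"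
      using abc module_hom_mem[OF q] by (simp_all add: M.M.l_neg flip: q0 module_hom_add[OF q])
    then have "\<exists>w\<in>carrier Q. w \<oplus>\<^bsub>Q\<^esub> q a = \<zero>\<^bsub>Q\<^esub>"
      by blast
    then show ?thesis
      unfolding x y z using abc module_hom_mem[OF q]
      by (simp add: M.M.a_ac M.smult_l_distr M.smult_r_distr M.smult_assoc1
          flip: q0 module_hom_add[OF q] module_hom_smult[OF q])
  qed
  have "abelian_group Q"
    by (rule abelian_groupI) (use laws zero in \<open>blast+\<close>)
  with R show ?thesis
    by (rule Module.moduleI) (use laws in \<open>blast+\<close>)
qed

lemma prod_module_module:
  assumes R: "cring R" and M: "\<And>i. i \<in> I \<Longrightarrow> module R (M i)"
  shows "module R (prod_module I M)"
proof (rule Module.moduleI[OF R])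
  have sub: "i \<in> I \<Longrightarrow> Module.module R (M i)" for i
    using M .
  note a = abelian_groupE[OF Module.module.axioms(2)[OF sub]]
  show "abelian_group (prod_module I M)"
  proof (rule abelian_groupI)
    fix x assume "x \<in> carrier (prod_module I M)"
    then have x: "x \<in> (\<Pi>\<^sub>E i\<in>I. carrier (M i))"
      by (simp add: prod_module_def)
    have "(\<lambda>i\<in>I. \<ominus>\<^bsub>M i\<^esub> x i) \<in> (\<Pi>\<^sub>E i\<in>I. carrier (M i))"
      using x by (auto intro: abelian_group.a_inv_closed[OF Module.module.axioms(2)[OF sub]])
    moreover have "(\<lambda>i\<in>I. \<ominus>\<^bsub>M i\<^esub> x i) \<oplus>\<^bsub>prod_module I M\<^esub> x = \<zero>\<^bsub>prod_module I M\<^esub>"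
      using x by (auto simp: prod_module_def fun_eq_iff
          intro!: abelian_group.l_neg[OF Module.module.axioms(2)[OF sub]])
    ultimately show "\<exists>y\<in>carrier (prod_module I M). y \<oplus>\<^bsub>prod_module I M\<^esub> x = \<zero>\<^bsub>prod_module I M\<^esub>"
      by (intro bexI[of _ "\<lambda>i\<in>I. \<ominus>\<^bsub>M i\<^esub> x i"]) (simp_all add: prod_module_def)
    show "\<zero>\<^bsub>prod_module I M\<^esub> \<oplus>\<^bsub>prod_module I M\<^esub> x = x"
      using x by (auto simp: prod_module_def fun_eq_iff PiE_iff extensional_def intro!: a)
  qed (auto simp: prod_module_def PiE_iff intro!: a restrict_ext)
qed (auto simp: prod_module_def PiE_iff fun_eq_iff extensional_def
    Module.module.smult_closed[OF M] Module.module.smult_l_distr[OF M] Module.module.smult_r_distr[OF M]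
    Module.module.smult_assoc1[OF M] Module.module.smult_one[OF M]
    abelian_groupE(1)[OF Module.module.axioms(2)[OF M]] cring.cring_simprules[OF R])

lemma submodule_abelian_subgroup:
  assumes "submodule R N M"
  shows "abelian_subgroup N M"
proof -
  interpret N: submodule R N M by fact
  interpret M: Module.module R M by (rule N.module)
  have "subgroup N (add_monoid M)"
  proof (rule group.subgroupI[OF M.a_group])
    show "inv\<^bsub>add_monoid M\<^esub> a \<in> N" if "a \<in> N" for a
    proof -
      \<comment> \<open>Negation is multiplication by the scalar -1, under which a submodule is
        closed.\<close>
      have "(\<ominus>\<^bsub>R\<^esub> \<one>\<^bsub>R\<^esub>) \<odot>\<^bsub>M\<^esub> a \<in> N"
        using that by (intro N.smult_closed) auto
      also have "(\<ominus>\<^bsub>R\<^esub> \<one>\<^bsub>R\<^esub>) \<odot>\<^bsub>M\<^esub> a = \<ominus>\<^bsub>M\<^esub> a"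
        using that N.subset M.smult_minus_1[of a] by blast
      finally show ?thesis
        by (simp add: a_inv_def)
    qed
  qed (use N.subset N.zero_closed in \<open>auto simp del: N.zero_closed\<close>)
  then show ?thesis
    by (rule abelian_subgroupI3[OF additive_subgroupI M.abelian_group_axioms])
qed

lemma rcos_eq_iff:
  assumes "submodule R N M" "a \<in> carrier M" "b \<in> carrier M"
  shows "N +>\<^bsub>M\<^esub> a = N +>\<^bsub>M\<^esub> b \<longleftrightarrow> a \<ominus>\<^bsub>M\<^esub> b \<in> N"
proof -
  interpret abelian_subgroup N M
    by (rule submodule_abelian_subgroup[OF assms(1)])
  show ?thesis
    using assms(2,3) a_rcos_module[of b a] a_repr_independence'[of a b] a_rcos_self[of a]
    by (auto simp: a_minus_def)
qed

lemma zero_quot_module: "\<zero>\<^bsub>quot_module M N\<^esub> = N"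
  by (simp add: quot_module_def)

lemma carrier_quot_module: "carrier (quot_module M N) = (\<lambda>a. N +>\<^bsub>M\<^esub> a) ` carrier M"
  by (auto simp: quot_module_def A_RCOSETS_defs a_r_coset_defs)

lemma quot_module_hom:
  assumes N: "submodule R N M"
  shows "(\<lambda>a. N +>\<^bsub>M\<^esub> a) \<in> module_hom R M (quot_module M N)"
proof (rule module_homI)
  interpret N: submodule R N M by fact
  interpret M: Module.module R M by (rule N.module)
  interpret abelian_subgroup N M
    by (rule submodule_abelian_subgroup[OF assms])
  show "N +>\<^bsub>M\<^esub> a \<in> carrier (quot_module M N)" if "a \<in> carrier M" for a
    using that by (simp add: carrier_quot_module)
  show "N +>\<^bsub>M\<^esub> (a \<oplus>\<^bsub>M\<^esub> b) = (N +>\<^bsub>M\<^esub> a) \<oplus>\<^bsub>quot_module M N\<^esub> (N +>\<^bsub>M\<^esub> b)"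
    if "a \<in> carrier M" "b \<in> carrier M" for a b
    using that by (simp add: quot_module_def a_rcos_sum)
  show "N +>\<^bsub>M\<^esub> (c \<odot>\<^bsub>M\<^esub> a) = c \<odot>\<^bsub>quot_module M N\<^esub> (N +>\<^bsub>M\<^esub> a)"
    if c: "c \<in> carrier R" and a: "a \<in> carrier M" for c a
  proof -
    \<comment> \<open>The scalar product in \<open>quot_module\<close> is a union over all members
      of the coset. The multiples of two members differ by an element of \<open>N\<close>, so the
      union is over equal cosets.\<close>
    have eq: "N +>\<^bsub>M\<^esub> (c \<odot>\<^bsub>M\<^esub> b) = N +>\<^bsub>M\<^esub> (c \<odot>\<^bsub>M\<^esub> a)" if b: "b \<in> N +>\<^bsub>M\<^esub> a" for b
    proof -
      have bM: "b \<in> carrier M"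
        using a_elemrcos_carrier[OF a b] .
      have "b \<ominus>\<^bsub>M\<^esub> a \<in> N"
        using a_rcos_module_imp[OF a b] by (simp add: a_minus_def)
      then have "c \<odot>\<^bsub>M\<^esub> (b \<ominus>\<^bsub>M\<^esub> a) \<in> N"
        using c by blast
      also have "c \<odot>\<^bsub>M\<^esub> (b \<ominus>\<^bsub>M\<^esub> a) = c \<odot>\<^bsub>M\<^esub> b \<ominus>\<^bsub>M\<^esub> c \<odot>\<^bsub>M\<^esub> a"
        using a bM c by (simp add: a_minus_def M.smult_r_distr M.smult_r_minus)
      finally show ?thesis
        using a bM c by (subst rcos_eq_iff[OF N]) auto
    qed
    have "c \<odot>\<^bsub>quot_module M N\<^esub> (N +>\<^bsub>M\<^esub> a) = (\<Union>b\<in>N +>\<^bsub>M\<^esub> a. N +>\<^bsub>M\<^esub> (c \<odot>\<^bsub>M\<^esub> a))"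
      unfolding quot_module_def module.simps using eq by (intro SUP_cong) auto
    also have "\<dots> = N +>\<^bsub>M\<^esub> (c \<odot>\<^bsub>M\<^esub> a)"
      using a_rcos_self[OF a] by blast
    finally show ?thesis ..
  qed
qed

lemma quot_module_module:
  fixes M :: "('k, 'a) module"
  assumes N: "submodule R N M"
  shows "module R (quot_module M N)"
proof -
  interpret N: submodule R N M by fact
  interpret M: Module.module R M by (rule N.module)
  interpret abelian_subgroup N M
    by (rule submodule_abelian_subgroup[OF assms])
  have z: "N +>\<^bsub>M\<^esub> \<zero>\<^bsub>M\<^esub> = \<zero>\<^bsub>quot_module M N\<^esub>"
    using a_rcos_const[of "\<zero>\<^bsub>M\<^esub>"] by (simp add: zero_quot_module)
  show ?thesis
  proof (rule module_by_charts[OF M.R.cring_axioms])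
    show "\<zero>\<^bsub>quot_module M N\<^esub> \<in> carrier (quot_module M N)"
      using z by (force simp: carrier_quot_module)
    fix x y z' assume "x \<in> carrier (quot_module M N)" "y \<in> carrier (quot_module M N)"
      "z' \<in> carrier (quot_module M N)"
    then show "\<exists>(M' :: ('k, 'a) module) q. module R M' \<and> q \<in> module_hom R M' (quot_module M N) \<and>
      q \<zero>\<^bsub>M'\<^esub> = \<zero>\<^bsub>quot_module M N\<^esub> \<and> x \<in> q ` carrier M' \<and> y \<in> q ` carrier M' \<and> z' \<in> q ` carrier M'"
      using z quot_module_hom[OF N] M.module_axioms carrier_quot_module[of M N]
      by (intro exI[of _ M] exI[of _ "\<lambda>a. N +>\<^bsub>M\<^esub> a"]) auto
  qed
qed

section \<open>Presheaves of modules\<close>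

text \<open>Sections exist over a base only, and the base need not be closed under intersections.
  Two basic sets around a point are therefore compared on a smaller basic set, as in
  \<open>opens_refine\<close>. The locale serves both the switching presheaf on its base and the
  presheaves on all open sets.\<close>

locale module_presheaf =
  fixes R :: "('k, 'm) ring_scheme" and X :: "'p topology" and F :: "('p, 'k, 'a) presheaf"
  assumes cring: "cring R"
    and opens_openin: "U \<in> opens F \<Longrightarrow> openin X U"
    and opens_base: "openin X U \<Longrightarrow> x \<in> U \<Longrightarrow> \<exists>B\<in>opens F. x \<in> B \<and> B \<subseteq> U"
    and sect_module: "U \<in> opens F \<Longrightarrow> module R (sect F U)"
    and restr_hom: "U \<in> opens F \<Longrightarrow> V \<in> opens F \<Longrightarrow> V \<subseteq> U \<Longrightarrow>
      restr F U V \<in> module_hom R (sect F U) (sect F V)"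
    and restr_id: "U \<in> opens F \<Longrightarrow> s \<in> carrier (sect F U) \<Longrightarrow> restr F U U s = s"
    and restr_restr: "U \<in> opens F \<Longrightarrow> V \<in> opens F \<Longrightarrow> W \<in> opens F \<Longrightarrow> W \<subseteq> V \<Longrightarrow> V \<subseteq> U \<Longrightarrow>
      s \<in> carrier (sect F U) \<Longrightarrow> restr F V W (restr F U V s) = restr F U W s"
begin

lemma restr_mem:
  "U \<in> opens F \<Longrightarrow> V \<in> opens F \<Longrightarrow> V \<subseteq> U \<Longrightarrow> s \<in> carrier (sect F U) \<Longrightarrow>
    restr F U V s \<in> carrier (sect F V)"
  using module_hom_mem[OF restr_hom] .

lemma opens_refine:
  assumes "U \<in> opens F" "V \<in> opens F" "x \<in> U" "x \<in> V"
  obtains B where "B \<in> opens F" "x \<in> B" "B \<subseteq> U" "B \<subseteq> V"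
  using opens_base[of "U \<inter> V" x] assms opens_openin by auto

lemma opens_topspace: "U \<in> opens F \<Longrightarrow> x \<in> U \<Longrightarrow> x \<in> topspace X"
  using opens_openin openin_subset by blast

lemma topspace_opens:
  assumes "x \<in> topspace X" obtains U where "U \<in> opens F" "x \<in> U"
  using opens_base[of "topspace X" x] assms by auto

lemma germ_self:
  "U \<in> opens F \<Longrightarrow> x \<in> U \<Longrightarrow> s \<in> carrier (sect F U) \<Longrightarrow> (U, s) \<in> germ F x U s"
  unfolding germ_def by auto

text \<open>\<open>germ F x U s\<close> is the class of the pair \<open>(U, s)\<close> under
  agreement near \<open>x\<close>. The content is the transitivity of this relation, seen on a basic
  set inside both neighbourhoods of agreement.\<close>

lemma germ_eq_iff:
  assumes "U \<in> opens F" "V \<in> opens F" "x \<in> U" "x \<in> V"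
    "s \<in> carrier (sect F U)" "t \<in> carrier (sect F V)"
  shows "germ F x U s = germ F x V t \<longleftrightarrow>
    (\<exists>B\<in>opens F. x \<in> B \<and> B \<subseteq> U \<inter> V \<and> restr F U B s = restr F V B t)"
proof
  assume "germ F x U s = germ F x V t"
  then have "(V, t) \<in> germ F x U s"
    using germ_self assms by simp
  then show "\<exists>B\<in>opens F. x \<in> B \<and> B \<subseteq> U \<inter> V \<and> restr F U B s = restr F V B t"
    unfolding germ_def by auto
next
  have sub: "germ F x V t \<subseteq> germ F x U s"
    if U: "U \<in> opens F" and V: "V \<in> opens F" and s: "s \<in> carrier (sect F U)"
      and t: "t \<in> carrier (sect F V)" and B: "B \<in> opens F" "x \<in> B" "B \<subseteq> U \<inter> V"
      and eq: "restr F U B s = restr F V B t"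
    for U V s t B
  proof
    fix p assume "p \<in> germ F x V t"
    then obtain W r B' where p: "p = (W, r)" and W: "W \<in> opens F" "x \<in> W" "r \<in> carrier (sect F W)"
      and B': "B' \<in> opens F" "x \<in> B'" "B' \<subseteq> V \<inter> W" "restr F V B' t = restr F W B' r"
      unfolding germ_def by auto
    obtain D where D: "D \<in> opens F" "x \<in> D" "D \<subseteq> B" "D \<subseteq> B'"
      using opens_refine B B' by metis
    have "restr F U D s = restr F B D (restr F U B s)"
      using U s B D by (subst restr_restr) auto
    also have "\<dots> = restr F V D t"
      using V t B D unfolding eq by (subst restr_restr) auto
    also have "\<dots> = restr F B' D (restr F V B' t)"
      using V t B' D by (subst restr_restr) auto
    also have "\<dots> = restr F W D r"
      unfolding B'(4) using W B' D by (subst restr_restr) auto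
    finally show "p \<in> germ F x U s"
      using W D B B' unfolding germ_def p by blast
  qed
  assume "\<exists>B\<in>opens F. x \<in> B \<and> B \<subseteq> U \<inter> V \<and> restr F U B s = restr F V B t"
  then obtain B where "B \<in> opens F" "x \<in> B" "B \<subseteq> U \<inter> V" "restr F U B s = restr F V B t"
    by auto
  then show "germ F x U s = germ F x V t"
    using sub[of U V s t B] sub[of V U t s B] assms by auto
qed

lemma germ_restr:
  assumes "U \<in> opens F" "V \<in> opens F" "V \<subseteq> U" "x \<in> V" "s \<in> carrier (sect F U)"
  shows "germ F x V (restr F U V s) = germ F x U s"
  using assms restr_mem[OF assms(1-3,5)]
  by (subst germ_eq_iff) (auto intro!: bexI[of _ V] simp: restr_restr)

lemma mem_germD:
  assumes "U \<in> opens F" "x \<in> U" "s \<in> carrier (sect F U)" "(W, t) \<in> germ F x U s"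
  shows "W \<in> opens F" "x \<in> W" "t \<in> carrier (sect F W)" "germ F x W t = germ F x U s"
proof -
  show W: "W \<in> opens F" "x \<in> W" "t \<in> carrier (sect F W)"
    using assms(4) unfolding germ_def by auto
  show "germ F x W t = germ F x U s"
    using assms W by (subst eq_commute, subst germ_eq_iff) (auto simp: germ_def)
qed

lemma carrier_stalk:
  "carrier (stalk F x) = {germ F x U s | U s. U \<in> opens F \<and> x \<in> U \<and> s \<in> carrier (sect F U)}"
  by (simp add: stalk_def)

lemma germ_in_stalk:
  "U \<in> opens F \<Longrightarrow> x \<in> U \<Longrightarrow> s \<in> carrier (sect F U) \<Longrightarrow> germ F x U s \<in> carrier (stalk F x)"
  unfolding carrier_stalk by blast

lemma stalk_obtain:
  assumes "g \<in> carrier (stalk F x)"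
  obtains U s where "U \<in> opens F" "x \<in> U" "s \<in> carrier (sect F U)" "g = germ F x U s"
  using assms unfolding carrier_stalk by blast

lemma stalk_zero:
  assumes U: "U \<in> opens F" "x \<in> U"
  shows "\<zero>\<^bsub>stalk F x\<^esub> = germ F x U \<zero>\<^bsub>sect F U\<^esub>"
proof -
  have z: "\<zero>\<^bsub>sect F B\<^esub> \<in> carrier (sect F B)" if "B \<in> opens F" for B
    using abelian_groupE(2)[OF Module.module.axioms(2)[OF sect_module[OF that]]] .
  have "germ F x B \<zero>\<^bsub>sect F B\<^esub> = germ F x U \<zero>\<^bsub>sect F U\<^esub>" if B: "B \<in> opens F" "x \<in> B" for B
  proof -
    obtain D where D: "D \<in> opens F" "x \<in> D" "D \<subseteq> B" "D \<subseteq> U"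
      using opens_refine U B by metis
    have "restr F V D \<zero>\<^bsub>sect F V\<^esub> = \<zero>\<^bsub>sect F D\<^esub>" if "V \<in> opens F" "D \<subseteq> V" for V
      using that D by (intro module_hom_zero[of R] sect_module restr_hom)
    then show ?thesis
      using U B D z by (subst germ_eq_iff) (auto intro!: bexI[of _ D])
  qed
  then have "{germ F x B \<zero>\<^bsub>sect F B\<^esub> | B. B \<in> opens F \<and> x \<in> B} = {germ F x U \<zero>\<^bsub>sect F U\<^esub>}"
    using U by blast
  then show ?thesis
    by (simp add: stalk_def)
qed

lemma stalk_add:
  assumes U: "U \<in> opens F" "x \<in> U" and s: "s \<in> carrier (sect F U)" and t: "t \<in> carrier (sect F U)"
  shows "germ F x U s \<oplus>\<^bsub>stalk F x\<^esub> germ F x U t = germ F x U (s \<oplus>\<^bsub>sect F U\<^esub> t)"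
proof -
  have cl: "a \<oplus>\<^bsub>sect F B\<^esub> b \<in> carrier (sect F B)"
    if "B \<in> opens F" "a \<in> carrier (sect F B)" "b \<in> carrier (sect F B)" for B a b
    using abelian_groupE(1)[OF Module.module.axioms(2)[OF sect_module[OF that(1)]]] that by simp
  have eq: "germ F x B (restr F V B a \<oplus>\<^bsub>sect F B\<^esub> restr F V' B b) = germ F x U (s \<oplus>\<^bsub>sect F U\<^esub> t)"
    if a: "(V, a) \<in> germ F x U s" and b: "(V', b) \<in> germ F x U t"
      and B: "B \<in> opens F" "x \<in> B" "B \<subseteq> V \<inter> V'" for B V a V' b
  proof -
    note a' = mem_germD[OF U s a] and b' = mem_germD[OF U t b]
    from a obtain D where D: "D \<in> opens F" "x \<in> D" "D \<subseteq> U \<inter> V" "restr F U D s = restr F V D a"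
      unfolding germ_def by auto
    from b obtain D' where D': "D' \<in> opens F" "x \<in> D'" "D' \<subseteq> U \<inter> V'" "restr F U D' t = restr F V' D' b"
      unfolding germ_def by auto
    obtain E0 where E0: "E0 \<in> opens F" "x \<in> E0" "E0 \<subseteq> D" "E0 \<subseteq> D'"
      using opens_refine D D' by metis
    \<comment> \<open>\<open>E\<close> lies in \<open>B\<close> and in both neighbourhoods of
      agreement, so over \<open>E\<close> the representatives \<open>a\<close> and \<open>b\<close>
      may be replaced by \<open>s\<close> and \<open>t\<close>.\<close>
    obtain E where E: "E \<in> opens F" "x \<in> E" "E \<subseteq> E0" "E \<subseteq> B"
      using opens_refine E0 B by metis
    have "restr F B E (restr F V B a \<oplus>\<^bsub>sect F B\<^esub> restr F V' B b) =
        restr F B E (restr F V B a) \<oplus>\<^bsub>sect F E\<^esub> restr F B E (restr F V' B b)"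
      using a' b' B E by (intro module_hom_add[OF restr_hom] restr_mem) auto
    also have "restr F B E (restr F V B a) = restr F V E a"
      using a' B E by (intro restr_restr) auto
    also have "\<dots> = restr F D E (restr F V D a)"
      using a' D E0 E by (subst restr_restr) auto
    also have "\<dots> = restr F U E s"
      unfolding D(4)[symmetric] using s U D E0 E by (intro restr_restr) auto
    also have "restr F B E (restr F V' B b) = restr F V' E b"
      using b' B E by (intro restr_restr) auto
    also have "\<dots> = restr F D' E (restr F V' D' b)"
      using b' D' E0 E by (subst restr_restr) auto
    also have "\<dots> = restr F U E t"
      unfolding D'(4)[symmetric] using t U D' E0 E by (intro restr_restr) auto
    also have "restr F U E s \<oplus>\<^bsub>sect F E\<^esub> restr F U E t = restr F U E (s \<oplus>\<^bsub>sect F U\<^esub> t)"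
      using s t U D E0 E by (subst module_hom_add[OF restr_hom]) auto
    finally show ?thesis
      using a' b' B U s t D E0 E
      by (subst germ_eq_iff) (auto intro!: bexI[of _ E] cl restr_mem)
  qed
  have "{germ F x B (restr F V B a \<oplus>\<^bsub>sect F B\<^esub> restr F V' B b) | B V a V' b.
      (V, a) \<in> germ F x U s \<and> (V', b) \<in> germ F x U t \<and> B \<in> opens F \<and> x \<in> B \<and> B \<subseteq> V \<inter> V'} =
    {germ F x U (s \<oplus>\<^bsub>sect F U\<^esub> t)}" (is "?A = _")
  proof
    show "?A \<subseteq> {germ F x U (s \<oplus>\<^bsub>sect F U\<^esub> t)}"
      using eq by blast
    have "(U, s) \<in> germ F x U s" "(U, t) \<in> germ F x U t"
      using germ_self U s t by auto
    then show "{germ F x U (s \<oplus>\<^bsub>sect F U\<^esub> t)} \<subseteq> ?A"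
      using eq[of U s U t U] U by blast
  qed
  then show ?thesis
    by (simp add: stalk_def)
qed

lemma stalk_smult:
  assumes U: "U \<in> opens F" "x \<in> U" and s: "s \<in> carrier (sect F U)" and c: "c \<in> carrier R"
  shows "c \<odot>\<^bsub>stalk F x\<^esub> germ F x U s = germ F x U (c \<odot>\<^bsub>sect F U\<^esub> s)"
proof -
  have cl: "c \<odot>\<^bsub>sect F B\<^esub> a \<in> carrier (sect F B)"
    if "B \<in> opens F" "a \<in> carrier (sect F B)" for B a
    using Module.module.smult_closed[OF sect_module[OF that(1)] c that(2)] .
  have eq: "germ F x V (c \<odot>\<^bsub>sect F V\<^esub> a) = germ F x U (c \<odot>\<^bsub>sect F U\<^esub> s)"
    if a: "(V, a) \<in> germ F x U s" for V a
  proof -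
    note a' = mem_germD[OF U s a]
    from a obtain D where D: "D \<in> opens F" "x \<in> D" "D \<subseteq> U \<inter> V" "restr F U D s = restr F V D a"
      unfolding germ_def by auto
    have "restr F V D (c \<odot>\<^bsub>sect F V\<^esub> a) = c \<odot>\<^bsub>sect F D\<^esub> restr F V D a"
      using a' D c by (intro module_hom_smult[OF restr_hom]) auto
    also have "\<dots> = restr F U D (c \<odot>\<^bsub>sect F U\<^esub> s)"
      unfolding D(4)[symmetric] using U s D c by (intro module_hom_smult[OF restr_hom, symmetric]) auto
    finally show ?thesis
      using a' U s D by (subst germ_eq_iff) (auto intro!: bexI[of _ D] cl)
  qed
  have "{germ F x V (c \<odot>\<^bsub>sect F V\<^esub> a) | V a. (V, a) \<in> germ F x U s} =
    {germ F x U (c \<odot>\<^bsub>sect F U\<^esub> s)}"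
    using eq germ_self[OF U s] by blast
  then show ?thesis
    by (simp add: stalk_def)
qed

lemma germ_hom:
  assumes "U \<in> opens F" "x \<in> U"
  shows "germ F x U \<in> module_hom R (sect F U) (stalk F x)"
  using assms by (intro module_homI) (auto simp: stalk_add stalk_smult germ_in_stalk)

lemma stalk_common:
  assumes "g \<in> carrier (stalk F x)" "h \<in> carrier (stalk F x)"
  obtains U s t where "U \<in> opens F" "x \<in> U" "s \<in> carrier (sect F U)" "t \<in> carrier (sect F U)"
    "g = germ F x U s" "h = germ F x U t"
proof -
  obtain U s where U: "U \<in> opens F" "x \<in> U" "s \<in> carrier (sect F U)" "g = germ F x U s"
    using assms(1) by (rule stalk_obtain)
  obtain V t where V: "V \<in> opens F" "x \<in> V" "t \<in> carrier (sect F V)" "h = germ F x V t"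
    using assms(2) by (rule stalk_obtain)
  obtain B where B: "B \<in> opens F" "x \<in> B" "B \<subseteq> U" "B \<subseteq> V"
    using opens_refine U V by metis
  show thesis
    using U V B by (intro that[of B "restr F U B s" "restr F V B t"]) (auto simp: germ_restr restr_mem)
qed

text \<open>Three germs have representatives over one basic neighbourhood, and the germ map from its
  sections is the chart that \<open>module_by_charts\<close> asks for.\<close>

lemma stalk_module:
  assumes x: "x \<in> topspace X"
  shows "module R (stalk F x)"
proof (rule module_by_charts[OF cring])
  obtain U where U: "U \<in> opens F" "x \<in> U"
    using x by (rule topspace_opens)
  show "\<zero>\<^bsub>stalk F x\<^esub> \<in> carrier (stalk F x)"
    using U abelian_groupE(2)[OF Module.module.axioms(2)[OF sect_module[OF U(1)]]]
    by (simp add: stalk_zero germ_in_stalk)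
next
  fix f g h assume fgh: "f \<in> carrier (stalk F x)" "g \<in> carrier (stalk F x)" "h \<in> carrier (stalk F x)"
  obtain U s t where U: "U \<in> opens F" "x \<in> U" "s \<in> carrier (sect F U)" "t \<in> carrier (sect F U)"
    "f = germ F x U s" "g = germ F x U t"
    using fgh(1,2) by (rule stalk_common)
  obtain V r where V: "V \<in> opens F" "x \<in> V" "r \<in> carrier (sect F V)" "h = germ F x V r"
    using fgh(3) by (rule stalk_obtain)
  obtain B where B: "B \<in> opens F" "x \<in> B" "B \<subseteq> U" "B \<subseteq> V"
    using opens_refine U V by metis
  have "f = germ F x B (restr F U B s)" "g = germ F x B (restr F U B t)" "h = germ F x B (restr F V B r)"
    using U V B by (auto simp: germ_restr)
  moreover have "restr F U B s \<in> carrier (sect F B)" "restr F U B t \<in> carrier (sect F B)"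
    "restr F V B r \<in> carrier (sect F B)"
    using U V B by (auto intro: restr_mem)
  ultimately show "\<exists>(M :: ('k, 'a) module) q. module R M \<and> q \<in> module_hom R M (stalk F x) \<and>
      q \<zero>\<^bsub>M\<^esub> = \<zero>\<^bsub>stalk F x\<^esub> \<and> f \<in> q ` carrier M \<and> g \<in> q ` carrier M \<and> h \<in> q ` carrier M"
    using B by (intro exI[of _ "sect F B"] exI[of _ "germ F x B"])
      (simp add: sect_module germ_hom stalk_zero)
qed

lemma prod_stalk_module: "U \<subseteq> topspace X \<Longrightarrow> module R (prod_module U (stalk F))"
  by (rule prod_module_module[OF cring stalk_module]) auto

lemma germs_apply: "x \<in> U \<Longrightarrow> germs F U s x = germ F x U s"
  by (simp add: germs_def)

lemma germs_hom:
  assumes "U \<in> opens F"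
  shows "germs F U \<in> module_hom R (sect F U) (prod_module U (stalk F))"
  using assms by (intro module_homI)
    (auto simp: prod_module_def germs_def germ_in_stalk stalk_add stalk_smult fun_eq_iff)

lemma C0_image_submodule:
  "U \<in> opens F \<Longrightarrow> submodule R (C0_image F U) (prod_module U (stalk F))"
  using opens_openin openin_subset
  by (intro module_image_submodule sect_module prod_stalk_module germs_hom) auto

end

lemma restrict_prod_hom:
  "V \<subseteq> U \<Longrightarrow> (\<lambda>\<sigma>. restrict \<sigma> V) \<in> module_hom R (prod_module U M) (prod_module V M)"
  by (intro module_homI) (auto simp: prod_module_def fun_eq_iff)

section \<open>Sheaves of modules\<close>

text \<open>Both sheaf axioms are phrased by germs; together they say that the unit of
  sheafification is bijective on sections. This suits the Godement resolution, where a section is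
  met as its family of germs in \<open>C0_image\<close>.\<close>

locale module_sheaf = module_presheaf R X F
  for R :: "('k, 'm) ring_scheme" and X :: "'p topology" and F :: "('p, 'k, 'a) presheaf" +
  assumes opens_eq: "opens F = {U. openin X U}"
    and separated: "openin X U \<Longrightarrow> s \<in> carrier (sect F U) \<Longrightarrow> t \<in> carrier (sect F U) \<Longrightarrow>
      (\<And>x. x \<in> U \<Longrightarrow> germ F x U s = germ F x U t) \<Longrightarrow> s = t"
    and gluing: "openin X U \<Longrightarrow> \<sigma> \<in> extensional U \<Longrightarrow>
      (\<And>x. x \<in> U \<Longrightarrow> \<exists>V t. openin X V \<and> x \<in> V \<and> V \<subseteq> U \<and> t \<in> carrier (sect F V) \<and>
        (\<forall>y\<in>V. \<sigma> y = germ F y V t)) \<Longrightarrow> \<exists>s\<in>carrier (sect F U). \<sigma> = germs F U s"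

section \<open>Sheafification of a presheaf on a base\<close>

context module_presheaf
begin

text \<open>Local representability already forces the values into the stalks, so of the dependent
  product only extensionality remains to be stated.\<close>

lemma carrier_sheafify:
  "\<sigma> \<in> carrier (sect (sheafify X F) U) \<longleftrightarrow> \<sigma> \<in> extensional U \<and>
    (\<forall>x\<in>U. \<exists>B\<in>opens F. x \<in> B \<and> B \<subseteq> U \<and> (\<exists>s\<in>carrier (sect F B). \<forall>y\<in>B. \<sigma> y = germ F y B s))"
proof -
  have "\<sigma> \<in> (\<Pi>\<^sub>E x\<in>U. carrier (stalk F x))" if ext: "\<sigma> \<in> extensional U"
    and loc: "\<forall>x\<in>U. \<exists>B\<in>opens F. x \<in> B \<and> B \<subseteq> U \<and> (\<exists>s\<in>carrier (sect F B). \<forall>y\<in>B. \<sigma> y = germ F y B s)"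
  proof (rule PiE_I)
    fix x assume "x \<in> U"
    then obtain B s where "B \<in> opens F" "x \<in> B" "s \<in> carrier (sect F B)" "\<sigma> x = germ F x B s"
      using loc by blast
    then show "\<sigma> x \<in> carrier (stalk F x)"
      by (simp add: germ_in_stalk)
  qed (use ext in \<open>simp add: extensional_def\<close>)
  then show ?thesis
    unfolding sheafify_def by (auto simp: PiE_iff)
qed

lemma sheafify_submodule:
  assumes "openin X U"
  shows "submodule R (carrier (sect (sheafify X F) U)) (prod_module U (stalk F))"
proof (rule submodule.intro)
  have U: "U \<subseteq> topspace X"
    using assms openin_subset by blast
  then interpret M: Module.module R "prod_module U (stalk F)"
    by (rule prod_stalk_module)
  show "module R (prod_module U (stalk F))"
    by (rule M.module_axioms)
  show "carrier (sect (sheafify X F) U) \<subseteq> carrier (prod_module U (stalk F))"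
    by (auto simp: sheafify_def prod_module_def)
  have mod: "module R (sect F B)" if "B \<in> opens F" for B
    using that by (rule sect_module)
  note cl = abelian_groupE(1,2)[OF Module.module.axioms(2)[OF mod]] Module.module.smult_closed[OF mod]
  show "\<zero>\<^bsub>prod_module U (stalk F)\<^esub> \<in> carrier (sect (sheafify X F) U)"
    unfolding carrier_sheafify
  proof (intro conjI ballI)
    fix x assume "x \<in> U"
    then obtain B where B: "B \<in> opens F" "x \<in> B" "B \<subseteq> U"
      using opens_base[OF assms] by blast
    then show "\<exists>B\<in>opens F. x \<in> B \<and> B \<subseteq> U \<and>
        (\<exists>s\<in>carrier (sect F B). \<forall>y\<in>B. \<zero>\<^bsub>prod_module U (stalk F)\<^esub> y = germ F y B s)"
      using cl(2) by (intro bexI[of _ B] conjI bexI[of _ "\<zero>\<^bsub>sect F B\<^esub>"])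
        (auto simp: prod_module_def stalk_zero[OF B(1)])
  qed (simp add: prod_module_def)
  show "\<sigma> \<oplus>\<^bsub>prod_module U (stalk F)\<^esub> \<tau> \<in> carrier (sect (sheafify X F) U)"
    if \<sigma>: "\<sigma> \<in> carrier (sect (sheafify X F) U)" and \<tau>: "\<tau> \<in> carrier (sect (sheafify X F) U)" for \<sigma> \<tau>
    unfolding carrier_sheafify
  proof (intro conjI ballI)
    fix x assume x: "x \<in> U"
    obtain B s where B: "B \<in> opens F" "x \<in> B" "B \<subseteq> U"
      "s \<in> carrier (sect F B)" "\<And>y. y \<in> B \<Longrightarrow> \<sigma> y = germ F y B s"
      using \<sigma> x unfolding carrier_sheafify by blast
    obtain B' t where B': "B' \<in> opens F" "x \<in> B'" "B' \<subseteq> U"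
      "t \<in> carrier (sect F B')" "\<And>y. y \<in> B' \<Longrightarrow> \<tau> y = germ F y B' t"
      using \<tau> x unfolding carrier_sheafify by blast
    obtain D where D: "D \<in> opens F" "x \<in> D" "D \<subseteq> B" "D \<subseteq> B'"
      using opens_refine B B' by metis
    have "(\<sigma> \<oplus>\<^bsub>prod_module U (stalk F)\<^esub> \<tau>) y =
        germ F y D (restr F B D s \<oplus>\<^bsub>sect F D\<^esub> restr F B' D t)" if y: "y \<in> D" for y
    proof -
      have "germ F y D (restr F B D s) = \<sigma> y" "germ F y D (restr F B' D t) = \<tau> y"
        using B B' D y by (auto simp: germ_restr)
      then show ?thesis
        using B B' D y by (subst stalk_add[symmetric]) (auto simp: prod_module_def intro: restr_mem)
    qed
    then show "\<exists>B\<in>opens F. x \<in> B \<and> B \<subseteq> U \<and> (\<exists>s\<in>carrier (sect F B).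
        \<forall>y\<in>B. (\<sigma> \<oplus>\<^bsub>prod_module U (stalk F)\<^esub> \<tau>) y = germ F y B s)"
      using B B' D by (intro bexI[of _ D] conjI bexI[of _ "restr F B D s \<oplus>\<^bsub>sect F D\<^esub> restr F B' D t"])
        (auto intro: cl restr_mem)
  qed (simp add: prod_module_def)
  show "c \<odot>\<^bsub>prod_module U (stalk F)\<^esub> \<sigma> \<in> carrier (sect (sheafify X F) U)"
    if c: "c \<in> carrier R" and \<sigma>: "\<sigma> \<in> carrier (sect (sheafify X F) U)" for c \<sigma>
    unfolding carrier_sheafify
  proof (intro conjI ballI)
    fix x assume x: "x \<in> U"
    obtain B s where B: "B \<in> opens F" "x \<in> B" "B \<subseteq> U"
      "s \<in> carrier (sect F B)" "\<And>y. y \<in> B \<Longrightarrow> \<sigma> y = germ F y B s"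
      using \<sigma> x unfolding carrier_sheafify by blast
    then show "\<exists>B\<in>opens F. x \<in> B \<and> B \<subseteq> U \<and> (\<exists>s\<in>carrier (sect F B).
        \<forall>y\<in>B. (c \<odot>\<^bsub>prod_module U (stalk F)\<^esub> \<sigma>) y = germ F y B s)"
      using c by (intro bexI[of _ B] conjI bexI[of _ "c \<odot>\<^bsub>sect F B\<^esub> s"])
        (auto simp: prod_module_def subset_iff stalk_smult intro: cl)
  qed (simp add: prod_module_def)
qed

lemma sheafify_module:
  assumes "openin X U"
  shows "module R (sect (sheafify X F) U)"
proof -
  interpret M: Module.module R "prod_module U (stalk F)"
    using sheafify_submodule[OF assms] by (rule submodule.module)
  show ?thesis
    using M.submodule_is_module[OF sheafify_submodule[OF assms]]
    by (simp add: sheafify_def)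
qed

lemma sheafify_opens: "opens (sheafify X F) = {U. openin X U}"
  and sheafify_restr: "restr (sheafify X F) U V \<sigma> = restrict \<sigma> V"
  by (simp_all add: sheafify_def)

lemma sheafify_presheaf: "module_presheaf R X (sheafify X F)"
proof (rule module_presheaf.intro[OF cring])
  fix U V assume U: "U \<in> opens (sheafify X F)" and V: "V \<in> opens (sheafify X F)" "V \<subseteq> U"
  show "restr (sheafify X F) U V \<in> module_hom R (sect (sheafify X F) U) (sect (sheafify X F) V)"
  proof (rule module_homI)
    fix \<sigma> assume \<sigma>: "\<sigma> \<in> carrier (sect (sheafify X F) U)"
    show "restr (sheafify X F) U V \<sigma> \<in> carrier (sect (sheafify X F) V)"
      unfolding carrier_sheafify sheafify_restr
    proof (intro conjI ballI)
      fix x assume x: "x \<in> V"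
      obtain B s where B: "B \<in> opens F" "x \<in> B" "B \<subseteq> U"
        "s \<in> carrier (sect F B)" "\<And>y. y \<in> B \<Longrightarrow> \<sigma> y = germ F y B s"
        using \<sigma> x V(2) unfolding carrier_sheafify by blast
      obtain D where D: "D \<in> opens F" "x \<in> D" "D \<subseteq> B \<inter> V"
        using opens_base[of "B \<inter> V" x] B(1,2) x V(1) opens_openin[OF B(1)]
        by (auto simp: sheafify_opens)
      show "\<exists>B\<in>opens F. x \<in> B \<and> B \<subseteq> V \<and> (\<exists>s\<in>carrier (sect F B). \<forall>y\<in>B. restrict \<sigma> V y = germ F y B s)"
        using B D by (intro bexI[of _ D] conjI bexI[of _ "restr F B D s"])
          (auto simp: germ_restr subset_iff intro: restr_mem)
    qed simp
  qed (use V(2) in \<open>auto simp: sheafify_def prod_module_def fun_eq_iff\<close>)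
next
  fix U s assume "U \<in> opens (sheafify X F)" "s \<in> carrier (sect (sheafify X F) U)"
  then show "restr (sheafify X F) U U s = s"
    unfolding carrier_sheafify sheafify_restr by (simp add: extensional_restrict)
qed (auto simp: sheafify_opens sheafify_module sheafify_restr Int_absorb1)

lemma sheafify_germ_eq_iff:
  assumes "openin X U" "openin X V" "x \<in> U" "x \<in> V" "\<sigma> \<in> carrier (sect (sheafify X F) U)"
    "\<tau> \<in> carrier (sect (sheafify X F) V)"
  shows "germ (sheafify X F) x U \<sigma> = germ (sheafify X F) x V \<tau> \<longleftrightarrow>
    (\<exists>B. openin X B \<and> x \<in> B \<and> B \<subseteq> U \<inter> V \<and> (\<forall>y\<in>B. \<sigma> y = \<tau> y))"
proof -
  have "restrict \<sigma> B = restrict \<tau> B \<longleftrightarrow> (\<forall>y\<in>B. \<sigma> y = \<tau> y)" for B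
    by (metis restrict_apply' restrict_ext)
  then show ?thesis
    using assms module_presheaf.germ_eq_iff[OF sheafify_presheaf, of U V x \<sigma> \<tau>]
    by (simp add: sheafify_opens sheafify_restr Bex_def)
qed

lemma sheafify_sheaf: "module_sheaf R X (sheafify X F)"
proof (rule module_sheaf.intro[OF sheafify_presheaf module_sheaf_axioms.intro[OF sheafify_opens]])
  fix U \<sigma> \<tau> assume U: "openin X U" and \<sigma>: "\<sigma> \<in> carrier (sect (sheafify X F) U)"
    and \<tau>: "\<tau> \<in> carrier (sect (sheafify X F) U)"
    and eq: "\<And>x. x \<in> U \<Longrightarrow> germ (sheafify X F) x U \<sigma> = germ (sheafify X F) x U \<tau>"
  have "\<sigma> x = \<tau> x" if "x \<in> U" for x
    using eq[OF that] U \<sigma> \<tau> that by (auto simp: sheafify_germ_eq_iff)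
  moreover have "\<sigma> \<in> extensional U" "\<tau> \<in> extensional U"
    using \<sigma> \<tau> by (auto simp: carrier_sheafify)
  ultimately show "\<sigma> = \<tau>"
    by (metis extensionalityI)
next
  fix U and \<Sigma> :: "'p \<Rightarrow> ('p set \<times> ('p \<Rightarrow> ('p set \<times> 'a) set)) set"
  assume U: "openin X U" and ext: "\<Sigma> \<in> extensional U"
    and loc: "\<And>x. x \<in> U \<Longrightarrow> \<exists>V \<tau>. openin X V \<and> x \<in> V \<and> V \<subseteq> U \<and> \<tau> \<in> carrier (sect (sheafify X F) V) \<and>
      (\<forall>y\<in>V. \<Sigma> y = germ (sheafify X F) y V \<tau>)"
  then obtain V \<tau> where V: "\<And>x. x \<in> U \<Longrightarrow> openin X (V x)" "\<And>x. x \<in> U \<Longrightarrow> x \<in> V x"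
      "\<And>x. x \<in> U \<Longrightarrow> V x \<subseteq> U" "\<And>x. x \<in> U \<Longrightarrow> \<tau> x \<in> carrier (sect (sheafify X F) (V x))"
      "\<And>x y. x \<in> U \<Longrightarrow> y \<in> V x \<Longrightarrow> \<Sigma> y = germ (sheafify X F) y (V x) (\<tau> x)"
    by metis
  \<comment> \<open>The glued section takes at \<open>x\<close> the value of the local section
    chosen for \<open>x\<close>. Equal germs of the sheafification have equal values at the point,
    which makes this agree with every local section on its whole domain.\<close>
  define \<sigma> where "\<sigma> = (\<lambda>x\<in>U. \<tau> x x)"
  have \<sigma>: "\<sigma> y = \<tau> x y" if x: "x \<in> U" and y: "y \<in> V x" for x y
  proof -
    have "germ (sheafify X F) y (V x) (\<tau> x) = germ (sheafify X F) y (V y) (\<tau> y)"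
      using V x y by (metis subset_iff)
    then have "\<tau> x y = \<tau> y y"
      using V x y by (subst (asm) sheafify_germ_eq_iff) (auto simp: subset_iff)
    then show ?thesis
      using V(3)[OF x] y by (auto simp: \<sigma>_def)
  qed
  have \<sigma>_sect: "\<sigma> \<in> carrier (sect (sheafify X F) U)"
    unfolding carrier_sheafify
  proof (intro conjI ballI)
    fix x assume x: "x \<in> U"
    then obtain B s where B: "B \<in> opens F" "x \<in> B" "B \<subseteq> V x"
      "s \<in> carrier (sect F B)" "\<And>y. y \<in> B \<Longrightarrow> \<tau> x y = germ F y B s"
      using V(2,4) unfolding carrier_sheafify by blast
    then show "\<exists>B\<in>opens F. x \<in> B \<and> B \<subseteq> U \<and> (\<exists>s\<in>carrier (sect F B). \<forall>y\<in>B. \<sigma> y = germ F y B s)"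
      using \<sigma>[OF x] V(3)[OF x] by (intro bexI[of _ B] conjI bexI[of _ s]) auto
  qed (simp add: \<sigma>_def)
  moreover have "\<Sigma> x = germ (sheafify X F) x U \<sigma>" if x: "x \<in> U" for x
    using V[OF x] V(5)[OF x V(2)[OF x]] \<sigma>[OF x] \<sigma>_sect U x
    by (simp add: sheafify_germ_eq_iff) (auto intro!: exI[of _ "V x"])
  then have "\<Sigma> = germs (sheafify X F) U \<sigma>"
    using ext by (intro extensionalityI[of _ U]) (auto simp: germs_def)
  ultimately show "\<exists>\<sigma>\<in>carrier (sect (sheafify X F) U). \<Sigma> = germs (sheafify X F) U \<sigma>"
    by blast
qed

end

section \<open>The quotient of cochains by sections, and its sheafification\<close>

context module_sheaf
begin

lemma sect_C0: "sect (C0 X F) U = prod_module U (stalk F)"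
  and restr_C0: "restr (C0 X F) U V \<sigma> = restrict \<sigma> V"
  by (simp_all add: C0_def)

abbreviation cls :: "'p set \<Rightarrow> ('p \<Rightarrow> ('p set \<times> 'a) set) \<Rightarrow> ('p \<Rightarrow> ('p set \<times> 'a) set) set" where
  "cls U \<sigma> \<equiv> C0_image F U +>\<^bsub>prod_module U (stalk F)\<^esub> \<sigma>"

lemma opens_iff: "U \<in> opens F \<longleftrightarrow> openin X U"
  by (simp add: opens_eq)

lemma C0_quot_opens: "opens (C0_quot X F) = {U. openin X U}"
  and sect_C0_quot: "sect (C0_quot X F) U = quot_module (prod_module U (stalk F)) (C0_image F U)"
  by (simp_all add: C0_quot_def sect_C0)

text \<open>The difference of the two cochains is expressed by additions in the separate stalks,
  because lifts are later corrected pointwise by germs of sections.\<close>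

lemma cls_eq_iff:
  assumes "openin X U" "\<sigma> \<in> carrier (prod_module U (stalk F))" "\<tau> \<in> carrier (prod_module U (stalk F))"
  shows "cls U \<sigma> = cls U \<tau> \<longleftrightarrow> (\<exists>s\<in>carrier (sect F U). \<forall>y\<in>U. \<sigma> y = \<tau> y \<oplus>\<^bsub>stalk F y\<^esub> germ F y U s)"
proof -
  have sub: "submodule R (C0_image F U) (prod_module U (stalk F))"
    using assms(1) by (intro C0_image_submodule) (simp add: opens_iff)
  then interpret M: Module.module R "prod_module U (stalk F)"
    by (rule submodule.module)
  let ?M = "prod_module U (stalk F)"
  have g: "germs F U s \<in> carrier ?M" if "s \<in> carrier (sect F U)" for s
    using that assms(1) by (intro module_hom_mem[OF germs_hom]) (simp_all add: opens_iff)
  have eq: "\<sigma> \<ominus>\<^bsub>?M\<^esub> \<tau> = germs F U s \<longleftrightarrow> (\<forall>y\<in>U. \<sigma> y = \<tau> y \<oplus>\<^bsub>stalk F y\<^esub> germ F y U s)"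
    if s: "s \<in> carrier (sect F U)" for s
  proof -
    have "\<sigma> \<ominus>\<^bsub>?M\<^esub> \<tau> = germs F U s \<longleftrightarrow> \<sigma> = germs F U s \<oplus>\<^bsub>?M\<^esub> \<tau>"
      using assms g[OF s] M.M.add.inv_solve_right[of "germs F U s" \<sigma> \<tau>]
      by (auto simp: a_minus_def)
    also have "\<dots> \<longleftrightarrow> \<sigma> = \<tau> \<oplus>\<^bsub>?M\<^esub> germs F U s"
      using assms g[OF s] by (simp add: M.M.a_comm)
    also have "\<dots> \<longleftrightarrow> (\<forall>y\<in>U. \<sigma> y = \<tau> y \<oplus>\<^bsub>stalk F y\<^esub> germ F y U s)"
      using assms(2) by (auto simp: prod_module_def germs_def fun_eq_iff PiE_iff extensional_def)
    finally show ?thesis .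
  qed
  show ?thesis
    using rcos_eq_iff[OF sub assms(2,3)] eq by auto
qed

lemma C0_quot_restr:
  assumes U: "openin X U" and V: "openin X V" "V \<subseteq> U" and \<sigma>: "\<sigma> \<in> carrier (prod_module U (stalk F))"
  shows "restr (C0_quot X F) U V (cls U \<sigma>) = cls V (restrict \<sigma> V)"
proof -
  have sub: "submodule R (C0_image F U) (prod_module U (stalk F))"
    using U by (intro C0_image_submodule) (simp add: opens_iff)
  interpret abelian_subgroup "C0_image F U" "prod_module U (stalk F)"
    using submodule_abelian_subgroup[OF sub] .
  \<comment> \<open>The restriction map is a union over the coset. A section of \<open>F\<close>
    restricts to a section of \<open>F\<close>, so every member of the coset contributes the same
    class over \<open>V\<close>.\<close>
  have eq: "cls V (restrict \<tau> V) = cls V (restrict \<sigma> V)" if \<tau>: "\<tau> \<in> cls U \<sigma>" for \<tau>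
  proof -
    have \<tau>': "\<tau> \<in> carrier (prod_module U (stalk F))"
      using a_elemrcos_carrier[OF \<sigma> \<tau>] .
    have "cls U \<tau> = cls U \<sigma>"
      using a_repr_independence'[OF \<tau> \<sigma>] by simp
    then obtain s where s: "s \<in> carrier (sect F U)"
      "\<And>y. y \<in> U \<Longrightarrow> \<tau> y = \<sigma> y \<oplus>\<^bsub>stalk F y\<^esub> germ F y U s"
      using U \<sigma> \<tau>' by (auto simp: cls_eq_iff)
    have res: "restrict \<rho> V \<in> carrier (prod_module V (stalk F))"
      if "\<rho> \<in> carrier (prod_module U (stalk F))" for \<rho>
      using module_hom_mem[OF restrict_prod_hom[OF V(2), where R = R] that] .
    show ?thesis
      using U V s \<sigma> \<tau>'
      by (subst cls_eq_iff) (auto simp: opens_iff germ_restr subset_iff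
          intro!: res bexI[of _ "restr F U V s"] restr_mem)
  qed
  have "restr (C0_quot X F) U V (cls U \<sigma>) = (\<Union>\<tau>\<in>cls U \<sigma>. cls V (restrict \<tau> V))"
    by (simp add: C0_quot_def sect_C0 restr_C0)
  also have "\<dots> = (\<Union>\<tau>\<in>cls U \<sigma>. cls V (restrict \<sigma> V))"
    using eq by (intro SUP_cong) auto
  also have "\<dots> = cls V (restrict \<sigma> V)"
    using a_rcos_self[OF \<sigma>] by blast
  finally show ?thesis .
qed

lemma C0_quot_obtain:
  assumes "A \<in> carrier (sect (C0_quot X F) U)"
  obtains \<sigma> where "\<sigma> \<in> carrier (prod_module U (stalk F))" "A = cls U \<sigma>"
  using assms by (auto simp: sect_C0_quot carrier_quot_module)

lemma cls_in_C0_quot: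
  "\<sigma> \<in> carrier (prod_module U (stalk F)) \<Longrightarrow> cls U \<sigma> \<in> carrier (sect (C0_quot X F) U)"
  by (simp add: sect_C0_quot carrier_quot_module)

lemma C0_quot_presheaf: "module_presheaf R X (C0_quot X F)"
proof (rule module_presheaf.intro[OF cring])
  fix U assume "U \<in> opens (C0_quot X F)"
  then have U: "openin X U"
    by (simp add: C0_quot_opens)
  then have sub: "submodule R (C0_image F U) (prod_module U (stalk F))"
    by (intro C0_image_submodule) (simp add: opens_iff)
  note hom = quot_module_hom[OF sub]
  show "module R (sect (C0_quot X F) U)"
    unfolding sect_C0_quot by (rule quot_module_module[OF sub])
  show "restr (C0_quot X F) U U A = A" if A: "A \<in> carrier (sect (C0_quot X F) U)" for A
  proof -
    obtain \<sigma> where \<sigma>: "\<sigma> \<in> carrier (prod_module U (stalk F))" "A = cls U \<sigma>"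
      using A by (rule C0_quot_obtain)
    then have "restrict \<sigma> U = \<sigma>"
      by (auto simp: prod_module_def PiE_iff extensional_restrict)
    then show ?thesis
      using U \<sigma> by (simp add: C0_quot_restr)
  qed
  fix V assume "V \<in> opens (C0_quot X F)" and VU: "V \<subseteq> U"
  then have V: "openin X V"
    by (simp add: C0_quot_opens)
  then have subV: "submodule R (C0_image F V) (prod_module V (stalk F))"
    by (intro C0_image_submodule) (simp add: opens_iff)
  note homV = quot_module_hom[OF subV]
  note res = restrict_prod_hom[OF VU, where R = R and M = "stalk F"]
  note resm = module_hom_mem[OF res]
  interpret M: Module.module R "prod_module U (stalk F)"
    by (rule submodule.module[OF sub])
  show "restr (C0_quot X F) U V \<in> module_hom R (sect (C0_quot X F) U) (sect (C0_quot X F) V)"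
  proof (rule module_homI)
    fix A assume "A \<in> carrier (sect (C0_quot X F) U)"
    then obtain \<sigma> where \<sigma>: "\<sigma> \<in> carrier (prod_module U (stalk F))" "A = cls U \<sigma>"
      by (rule C0_quot_obtain)
    then show "restr (C0_quot X F) U V A \<in> carrier (sect (C0_quot X F) V)"
      using U V VU resm by (simp add: C0_quot_restr cls_in_C0_quot)
    show "restr (C0_quot X F) U V (c \<odot>\<^bsub>sect (C0_quot X F) U\<^esub> A) =
        c \<odot>\<^bsub>sect (C0_quot X F) V\<^esub> restr (C0_quot X F) U V A" if c: "c \<in> carrier R" for c
    proof -
      have "restr (C0_quot X F) U V (c \<odot>\<^bsub>sect (C0_quot X F) U\<^esub> A) =
          restr (C0_quot X F) U V (cls U (c \<odot>\<^bsub>prod_module U (stalk F)\<^esub> \<sigma>))"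
        using c \<sigma> by (simp add: sect_C0_quot module_hom_smult[OF hom])
      also have "\<dots> = cls V (restrict (c \<odot>\<^bsub>prod_module U (stalk F)\<^esub> \<sigma>) V)"
        using U V VU c \<sigma> by (intro C0_quot_restr) auto
      also have "\<dots> = c \<odot>\<^bsub>sect (C0_quot X F) V\<^esub> cls V (restrict \<sigma> V)"
        using c \<sigma> resm[OF \<sigma>(1)]
        by (simp add: sect_C0_quot module_hom_smult[OF homV] module_hom_smult[OF res])
      finally show ?thesis
        using U V VU \<sigma> by (simp add: C0_quot_restr)
    qed
    fix B assume "B \<in> carrier (sect (C0_quot X F) U)"
    then obtain \<tau> where \<tau>: "\<tau> \<in> carrier (prod_module U (stalk F))" "B = cls U \<tau>"
      by (rule C0_quot_obtain)
    have "restr (C0_quot X F) U V (A \<oplus>\<^bsub>sect (C0_quot X F) U\<^esub> B) =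
        restr (C0_quot X F) U V (cls U (\<sigma> \<oplus>\<^bsub>prod_module U (stalk F)\<^esub> \<tau>))"
      using \<sigma> \<tau> by (simp add: sect_C0_quot module_hom_add[OF hom])
    also have "\<dots> = cls V (restrict (\<sigma> \<oplus>\<^bsub>prod_module U (stalk F)\<^esub> \<tau>) V)"
      using U V VU \<sigma> \<tau> by (intro C0_quot_restr) auto
    also have "\<dots> = cls V (restrict \<sigma> V) \<oplus>\<^bsub>sect (C0_quot X F) V\<^esub> cls V (restrict \<tau> V)"
      using resm[OF \<sigma>(1)] resm[OF \<tau>(1)] \<sigma> \<tau>
      by (simp add: sect_C0_quot module_hom_add[OF homV] module_hom_add[OF res])
    finally show "restr (C0_quot X F) U V (A \<oplus>\<^bsub>sect (C0_quot X F) U\<^esub> B) =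
        restr (C0_quot X F) U V A \<oplus>\<^bsub>sect (C0_quot X F) V\<^esub> restr (C0_quot X F) U V B"
      using U V VU \<sigma> \<tau> by (simp add: C0_quot_restr)
  qed
  fix W A assume "W \<in> opens (C0_quot X F)" and WV: "W \<subseteq> V" and "A \<in> carrier (sect (C0_quot X F) U)"
  then obtain \<sigma> where \<sigma>: "\<sigma> \<in> carrier (prod_module U (stalk F))" "A = cls U \<sigma>" and W: "openin X W"
    by (auto elim: C0_quot_obtain simp: C0_quot_opens)
  have "restrict (restrict \<sigma> V) W = restrict \<sigma> W"
    using WV by (simp add: Int_absorb1)
  then show "restr (C0_quot X F) V W (restr (C0_quot X F) U V A) = restr (C0_quot X F) U W A"
    using U V W VU WV \<sigma> resm[OF \<sigma>(1)] by (simp add: C0_quot_restr)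
qed (auto simp: C0_quot_opens)

lemma Z1_sheaf: "module_sheaf R X (Z1 X F)"
  unfolding Z1_def by (rule module_presheaf.sheafify_sheaf[OF C0_quot_presheaf])

text \<open>The bridge from the quotient presheaf back to sections of \<open>F\<close>; both the
  computation of the cocycles and \<open>lifts_diff\<close> rest on it.\<close>

lemma germ_cls_eq_iff:
  assumes U: "openin X U" "x \<in> U" "\<sigma> \<in> carrier (prod_module U (stalk F))"
    and V: "openin X V" "x \<in> V" "\<tau> \<in> carrier (prod_module V (stalk F))"
  shows "germ (C0_quot X F) x U (cls U \<sigma>) = germ (C0_quot X F) x V (cls V \<tau>) \<longleftrightarrow>
    (\<exists>W s. openin X W \<and> x \<in> W \<and> W \<subseteq> U \<inter> V \<and> s \<in> carrier (sect F W) \<and>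
      (\<forall>y\<in>W. \<sigma> y = \<tau> y \<oplus>\<^bsub>stalk F y\<^esub> germ F y W s))"
proof -
  have "restr (C0_quot X F) U W (cls U \<sigma>) = restr (C0_quot X F) V W (cls V \<tau>) \<longleftrightarrow>
      (\<exists>s\<in>carrier (sect F W). \<forall>y\<in>W. \<sigma> y = \<tau> y \<oplus>\<^bsub>stalk F y\<^esub> germ F y W s)"
    if W: "openin X W" "W \<subseteq> U \<inter> V" for W
  proof -
    have "restrict \<sigma> W \<in> carrier (prod_module W (stalk F))"
      "restrict \<tau> W \<in> carrier (prod_module W (stalk F))"
      using W U V module_hom_mem[OF restrict_prod_hom[where R = R and V = W and U = U and M = "stalk F"]]
        module_hom_mem[OF restrict_prod_hom[where R = R and V = W and U = V and M = "stalk F"]]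
      by auto
    then show ?thesis
      using U V W by (simp add: C0_quot_restr cls_eq_iff)
  qed
  then have "(\<exists>W. openin X W \<and> x \<in> W \<and> W \<subseteq> U \<inter> V \<and>
        restr (C0_quot X F) U W (cls U \<sigma>) = restr (C0_quot X F) V W (cls V \<tau>)) \<longleftrightarrow>
      (\<exists>W. openin X W \<and> x \<in> W \<and> W \<subseteq> U \<inter> V \<and>
        (\<exists>s\<in>carrier (sect F W). \<forall>y\<in>W. \<sigma> y = \<tau> y \<oplus>\<^bsub>stalk F y\<^esub> germ F y W s))"
    by (intro ex_cong1 conj_cong refl) simp
  then show ?thesis
    using U V by (simp add: module_presheaf.germ_eq_iff[OF C0_quot_presheaf] C0_quot_opens
        cls_in_C0_quot Bex_def)
qed

subsection \<open>The degrees 0 and 1 of the cohomology\<close>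

lemma topspace_opens_eq: "topspace X \<in> opens F"
  by (simp add: opens_iff)

lemma germs_inj:
  assumes "openin X U" "s \<in> carrier (sect F U)" "t \<in> carrier (sect F U)" "germs F U s = germs F U t"
  shows "s = t"
proof (rule separated[OF assms(1-3)])
  show "germ F x U s = germ F x U t" if "x \<in> U" for x
    using fun_cong[OF assms(4), of x] that by (simp add: germs_def)
qed

lemma germs_section:
  "\<sigma> \<in> carrier (sect (C0_quot X F) U) \<Longrightarrow> openin X U \<Longrightarrow>
    germs (C0_quot X F) U \<sigma> \<in> carrier (sect (Z1 X F) U)"
  unfolding Z1_def module_presheaf.carrier_sheafify[OF C0_quot_presheaf]
  by (auto simp: germs_def C0_quot_opens)

lemma zero_sect_Z1:
  assumes "openin X U"
  shows "\<zero>\<^bsub>sect (Z1 X F) U\<^esub> = germs (C0_quot X F) U \<zero>\<^bsub>sect (C0_quot X F) U\<^esub>"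
  using assms by (auto simp: Z1_def sheafify_def prod_module_def germs_def fun_eq_iff C0_quot_opens
      module_presheaf.stalk_zero[OF C0_quot_presheaf])

text \<open>Exactness of the resolution at \<open>C0 F\<close> on global sections. Sections of the
  sheaf \<open>Z1 F\<close> are determined by their germs, so a vanishing differential means that
  the cochain is locally a section of \<open>F\<close>; the gluing axiom for \<open>F\<close> makes
  it a global one.\<close>

lemma godement_d_eq_zero_iff:
  assumes \<sigma>: "\<sigma> \<in> carrier (sect (C0 X F) (topspace X))"
  shows "godement_d X F \<sigma> = \<zero>\<^bsub>sect (C0 X (Z1 X F)) (topspace X)\<^esub> \<longleftrightarrow> \<sigma> \<in> C0_image F (topspace X)"
proof -
  let ?S = "topspace X" and ?M = "prod_module (topspace X) (stalk F)"
  interpret Z: module_sheaf R X "Z1 X F"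
    by (rule Z1_sheaf)
  interpret Q: module_presheaf R X "C0_quot X F"
    by (rule C0_quot_presheaf)
  interpret M: Module.module R ?M
    by (rule prod_stalk_module) simp
  have S: "openin X ?S"
    by simp
  have \<sigma>': "\<sigma> \<in> carrier ?M"
    using \<sigma> by (simp add: sect_C0)
  have ZS: "abelian_group (sect (Z1 X F) ?S)"
    using Module.module.axioms(2)[OF Z.sect_module[OF Z.topspace_opens_eq]] .
  have zero: "\<zero>\<^bsub>sect (C0 X (Z1 X F)) ?S\<^esub> = germs (Z1 X F) ?S \<zero>\<^bsub>sect (Z1 X F) ?S\<^esub>"
    by (auto simp: C0_def prod_module_def germs_def fun_eq_iff Z.stalk_zero[OF Z.topspace_opens_eq])
  have cls0: "\<zero>\<^bsub>sect (C0_quot X F) ?S\<^esub> = cls ?S \<zero>\<^bsub>?M\<^esub>"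
    using abelian_subgroup.a_rcos_const[OF submodule_abelian_subgroup[OF
        C0_image_submodule[OF topspace_opens_eq]], of "\<zero>\<^bsub>?M\<^esub>"]
      submodule.zero_closed[OF C0_image_submodule[OF topspace_opens_eq]]
    by (simp add: sect_C0_quot zero_quot_module)
  have "godement_d X F \<sigma> = \<zero>\<^bsub>sect (C0 X (Z1 X F)) ?S\<^esub> \<longleftrightarrow>
      germs (Z1 X F) ?S (germs (C0_quot X F) ?S (cls ?S \<sigma>)) = germs (Z1 X F) ?S \<zero>\<^bsub>sect (Z1 X F) ?S\<^esub>"
    by (simp add: godement_d_def Let_def sect_C0 zero)
  also have "\<dots> \<longleftrightarrow> germs (C0_quot X F) ?S (cls ?S \<sigma>) = germs (C0_quot X F) ?S (cls ?S \<zero>\<^bsub>?M\<^esub>)"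
    using Z.germs_inj[OF S germs_section[OF cls_in_C0_quot[OF \<sigma>'] S] abelian_groupE(2)[OF ZS]]
    by (auto simp: zero_sect_Z1 cls0)
  also have "\<dots> \<longleftrightarrow> (\<forall>x\<in>?S. germ (C0_quot X F) x ?S (cls ?S \<sigma>) = germ (C0_quot X F) x ?S (cls ?S \<zero>\<^bsub>?M\<^esub>))"
    by (auto simp: germs_def fun_eq_iff)
  also have "\<dots> \<longleftrightarrow> (\<forall>x\<in>?S. \<exists>W s. openin X W \<and> x \<in> W \<and> W \<subseteq> ?S \<and> s \<in> carrier (sect F W) \<and>
      (\<forall>y\<in>W. \<sigma> y = germ F y W s))"
  proof (rule ball_cong[OF refl])
    fix x assume x: "x \<in> ?S"
    have add0: "\<zero>\<^bsub>?M\<^esub> y \<oplus>\<^bsub>stalk F y\<^esub> germ F y W s = germ F y W s"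
      if "openin X W" "y \<in> W" "s \<in> carrier (sect F W)" for y W s
    proof -
      have y: "y \<in> ?S"
        using that openin_subset by blast
      interpret N: Module.module R "stalk F y"
        using y by (rule stalk_module)
      show ?thesis
        using that y germ_in_stalk[of W y s] by (simp add: prod_module_def opens_iff)
    qed
    show "germ (C0_quot X F) x ?S (cls ?S \<sigma>) = germ (C0_quot X F) x ?S (cls ?S \<zero>\<^bsub>?M\<^esub>) \<longleftrightarrow>
        (\<exists>W s. openin X W \<and> x \<in> W \<and> W \<subseteq> ?S \<and> s \<in> carrier (sect F W) \<and> (\<forall>y\<in>W. \<sigma> y = germ F y W s))"
      unfolding germ_cls_eq_iff[OF S x \<sigma>' S x M.M.zero_closed] Int_absorb
      using add0 by (intro ex_cong1 conj_cong refl ball_cong) simp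
  qed
  also have "\<dots> \<longleftrightarrow> \<sigma> \<in> C0_image F ?S"
  proof
    assume "\<forall>x\<in>?S. \<exists>W s. openin X W \<and> x \<in> W \<and> W \<subseteq> ?S \<and> s \<in> carrier (sect F W) \<and>
      (\<forall>y\<in>W. \<sigma> y = germ F y W s)"
    moreover have "\<sigma> \<in> extensional ?S"
      using \<sigma>' by (auto simp: prod_module_def PiE_iff)
    ultimately have "\<exists>s\<in>carrier (sect F ?S). \<sigma> = germs F ?S s"
      by (intro gluing) auto
    then show "\<sigma> \<in> C0_image F ?S"
      by auto
  next
    assume "\<sigma> \<in> C0_image F ?S"
    then obtain s where "s \<in> carrier (sect F ?S)" "\<sigma> = germs F ?S s"
      by auto
    then show "\<forall>x\<in>?S. \<exists>W s. openin X W \<and> x \<in> W \<and> W \<subseteq> ?S \<and> s \<in> carrier (sect F W) \<and>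
      (\<forall>y\<in>W. \<sigma> y = germ F y W s)"
      using S by (intro ballI exI[of _ ?S] exI[of _ s]) (simp add: germs_def)
  qed
  finally show ?thesis .
qed

text \<open>Applied to \<open>F\<close> this identifies \<open>sheaf_H0\<close> with the global
  sections of \<open>F\<close>. Applied to \<open>Z1 F\<close> it identifies the cocycles of degree
  1 with the global sections of \<open>Z1 F\<close>.\<close>

lemma godement_cocycles_eq:
  "godement_cocycles X F = (prod_module (topspace X) (stalk F))\<lparr>carrier := C0_image F (topspace X)\<rparr>"
proof -
  have "C0_image F (topspace X) \<subseteq> carrier (prod_module (topspace X) (stalk F))"
    using submodule.subset[OF C0_image_submodule[OF topspace_opens_eq]] .
  then have "{\<sigma> \<in> carrier (sect (C0 X F) (topspace X)). godement_d X F \<sigma> =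
      \<zero>\<^bsub>sect (C0 X (Z1 X F)) (topspace X)\<^esub>} = C0_image F (topspace X)"
    using godement_d_eq_zero_iff by (auto simp: sect_C0)
  then show ?thesis
    by (simp add: godement_cocycles_def Let_def sect_C0)
qed

lemma carrier_godement_cocycles: "carrier (godement_cocycles X F) = C0_image F (topspace X)"
  by (simp add: godement_cocycles_eq)

lemma godement_cocycles_module: "module R (godement_cocycles X F)"
proof -
  have sub: "submodule R (C0_image F (topspace X)) (prod_module (topspace X) (stalk F))"
    using C0_image_submodule[OF topspace_opens_eq] .
  then interpret M: Module.module R "prod_module (topspace X) (stalk F)"
    by (rule submodule.module)
  show ?thesis
    unfolding godement_cocycles_eq by (rule M.submodule_is_module[OF sub])
qed

text \<open>H^1 is the cokernel of the map from global cochains to global sections of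
  \<open>Z1 F\<close>. The hypothesis says that this map is onto, so the cocycles are divided by all
  of themselves.\<close>

lemma sheaf_H1_trivial:
  assumes lift: "\<And>z. z \<in> carrier (sect (Z1 X F) (topspace X)) \<Longrightarrow>
    \<exists>\<tau>\<in>carrier (prod_module (topspace X) (stalk F)).
      \<forall>x\<in>topspace X. z x = germ (C0_quot X F) x (topspace X) (cls (topspace X) \<tau>)"
  shows "carrier (sheaf_H1 X F) = {\<zero>\<^bsub>sheaf_H1 X F\<^esub>}"
proof -
  let ?S = "topspace X"
  interpret Z: module_sheaf R X "Z1 X F"
    by (rule Z1_sheaf)
  interpret G: Module.module R "godement_cocycles X (Z1 X F)"
    by (rule Z.godement_cocycles_module)
  have "godement_d X F ` carrier (sect (C0 X F) ?S) = carrier (godement_cocycles X (Z1 X F))"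
  proof
    show "godement_d X F ` carrier (sect (C0 X F) ?S) \<subseteq> carrier (godement_cocycles X (Z1 X F))"
      unfolding Z.carrier_godement_cocycles
      by (auto simp: godement_d_def Let_def sect_C0 intro!: imageI germs_section cls_in_C0_quot)
    show "carrier (godement_cocycles X (Z1 X F)) \<subseteq> godement_d X F ` carrier (sect (C0 X F) ?S)"
    proof
      fix A assume "A \<in> carrier (godement_cocycles X (Z1 X F))"
      then obtain z where z: "z \<in> carrier (sect (Z1 X F) ?S)" "A = germs (Z1 X F) ?S z"
        by (auto simp: Z.carrier_godement_cocycles)
      obtain \<tau> where \<tau>: "\<tau> \<in> carrier (prod_module ?S (stalk F))"
        "\<And>x. x \<in> ?S \<Longrightarrow> z x = germ (C0_quot X F) x ?S (cls ?S \<tau>)"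
        using lift[OF z(1)] by blast
      have "z \<in> extensional ?S"
        using z(1) unfolding Z1_def module_presheaf.carrier_sheafify[OF C0_quot_presheaf] by simp
      then have "z = germs (C0_quot X F) ?S (cls ?S \<tau>)"
        using \<tau>(2) by (intro extensionalityI[of _ ?S]) (auto simp: germs_def)
      then have "A = godement_d X F \<tau>"
        by (simp add: z(2) godement_d_def Let_def sect_C0)
      then show "A \<in> godement_d X F ` carrier (sect (C0 X F) ?S)"
        using \<tau>(1) by (simp add: sect_C0)
    qed
  qed
  \<comment> \<open>A module modulo itself has a single coset.\<close>
  moreover have "carrier (godement_cocycles X (Z1 X F)) +>\<^bsub>godement_cocycles X (Z1 X F)\<^esub> a =
      carrier (godement_cocycles X (Z1 X F))"
    if "a \<in> carrier (godement_cocycles X (Z1 X F))" for a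
    using G.M.a_coset_join2[OF that G.M.add.subgroup_self that] by simp
  ultimately show ?thesis
    using G.M.zero_closed by (auto simp: sheaf_H1_def carrier_quot_module zero_quot_module)
qed

end

section \<open>Cochains that represent a given section of \<open>Z1 F\<close>\<close>

context module_sheaf
begin

text \<open>\<open>\<tau>\<close> is a cochain over \<open>U\<close> which represents the section \<open>z\<close> of \<open>Z1 X F\<close>. Such cochains form a
  torsor under \<open>F\<close>, and \<open>H\<^sup>1\<close> vanishes if all these torsors have global sections.\<close>

definition lifts ::
  "('p \<Rightarrow> ('p set \<times> ('p \<Rightarrow> ('p set \<times> 'a) set) set) set) \<Rightarrow> 'p set \<Rightarrow> ('p \<Rightarrow> ('p set \<times> 'a) set) \<Rightarrow> bool"
  where "lifts z U \<tau> \<longleftrightarrow> openin X U \<and> \<tau> \<in> carrier (prod_module U (stalk F)) \<and>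
    (\<forall>x\<in>U. z x = germ (C0_quot X F) x U (cls U \<tau>))"

lemma lifts_stalk: "lifts z U \<tau> \<Longrightarrow> x \<in> U \<Longrightarrow> \<tau> x \<in> carrier (stalk F x)"
  by (auto simp: lifts_def prod_module_def)

lemma restrict_carrier:
  "V \<subseteq> U \<Longrightarrow> \<tau> \<in> carrier (prod_module U M) \<Longrightarrow> restrict \<tau> V \<in> carrier (prod_module V M)"
  by (auto simp: prod_module_def)

lemma germ_cls_restrict:
  assumes "openin X U" "openin X V" "V \<subseteq> U" "x \<in> V" "\<tau> \<in> carrier (prod_module U (stalk F))"
  shows "germ (C0_quot X F) x V (cls V (restrict \<tau> V)) = germ (C0_quot X F) x U (cls U \<tau>)"
proof -
  interpret Q: module_presheaf R X "C0_quot X F"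
    by (rule C0_quot_presheaf)
  show ?thesis
    using assms Q.germ_restr[of U V x "cls U \<tau>"]
    by (simp add: C0_quot_opens C0_quot_restr cls_in_C0_quot)
qed

lemma lifts_restrict:
  assumes "lifts z U \<tau>" "openin X V" "V \<subseteq> U"
  shows "lifts z V (restrict \<tau> V)"
  unfolding lifts_def
proof (intro conjI ballI)
  fix x assume "x \<in> V"
  then show "z x = germ (C0_quot X F) x V (cls V (restrict \<tau> V))"
    using assms germ_cls_restrict[of U V x \<tau>] by (auto simp: lifts_def)
qed (use assms restrict_carrier[of V U \<tau> "stalk F"] in \<open>auto simp: lifts_def\<close>)

lemma lifts_local:
  assumes "z \<in> carrier (sect (Z1 X F) U)" "x \<in> U"
  obtains V \<tau> where "x \<in> V" "V \<subseteq> U" "lifts z V \<tau>"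
proof -
  obtain V A where V: "openin X V" "x \<in> V" "V \<subseteq> U" "A \<in> carrier (sect (C0_quot X F) V)"
    "\<And>y. y \<in> V \<Longrightarrow> z y = germ (C0_quot X F) y V A"
    using assms by (auto simp: Z1_def module_presheaf.carrier_sheafify[OF C0_quot_presheaf] C0_quot_opens
        Bex_def)
  obtain \<tau> where "\<tau> \<in> carrier (prod_module V (stalk F))" "A = cls V \<tau>"
    using V(4) by (rule C0_quot_obtain)
  then show thesis
    using V by (intro that[of V \<tau>]) (auto simp: lifts_def)
qed

text \<open>Being a lift is a condition on the germ of the class at each point, hence local.
  Compatibility of the pieces is built in, as \<open>\<tau>\<close> is one function on all of
  \<open>U\<close>.\<close>

lemma lifts_glue:
  assumes U: "openin X U" and ext: "\<tau> \<in> extensional U"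
    and loc: "\<And>x. x \<in> U \<Longrightarrow> \<exists>V. x \<in> V \<and> V \<subseteq> U \<and> lifts z V (restrict \<tau> V)"
  shows "lifts z U \<tau>"
proof -
  have "\<tau> x \<in> carrier (stalk F x)" if x: "x \<in> U" for x
    using loc[OF x] lifts_stalk[where x = x and z = z] by fastforce
  then have \<tau>: "\<tau> \<in> carrier (prod_module U (stalk F))"
    using ext by (auto simp: prod_module_def PiE_iff)
  have "z x = germ (C0_quot X F) x U (cls U \<tau>)" if x: "x \<in> U" for x
  proof -
    obtain V where V: "x \<in> V" "V \<subseteq> U" "lifts z V (restrict \<tau> V)"
      using loc[OF x] by blast
    then show ?thesis
      using germ_cls_restrict[OF U _ V(2,1) \<tau>] by (auto simp: lifts_def)
  qed
  then show ?thesis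
    using U \<tau> by (simp add: lifts_def)
qed

lemma lifts_add:
  assumes \<tau>: "lifts z U \<tau>" and s: "s \<in> carrier (sect F U)"
  shows "lifts z U (\<lambda>x\<in>U. \<tau> x \<oplus>\<^bsub>stalk F x\<^esub> germ F x U s)" (is "lifts z U ?\<tau>")
proof -
  have U: "openin X U" "U \<in> opens F"
    using \<tau> by (simp_all add: lifts_def opens_iff)
  have "\<tau> x \<oplus>\<^bsub>stalk F x\<^esub> germ F x U s \<in> carrier (stalk F x)" if "x \<in> U" for x
    using abelian_groupE(1)[OF Module.module.axioms(2)[OF stalk_module[OF opens_topspace[OF U(2) that]]]
        lifts_stalk[OF \<tau> that] germ_in_stalk[OF U(2) that s]] .
  then have "?\<tau> \<in> carrier (prod_module U (stalk F))"
    by (simp add: prod_module_def)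
  moreover from this have "cls U ?\<tau> = cls U \<tau>"
    using U \<tau> s by (subst cls_eq_iff) (auto simp: lifts_def)
  ultimately show ?thesis
    using \<tau> by (simp add: lifts_def)
qed

text \<open>Transitivity of the action in \<open>lifts_add\<close>: by
  \<open>germ_cls_eq_iff\<close> the difference of two lifts is locally a section of
  \<open>F\<close>, and the gluing axiom assembles these into one section over
  \<open>U\<close>.\<close>

lemma lifts_diff:
  assumes \<tau>: "lifts z U \<tau>" and \<tau>': "lifts z U \<tau>'"
  obtains s where "s \<in> carrier (sect F U)" "\<And>x. x \<in> U \<Longrightarrow> \<tau> x = \<tau>' x \<oplus>\<^bsub>stalk F x\<^esub> germ F x U s"
proof -
  have U: "openin X U"
    using \<tau> by (simp add: lifts_def)
  have mod: "Module.module R (stalk F x)" if "x \<in> U" for x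
    using stalk_module opens_topspace U that by (simp add: opens_iff)
  define \<sigma> where "\<sigma> = (\<lambda>x\<in>U. \<tau> x \<ominus>\<^bsub>stalk F x\<^esub> \<tau>' x)"
  have eq: "\<tau> x = \<tau>' x \<oplus>\<^bsub>stalk F x\<^esub> a \<longleftrightarrow> \<sigma> x = a" if x: "x \<in> U" and a: "a \<in> carrier (stalk F x)" for x a
  proof -
    interpret M: Module.module R "stalk F x"
      by (rule mod[OF x])
    show ?thesis
      using x a lifts_stalk[OF \<tau> x] lifts_stalk[OF \<tau>' x] M.M.add.inv_solve_right'[of a "\<tau> x" "\<tau>' x"]
      by (auto simp: \<sigma>_def a_minus_def M.M.a_comm)
  qed
  have "\<exists>s\<in>carrier (sect F U). \<sigma> = germs F U s"
  proof (rule gluing[OF U])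
    fix x assume x: "x \<in> U"
    have "germ (C0_quot X F) x U (cls U \<tau>) = germ (C0_quot X F) x U (cls U \<tau>')"
      using \<tau> \<tau>' x by (simp add: lifts_def)
    then obtain W s where W: "openin X W" "x \<in> W" "W \<subseteq> U" "s \<in> carrier (sect F W)"
      "\<And>y. y \<in> W \<Longrightarrow> \<tau> y = \<tau>' y \<oplus>\<^bsub>stalk F y\<^esub> germ F y W s"
      using \<tau> \<tau>' x by (subst (asm) germ_cls_eq_iff) (auto simp: lifts_def)
    then have "\<sigma> y = germ F y W s" if "y \<in> W" for y
      using that eq[of y "germ F y W s"] by (auto simp: opens_iff germ_in_stalk)
    then show "\<exists>V t. openin X V \<and> x \<in> V \<and> V \<subseteq> U \<and> t \<in> carrier (sect F V) \<and> (\<forall>y\<in>V. \<sigma> y = germ F y V t)"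
      using W by blast
  qed (simp add: \<sigma>_def)
  then obtain s where s: "s \<in> carrier (sect F U)" "\<sigma> = germs F U s"
    by blast
  show thesis
    using s eq U by (intro that[of s]) (auto simp: germs_apply opens_iff germ_in_stalk)
qed

lemma sheaf_H1_trivial_lifts:
  assumes "\<And>z. z \<in> carrier (sect (Z1 X F) (topspace X)) \<Longrightarrow> \<exists>\<tau>. lifts z (topspace X) \<tau>"
  shows "carrier (sheaf_H1 X F) = {\<zero>\<^bsub>sheaf_H1 X F\<^esub>}"
  by (rule sheaf_H1_trivial) (use assms in \<open>auto simp: lifts_def Bex_def\<close>)

end

section \<open>The topology of a graph with external edges\<close>

lemma topspace_graph_top_subset: "topspace (graph_top G) \<subseteq> graph_space G"
  using openin_topspace[of "graph_top G"] unfolding openin_graph_top by blast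

text \<open>Without loops an edge has at most one end at a given vertex. It then meets a star of
  that vertex in at most one interval, and it is never both incoming and outgoing there.\<close>

locale loopless_ext_digraph =
  fixes G :: "('v, 'e) ext_digraph"
  assumes finite_ext_digraph: "finite_ext_digraph G"
    and loopless: "e \<in> edges G \<Longrightarrow> src G e \<noteq> tgt G e"
begin

lemma finite_verts: "finite (verts G)" and finite_edges: "finite (edges G)"
  using finite_ext_digraph by (auto simp: finite_ext_digraph_def)

lemma src_verts: "e \<in> edges G \<Longrightarrow> src G e = Some v \<Longrightarrow> v \<in> verts G"
  and tgt_verts: "e \<in> edges G \<Longrightarrow> tgt G e = Some v \<Longrightarrow> v \<in> verts G"
  using finite_ext_digraph by (auto simp: finite_ext_digraph_def)

lemma in_out_disjoint: "in_edges G v \<inter> out_edges G v = {}"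
  using loopless by (fastforce simp: in_edges_def out_edges_def)

definition interval :: "'e \<Rightarrow> real \<Rightarrow> real \<Rightarrow> ('v, 'e) point set" where
  "interval e a b = Inner e ` {a<..<b}"

text \<open>An outgoing edge leaves \<open>v\<close> at parameter 0, an incoming one arrives at
  parameter 1. For \<open>\<epsilon> = 1\<close> the star contains the whole open edges.\<close>

definition star :: "'v \<Rightarrow> real \<Rightarrow> ('v, 'e) point set" where
  "star v \<epsilon> = {Vert v} \<union> (\<Union>e\<in>out_edges G v. interval e 0 \<epsilon>) \<union> (\<Union>e\<in>in_edges G v. interval e (1 - \<epsilon>) 1)"

lemma Inner_in_interval [simp]: "Inner e t \<in> interval e' a b \<longleftrightarrow> e = e' \<and> a < t \<and> t < b"
  and Vert_in_interval [simp]: "Vert v \<notin> interval e' a b"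
  by (auto simp: interval_def)

lemma interval_cases:
  assumes "x \<in> interval e a b" obtains t where "x = Inner e t" "a < t" "t < b"
  using assms by (auto simp: interval_def)

lemma Vert_in_star [simp]: "Vert w \<in> star v \<epsilon> \<longleftrightarrow> w = v"
  and Inner_in_star: "Inner e t \<in> star v \<epsilon> \<longleftrightarrow>
    e \<in> out_edges G v \<and> 0 < t \<and> t < \<epsilon> \<or> e \<in> in_edges G v \<and> 1 - \<epsilon> < t \<and> t < 1"
  by (auto simp: star_def)

lemma openin_interval:
  assumes "e \<in> edges G" "0 \<le> a" "b \<le> 1"
  shows "openin (graph_top G) (interval e a b)"
  unfolding openin_graph_top
proof (intro conjI ballI)
  show "interval e a b \<subseteq> graph_space G"
    using assms by (auto simp: interval_def graph_space_def)
  fix e' assume "e' \<in> edges G"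
  have eq: "{t \<in> edge_dom G e'. edge_param G e' t \<in> interval e a b} =
      edge_dom G e' \<inter> (if e' = e then {a<..<b} else {})"
    using assms(2,3) by (auto simp: edge_param_def edge_dom_def)
  then show "openin (top_of_set (edge_dom G e')) {t \<in> edge_dom G e'. edge_param G e' t \<in> interval e a b}"
    unfolding eq by (intro openin_open_Int) simp
qed

lemma openin_star:
  assumes v: "v \<in> verts G" and \<epsilon>: "0 < \<epsilon>" "\<epsilon> \<le> 1"
  shows "openin (graph_top G) (star v \<epsilon>)"
  unfolding openin_graph_top
proof (intro conjI ballI)
  show "star v \<epsilon> \<subseteq> graph_space G"
    using assms by (auto simp: star_def interval_def graph_space_def out_edges_def in_edges_def)
  fix e assume e: "e \<in> edges G"
  have eq: "{t \<in> edge_dom G e. edge_param G e t \<in> star v \<epsilon>} =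
      edge_dom G e \<inter> ((if src G e = Some v then {..<\<epsilon>} else {}) \<union> (if tgt G e = Some v then {1 - \<epsilon><..} else {}))"
    using \<epsilon> e by (auto simp: edge_param_def edge_dom_def Inner_in_star out_edges_def in_edges_def)
  show "openin (top_of_set (edge_dom G e)) {t \<in> edge_dom G e. edge_param G e t \<in> star v \<epsilon>}"
    unfolding eq by (intro openin_open_Int open_Un) auto
qed

lemma openin_edge:
  assumes "openin (graph_top G) U" "e \<in> edges G"
  obtains T where "open T" "\<And>t. t \<in> edge_dom G e \<Longrightarrow> edge_param G e t \<in> U \<longleftrightarrow> t \<in> T"
proof -
  have "openin (top_of_set (edge_dom G e)) {t \<in> edge_dom G e. edge_param G e t \<in> U}"
    using assms unfolding openin_graph_top by blast
  then obtain T where "open T" "{t \<in> edge_dom G e. edge_param G e t \<in> U} = edge_dom G e \<inter> T"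
    unfolding openin_open by blast
  then show thesis
    using that[of T] by blast
qed

lemma inner_edge_dom: "0 < t \<Longrightarrow> t < 1 \<Longrightarrow> t \<in> edge_dom G e"
  and inner_edge_param: "0 < t \<Longrightarrow> t < 1 \<Longrightarrow> edge_param G e t = Inner e t"
  by (simp_all add: edge_dom_def edge_param_def)

lemma interval_nbhd:
  assumes U: "openin (graph_top G) U" and x: "Inner e t \<in> U"
  obtains a b where "e \<in> edges G" "0 \<le> a" "a < t" "t < b" "b \<le> 1" "interval e a b \<subseteq> U"
proof -
  have et: "e \<in> edges G" "0 < t" "t < 1"
    using assms by (auto simp: openin_graph_top graph_space_def)
  obtain T where T: "open T" "\<And>t. t \<in> edge_dom G e \<Longrightarrow> edge_param G e t \<in> U \<longleftrightarrow> t \<in> T"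
    using openin_edge[OF U et(1)] by blast
  have "t \<in> T"
    using T(2)[of t] et x by (simp add: inner_edge_dom inner_edge_param)
  then obtain d where d: "d > 0" "ball t d \<subseteq> T"
    using T(1) open_contains_ball by blast
  have "interval e (max 0 (t - d)) (min 1 (t + d)) \<subseteq> U"
  proof
    fix y assume "y \<in> interval e (max 0 (t - d)) (min 1 (t + d))"
    then obtain s where s: "y = Inner e s" "0 < s" "s < 1" "t - d < s" "s < t + d"
      by (auto elim: interval_cases)
    then have "s \<in> T"
      using d(2) by (auto simp: dist_real_def)
    then show "y \<in> U"
      using s T(2)[of s] by (simp add: inner_edge_dom inner_edge_param)
  qed
  then show thesis
    using et d(1) by (intro that[of "max 0 (t - d)" "min 1 (t + d)"]) auto
qed

text \<open>Finiteness of the graph enters here: each edge end at \<open>v\<close> yields some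
  radius, and finitely many radii have a positive minimum. In the CW topology this makes the stars a
  neighbourhood base at \<open>v\<close>.\<close>

lemma star_nbhd:
  assumes U: "openin (graph_top G) U" and x: "Vert v \<in> U"
  obtains \<epsilon> where "0 < \<epsilon>" "\<epsilon> \<le> 1" "star v \<epsilon> \<subseteq> U"
proof -
  have "\<exists>d>0. (src G e = Some v \<longrightarrow> interval e 0 d \<subseteq> U) \<and> (tgt G e = Some v \<longrightarrow> interval e (1 - d) 1 \<subseteq> U)"
    if e: "e \<in> edges G" for e
  proof -
    obtain T where T: "open T" "\<And>t. t \<in> edge_dom G e \<Longrightarrow> edge_param G e t \<in> U \<longleftrightarrow> t \<in> T"
      using openin_edge[OF U e] by blast
    have end_nbhd: "\<exists>d>0. \<forall>s. \<bar>s - r\<bar> < d \<and> 0 < s \<and> s < 1 \<longrightarrow> Inner e s \<in> U"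
      if r: "r \<in> edge_dom G e" "edge_param G e r \<in> U" for r
    proof -
      obtain d where d: "d > 0" "ball r d \<subseteq> T"
        using T r open_contains_ball by blast
      have "Inner e s \<in> U" if "\<bar>s - r\<bar> < d" "0 < s" "s < 1" for s
      proof -
        have "s \<in> T"
          using that d(2) by (auto simp: dist_real_def)
        then show ?thesis
          using that T(2)[of s] by (simp add: inner_edge_dom inner_edge_param)
      qed
      then show ?thesis
        using d(1) by blast
    qed
    have "\<exists>d>0. d \<le> 1 \<and> interval e 0 d \<subseteq> U" if "src G e = Some v"
    proof -
      have "0 \<in> edge_dom G e" "edge_param G e 0 = Vert v"
        using that by (simp_all add: edge_dom_def edge_param_def)
      then obtain d where d: "d > 0" "\<And>s. \<bar>s - 0\<bar> < d \<Longrightarrow> 0 < s \<Longrightarrow> s < 1 \<Longrightarrow> Inner e s \<in> U"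
        using end_nbhd x by metis
      then show ?thesis
        by (intro exI[of _ "min d 1"]) (auto elim!: interval_cases)
    qed
    moreover have "\<exists>d>0. d \<le> 1 \<and> interval e (1 - d) 1 \<subseteq> U" if "tgt G e = Some v"
    proof -
      have "1 \<in> edge_dom G e" "edge_param G e 1 = Vert v"
        using that by (simp_all add: edge_dom_def edge_param_def)
      then obtain d where d: "d > 0" "\<And>s. \<bar>s - 1\<bar> < d \<Longrightarrow> 0 < s \<Longrightarrow> s < 1 \<Longrightarrow> Inner e s \<in> U"
        using end_nbhd x by metis
      then show ?thesis
        by (intro exI[of _ "min d 1"]) (auto elim!: interval_cases)
    qed
    \<comment> \<open>At most one end of \<open>e\<close> is \<open>v\<close>, so at most one of the
      two radii is asked for; if there is none, any positive number such as 1 will do.\<close>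
    ultimately show ?thesis
      using loopless[OF e]
      by (cases "src G e = Some v"; cases "tgt G e = Some v") (auto intro: exI[of _ "1::real"])
  qed
  then obtain d where d: "\<And>e. e \<in> edges G \<Longrightarrow> d e > 0"
    "\<And>e. e \<in> edges G \<Longrightarrow> src G e = Some v \<Longrightarrow> interval e 0 (d e) \<subseteq> U"
    "\<And>e. e \<in> edges G \<Longrightarrow> tgt G e = Some v \<Longrightarrow> interval e (1 - d e) 1 \<subseteq> U"
    by metis
  define \<epsilon> where "\<epsilon> = Min (insert 1 (d ` edges G))"
  have \<epsilon>: "0 < \<epsilon>" "\<epsilon> \<le> 1" "\<And>e. e \<in> edges G \<Longrightarrow> \<epsilon> \<le> d e"
    using d(1) finite_edges by (auto simp: \<epsilon>_def)
  have "star v \<epsilon> \<subseteq> U"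
    unfolding star_def
  proof (intro Un_least UN_least)
    fix e assume e: "e \<in> out_edges G v"
    then show "interval e 0 \<epsilon> \<subseteq> U"
      using d(2)[of e] \<epsilon>(3)[of e] by (fastforce simp: out_edges_def interval_def)
  next
    fix e assume e: "e \<in> in_edges G v"
    then show "interval e (1 - \<epsilon>) 1 \<subseteq> U"
      using d(3)[of e] \<epsilon>(3)[of e] by (fastforce simp: in_edges_def interval_def)
  qed (use x in auto)
  then show thesis
    using \<epsilon> that by blast
qed

lemma topspace_graph_top: "topspace (graph_top G) = graph_space G"
proof
  show "graph_space G \<subseteq> topspace (graph_top G)"
  proof
    fix x assume "x \<in> graph_space G"
    then consider v where "v \<in> verts G" "x = Vert v" | e t where "e \<in> edges G" "x = Inner e t" "0 < t" "t < 1"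
      by (auto simp: graph_space_def)
    then show "x \<in> topspace (graph_top G)"
    proof cases
      case 1
      then show ?thesis
        using openin_star[of v 1] openin_subset by force
    next
      case 2
      then show ?thesis
        using openin_interval[of e 0 1] openin_subset by force
    qed
  qed
qed (rule topspace_graph_top_subset)

lemma continuous_map_Inner:
  assumes e: "e \<in> edges G"
  shows "continuous_map (top_of_set {0<..<1}) (graph_top G) (Inner e)"
  unfolding continuous_map_def
proof (intro conjI allI impI)
  show "Inner e \<in> topspace (top_of_set {0<..<1}) \<rightarrow> topspace (graph_top G)"
    using e by (auto simp: topspace_graph_top graph_space_def)
  fix U assume U: "openin (graph_top G) U"
  then obtain T where T: "open T" "\<And>t. t \<in> edge_dom G e \<Longrightarrow> edge_param G e t \<in> U \<longleftrightarrow> t \<in> T"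
    using e openin_edge by blast
  have "Inner e t \<in> U \<longleftrightarrow> t \<in> T" if "0 < t" "t < 1" for t
    using T(2)[of t] that by (simp add: inner_edge_dom inner_edge_param)
  then have eq: "{t \<in> topspace (top_of_set {0<..<1}). Inner e t \<in> U} = {0<..<1} \<inter> T"
    by auto
  show "openin (top_of_set {0<..<1}) {t \<in> topspace (top_of_set {0<..<1}). Inner e t \<in> U}"
    unfolding eq by (rule openin_open_Int[OF T(1)])
qed

lemma connectedin_interval:
  assumes "e \<in> edges G" "0 \<le> a" "b \<le> 1"
  shows "connectedin (graph_top G) (interval e a b)"
  unfolding interval_def
proof (rule connectedin_continuous_map_image[OF continuous_map_Inner[OF assms(1)]])
  show "connectedin (top_of_set {0<..<1}) {a<..<b}"
    using assms by (auto simp: connectedin_subtopology)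
qed

lemma edge_basic_interval:
  "e \<in> edges G \<Longrightarrow> 0 \<le> a \<Longrightarrow> a < b \<Longrightarrow> b \<le> 1 \<Longrightarrow> edge_basic G e (interval e a b)"
  unfolding edge_basic_def
  using openin_interval connectedin_interval by (auto simp: interval_def)

subsection \<open>Stars are contractible\<close>

text \<open>Polar coordinates on a star: \<open>ray v e r\<close> is the point of the incident edge
  \<open>e\<close> at distance \<open>r\<close> from \<open>v\<close>, and \<open>height v\<close>
  recovers this distance.\<close>

definition ray :: "'v \<Rightarrow> 'e \<Rightarrow> real \<Rightarrow> ('v, 'e) point" where
  "ray v e r = (if r = 0 then Vert v else if e \<in> out_edges G v then Inner e r else Inner e (1 - r))"

definition height :: "'v \<Rightarrow> ('v, 'e) point \<Rightarrow> real" where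
  "height v x = (case x of Vert w \<Rightarrow> 0 | Inner e t \<Rightarrow> if e \<in> out_edges G v then t else 1 - t)"

text \<open>The straight-line homotopy in polar coordinates: at time \<open>s\<close> all distances
  from \<open>v\<close> are scaled by \<open>1 - s\<close>.\<close>

definition contraction :: "'v \<Rightarrow> real \<times> ('v, 'e) point \<Rightarrow> ('v, 'e) point" where
  "contraction v = (\<lambda>(s, x). case x of Vert w \<Rightarrow> Vert v | Inner e t \<Rightarrow> ray v e ((1 - s) * height v x))"

lemma height_star: "x \<in> star v \<epsilon> \<Longrightarrow> 0 \<le> height v x"
  "x \<in> star v \<epsilon> \<Longrightarrow> 0 < \<epsilon> \<Longrightarrow> height v x < \<epsilon>"
  using in_out_disjoint[of v] by (cases x; auto simp: height_def Inner_in_star)+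

lemma continuous_map_height:
  assumes v: "v \<in> verts G" and \<epsilon>: "0 < \<epsilon>" "\<epsilon> \<le> 1"
  shows "continuous_map (subtopology (graph_top G) (star v \<epsilon>)) euclideanreal (height v)"
  unfolding continuous_map_def
proof (intro conjI allI impI)
  fix T :: "real set" assume "openin euclideanreal T"
  then have T: "open T"
    by simp
  have "\<exists>W. openin (graph_top G) W \<and> x \<in> W \<and> (\<forall>y\<in>W \<inter> star v \<epsilon>. height v y \<in> T)"
    if x: "x \<in> star v \<epsilon>" "height v x \<in> T" for x
  proof -
    obtain d where d: "d > 0" "\<And>r. \<bar>r - height v x\<bar> < d \<Longrightarrow> r \<in> T"
      using T x(2) unfolding open_dist dist_real_def by blast
    show ?thesis
    proof (cases x)
      case (Vert w)
      then have h: "w = v" "height v x = 0"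
        using x by (auto simp: height_def)
      have "height v y \<in> T" if "y \<in> star v (min d 1)" for y
        using height_star[OF that] d h by auto
      then show ?thesis
        using openin_star[OF v, of "min d 1"] d(1) Vert h by (intro exI[of _ "star v (min d 1)"]) auto
    next
      case (Inner e t)
      then have et: "e \<in> edges G" "0 < t" "t < 1"
        using x(1) \<epsilon> by (auto simp: Inner_in_star out_edges_def in_edges_def)
      have "height v y \<in> T" if "y \<in> interval e (max 0 (t - d)) (min 1 (t + d))" for y
        using that by (auto elim!: interval_cases simp: height_def Inner abs_less_iff intro!: d(2))
      then show ?thesis
        using openin_interval[of e "max 0 (t - d)" "min 1 (t + d)"] et d(1) Inner
        by (intro exI[of _ "interval e (max 0 (t - d)) (min 1 (t + d))"]) auto
    qed
  qed
  then show "openin (subtopology (graph_top G) (star v \<epsilon>))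
      {x \<in> topspace (subtopology (graph_top G) (star v \<epsilon>)). height v x \<in> T}"
    using openin_subset[OF openin_star[OF v \<epsilon>]]
    by (subst openin_subopen) (fastforce simp: openin_subtopology)
qed auto

lemma contraction_Vert [simp]: "contraction v (s, Vert w) = Vert v"
  and contraction_Inner: "contraction v (s, Inner e t) = ray v e ((1 - s) * height v (Inner e t))"
  by (simp_all add: contraction_def)

lemma contraction_in_star:
  assumes s: "0 \<le> s" "s \<le> 1" and x: "x \<in> star v \<epsilon>" and less: "(1 - s) * height v x < \<delta>"
  shows "contraction v (s, x) \<in> star v \<delta>"
proof (cases x)
  case (Inner e t)
  have "0 \<le> (1 - s) * height v x"
    using s height_star(1)[OF x] by simp
  moreover have "e \<in> out_edges G v \<or> e \<in> in_edges G v"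
    using x Inner by (auto simp: Inner_in_star)
  moreover have "(1 - s) * height v x = 0 \<or> 0 < (1 - s) * height v x"
    using calculation(1) by linarith
  ultimately show ?thesis
    using less unfolding Inner contraction_Inner ray_def
    by (auto simp: Inner_in_star simp del: mult_eq_0_iff)
qed simp

text \<open>The scaled distance from \<open>v\<close> is a continuous real function of time and
  point, and continuity of the contraction is reduced to it. Near the centre the distance alone
  decides membership in a small star; away from the centre the edge is locally fixed and the
  distance is a coordinate on it.\<close>

lemma contractible_star:
  assumes v: "v \<in> verts G" and \<epsilon>: "0 < \<epsilon>" "\<epsilon> \<le> 1"
  shows "contractible_space (subtopology (graph_top G) (star v \<epsilon>))"
proof -
  let ?S = "subtopology (graph_top G) (star v \<epsilon>)"
  let ?P = "prod_topology (top_of_set {0..1::real}) ?S"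
  have topS: "topspace ?S = star v \<epsilon>"
    using openin_subset[OF openin_star[OF v \<epsilon>]] by auto
  have height: "continuous_map ?P euclideanreal (\<lambda>q. (1 - fst q) * height v (snd q))"
  proof (rule continuous_map_real_mult)
    have "continuous_map ?P euclideanreal fst"
      by (rule continuous_map_into_fulltopology[OF continuous_map_fst])
    then show "continuous_map ?P euclideanreal (\<lambda>q. 1 - fst q)"
      by (intro continuous_map_diff) auto
    show "continuous_map ?P euclideanreal (\<lambda>q. height v (snd q))"
      using continuous_map_compose[OF continuous_map_snd continuous_map_height[OF v \<epsilon>]]
      by (simp add: o_def)
  qed
  have "continuous_map ?P ?S (contraction v)"
    unfolding continuous_map_def
  proof (intro conjI allI impI)
    show "contraction v \<in> topspace ?P \<rightarrow> topspace ?S"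
    proof
      fix q assume "q \<in> topspace ?P"
      then obtain s x where q: "q = (s, x)" "0 \<le> s" "s \<le> 1" "x \<in> star v \<epsilon>"
        unfolding topspace_prod_topology topS by auto
      have "(1 - s) * height v x \<le> height v x"
        using q height_star(1)[OF q(4)] by (simp add: mult_left_le_one_le)
      then have "(1 - s) * height v x < \<epsilon>"
        using height_star(2)[OF q(4) \<epsilon>(1)] by simp
      then show "contraction v q \<in> topspace ?S"
        unfolding topS q(1) using q by (intro contraction_in_star) auto
    qed
    fix W assume "openin ?S W"
    then obtain W' where W': "openin (graph_top G) W'" "W = W' \<inter> star v \<epsilon>"
      by (auto simp: openin_subtopology)
    have "\<exists>N. openin ?P N \<and> q \<in> N \<and> N \<subseteq> {q \<in> topspace ?P. contraction v q \<in> W}"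
      if q: "q \<in> topspace ?P" "contraction v q \<in> W" for q
    proof -
      have star: "contraction v q' \<in> star v \<epsilon>" if "q' \<in> topspace ?P" for q'
        using funcset_mem[OF \<open>contraction v \<in> topspace ?P \<rightarrow> topspace ?S\<close> that] topS by simp
      obtain s x where sx: "q = (s, x)" "0 \<le> s" "s \<le> 1" "x \<in> star v \<epsilon>"
        using q(1) unfolding topspace_prod_topology topS by auto
      show ?thesis
      proof (cases "contraction v q")
        case (Vert w)
        then have "w = v"
          using star[OF q(1)] by simp
        then have "Vert v \<in> W'"
          using q(2) W'(2) Vert by simp
        then obtain \<delta> where \<delta>: "0 < \<delta>" "star v \<delta> \<subseteq> W'"
          using star_nbhd[OF W'(1)] by metis
        \<comment> \<open>The points that the homotopy moves to distance less than
          \<open>\<delta>\<close> from \<open>v\<close>, hence into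
          \<open>star v \<delta>\<close>.\<close>
        let ?N = "{q \<in> topspace ?P. (1 - fst q) * height v (snd q) \<in> {..<\<delta>}}"
        have "openin ?P ?N"
          by (rule openin_continuous_map_preimage[OF height]) simp
        moreover have "(1 - s) * height v x = 0"
          using Vert sx by (cases x) (auto simp: height_def contraction_Inner ray_def split: if_splits)
        then have "(1 - fst q) * height v (snd q) < \<delta>"
          using \<delta>(1) by (simp only: sx(1) fst_conv snd_conv)
        then have "q \<in> ?N"
          using q(1) by blast
        moreover have "contraction v q' \<in> W" if q': "q' \<in> ?N" for q'
        proof -
          obtain s' x' where "q' = (s', x')" "0 \<le> s'" "s' \<le> 1" "x' \<in> star v \<epsilon>"
            "(1 - s') * height v x' < \<delta>"
            using q' unfolding topspace_prod_topology topS by auto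
          then have "contraction v q' \<in> star v \<delta>"
            using contraction_in_star by simp
          then show ?thesis
            using \<delta>(2) star[of q'] q' W'(2) by blast
        qed
        ultimately show ?thesis
          by blast
      next
        case (Inner e r)
        then have "Inner e r \<in> W'"
          using q(2) W'(2) by simp
        then obtain a b where ab: "e \<in> edges G" "0 \<le> a" "a < r" "r < b" "b \<le> 1" "interval e a b \<subseteq> W'"
          by (rule interval_nbhd[OF W'(1)])
        obtain t where t: "x = Inner e t"
          using Inner sx(1) by (cases x) (auto simp: contraction_Inner ray_def split: if_splits)
        \<comment> \<open>The parameter interval from \<open>a\<close> to \<open>b\<close>,
          rewritten as a range of distances from \<open>v\<close>; on an incoming edge the distance
          is 1 minus the parameter.\<close>
        define J where "J = (if e \<in> out_edges G v then {a<..<b} else {1 - b<..<1 - a})"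
        have J: "ray v e h \<in> interval e a b \<longleftrightarrow> h \<in> J" for h
          using ab unfolding J_def ray_def by auto
        \<comment> \<open>The second set keeps the moving point on the edge \<open>e\<close>, where
          its image is determined by the scaled distance.\<close>
        let ?N = "{q \<in> topspace ?P. (1 - fst q) * height v (snd q) \<in> J} \<inter>
          {q \<in> topspace ?P. snd q \<in> interval e 0 1 \<inter> star v \<epsilon>}"
        have "openin ?S (interval e 0 1 \<inter> star v \<epsilon>)"
          using openin_interval[OF ab(1), of 0 1] by (auto simp: openin_subtopology)
        moreover have "openin euclideanreal J"
          by (simp add: J_def)
        ultimately have "openin ?P ?N"
          using openin_continuous_map_preimage[OF height]
            openin_continuous_map_preimage[OF continuous_map_snd] openin_Int by blast
        moreover have "q \<in> ?N"
        proof -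
          have "ray v e ((1 - s) * height v x) \<in> interval e a b"
            using Inner ab unfolding sx(1) t contraction_Inner by simp
          moreover have "x \<in> interval e 0 1"
            using sx(4) \<epsilon> unfolding t by (auto simp: Inner_in_star)
          ultimately show ?thesis
            using q(1) sx by (simp add: J)
        qed
        moreover have "contraction v q' \<in> W" if q': "q' \<in> ?N" for q'
        proof -
          obtain s' t' where "q' = (s', Inner e t')" "(1 - s') * height v (Inner e t') \<in> J"
            using q' by (auto elim!: interval_cases)
          then have "contraction v q' \<in> interval e a b"
            by (simp add: contraction_Inner J)
          then show ?thesis
            using ab(6) star[of q'] q' W'(2) by blast
        qed
        ultimately show ?thesis
          by blast
      qed
    qed
    then show "openin ?P {q \<in> topspace ?P. contraction v q \<in> W}"
      by (subst openin_subopen) blast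
  qed
  moreover have "contraction v (0, x) = x" if "x \<in> star v \<epsilon>" for x
    using that in_out_disjoint[of v]
    by (cases x) (auto simp: contraction_Inner ray_def height_def Inner_in_star)
  moreover have "contraction v (1, x) = Vert v" for x
    by (cases x) (auto simp: contraction_Inner ray_def)
  ultimately show ?thesis
    unfolding contractible_space_def
    by (intro exI[of _ "Vert v"], subst homotopic_with) (auto simp: topS intro!: exI[of _ "contraction v"])
qed

lemma vertex_basic_star:
  "v \<in> verts G \<Longrightarrow> 0 < \<epsilon> \<Longrightarrow> \<epsilon> \<le> 1 \<Longrightarrow> vertex_basic G v (star v \<epsilon>)"
  using openin_star contractible_star by (simp add: vertex_basic_def)

end

section \<open>Potentials on forests\<close>

definition internal_edges :: "('v, 'e) ext_digraph \<Rightarrow> 'e set" where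
  "internal_edges G = {e \<in> edges G. src G e \<noteq> None \<and> tgt G e \<noteq> None}"

definition simple_path :: "('v, 'e) ext_digraph \<Rightarrow> 'e set \<Rightarrow> 'v \<Rightarrow> 'v \<Rightarrow> 'v list \<Rightarrow> 'e list \<Rightarrow> bool" where
  "simple_path G E u w vs es \<longleftrightarrow> length vs = Suc (length es) \<and> vs ! 0 = u \<and> vs ! length es = w \<and>
    distinct vs \<and> (\<forall>i<length es. es ! i \<in> E \<and> joins G (es ! i) (vs ! i) (vs ! Suc i))"

lemma reachable_simple_path:
  assumes "(u, w) \<in> {(a, b). \<exists>e\<in>E. joins G e a b}\<^sup>*"
  shows "\<exists>vs es. simple_path G E u w vs es"
  using assms
proof (induction rule: rtrancl_induct)
  case base
  show ?case
    by (intro exI[of _ "[u]"] exI[of _ "[]"]) (simp add: simple_path_def)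
next
  case (step x y)
  then obtain vs es e where p: "simple_path G E u x vs es" and e: "e \<in> E" "joins G e x y"
    by auto
  show ?case
  proof (cases "y \<in> set vs")
    case True
    then obtain i where i: "i < length vs" "vs ! i = y"
      by (auto simp: in_set_conv_nth)
    \<comment> \<open>If \<open>y\<close> was visited before, the path is cut there instead of being
      prolonged.\<close>
    then have "simple_path G E u y (take (Suc i) vs) (take i es)"
      using p by (auto simp: simple_path_def)
    then show ?thesis
      by blast
  next
    case False
    then have "simple_path G E u y (vs @ [y]) (es @ [e])"
      using p e by (auto simp: simple_path_def nth_append less_Suc_eq)
    then show ?thesis
      by blast
  qed
qed

lemma joins_unique: "joins G e a b \<Longrightarrow> joins G e c d \<Longrightarrow> {a, b} = {c, d}"
  by (auto simp: joins_def)

text \<open>An edge determines its unordered pair of ends, and consecutive pairs of a sequence of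
  distinct vertices are different.\<close>

lemma simple_path_distinct_edges:
  assumes "simple_path G E u w vs es"
  shows "distinct es"
  unfolding distinct_conv_nth
proof (intro allI impI)
  fix i j assume ij: "i < length es" "j < length es" "i \<noteq> j"
  show "es ! i \<noteq> es ! j"
  proof
    assume "es ! i = es ! j"
    then have "{vs ! i, vs ! Suc i} = {vs ! j, vs ! Suc j}"
      using assms ij joins_unique unfolding simple_path_def by metis
    moreover have "vs ! k = vs ! l \<longleftrightarrow> k = l" if "k \<le> length es" "l \<le> length es" for k l
      using assms that by (auto simp: simple_path_def nth_eq_iff_index_eq)
    ultimately show False
      using ij by (auto simp: doubleton_eq_iff)
  qed
qed

text \<open>The empty path is included: then \<open>u = w\<close>, the edge \<open>e\<close> is a
  loop, and the cycle has length 1.\<close>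

lemma closing_edge_cycle:
  assumes "simple_path G E w u vs es" "e \<notin> E" "joins G e u w"
  shows "is_cycle G vs (es @ [e])"
proof -
  have "e \<notin> set es"
    using assms by (auto simp: simple_path_def in_set_conv_nth)
  moreover have "joins G ((es @ [e]) ! i) (vs ! i) (vs ! (Suc i mod length (es @ [e])))"
    if "i < length (es @ [e])" for i
  proof (cases "i = length es")
    case False
    then have "i < length es"
      using that by simp
    then show ?thesis
      using assms by (simp add: simple_path_def nth_append)
  qed (use assms in \<open>simp add: simple_path_def\<close>)
  ultimately show ?thesis
    using assms simple_path_distinct_edges[OF assms(1)] by (auto simp: is_cycle_def simple_path_def)
qed

text \<open>Edges are added one at a time. The ends of a new edge lie in different components of the
  edges treated so far, since a path between them would close up to a cycle; so the potential may be
  shifted on one of the two components.\<close>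

lemma forest_potential:
  fixes h :: "'e \<Rightarrow> 'b :: ab_group_add"
  assumes fin: "finite (edges G)" and acyclic: "\<nexists>vs es. is_cycle G vs es"
  shows "\<exists>g. \<forall>e\<in>edges G. \<forall>u w. src G e = Some u \<longrightarrow> tgt G e = Some w \<longrightarrow> g w = g u + h e"
proof -
  have "\<exists>g. \<forall>e\<in>E. \<forall>u w. src G e = Some u \<longrightarrow> tgt G e = Some w \<longrightarrow> g w = g u + h e"
    if "E \<subseteq> edges G" for E
    using finite_subset[OF that fin] that
  proof (induction E)
    case (insert e E)
    then obtain g where g: "\<And>e u w. e \<in> E \<Longrightarrow> src G e = Some u \<Longrightarrow> tgt G e = Some w \<Longrightarrow> g w = g u + h e"
      by auto
    show ?case
    proof (cases "\<exists>u w. src G e = Some u \<and> tgt G e = Some w")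
      case True
      then obtain u w where uw: "src G e = Some u" "tgt G e = Some w"
        by auto
      let ?R = "{(a, b). \<exists>e\<in>E. joins G e a b}\<^sup>*"
      have "(w, u) \<notin> ?R"
      proof
        assume wu: "(w, u) \<in> ?R"
        obtain vs es where path: "simple_path G E w u vs es"
          using reachable_simple_path[OF wu] by blast
        have "joins G e u w"
          using insert.prems uw by (simp add: joins_def)
        then show False
          using acyclic closing_edge_cycle[OF path insert.hyps(2)] by blast
      qed
      \<comment> \<open>The component of \<open>w\<close> is shifted by the defect of the equation
        for \<open>e\<close>. Edges in \<open>E\<close> have both ends inside or both outside this
        component and keep their equations.\<close>
      define g' where "g' x = (if (w, x) \<in> ?R then g x + (h e - (g w - g u)) else g x)" for x
      have "g' b = g' a + h e'" if e': "e' \<in> E" "src G e' = Some a" "tgt G e' = Some b" for e' a b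
      proof -
        have "joins G e' a b" "joins G e' b a"
          using e' insert.prems by (auto simp: joins_def)
        then have "(w, a) \<in> ?R \<longleftrightarrow> (w, b) \<in> ?R"
          using e'(1) by (auto intro: rtrancl_into_rtrancl)
        then show ?thesis
          using g[OF e'] by (auto simp: g'_def algebra_simps)
      qed
      moreover have "g' w = g' u + h e"
        using \<open>(w, u) \<notin> ?R\<close> by (simp add: g'_def)
      ultimately show ?thesis
        using uw by (intro exI[of _ g']) auto
    next
      case False
      then show ?thesis
        using g by (intro exI[of _ g]) auto
    qed
  qed simp
  then show ?thesis
    by blast
qed

section \<open>The switching presheaf\<close>

lemma field_F2: "field F2"
proof -
  have "cring F2"
  proof (rule cringI)
    show "abelian_group F2"
      by (rule abelian_groupI) (auto simp: F2_def add.assoc add.commute intro!: exI[of _ "- _"])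
    show "comm_monoid F2"
      by (rule comm_monoidI) (auto simp: F2_def mult.assoc mult.commute)
    show "(x \<oplus>\<^bsub>F2\<^esub> y) \<otimes>\<^bsub>F2\<^esub> z = x \<otimes>\<^bsub>F2\<^esub> z \<oplus>\<^bsub>F2\<^esub> y \<otimes>\<^bsub>F2\<^esub> z" for x y z
      by (cases z) (simp_all add: F2_def)
  qed
  then interpret cring F2 .
  show ?thesis
  proof (rule cring_fieldI)
    show "Units F2 = carrier F2 - {\<zero>\<^bsub>F2\<^esub>}"
      by (auto simp: F2_def Units_def)
  qed
qed

lemma cring_F2: "cring F2"
  using field_F2 by (simp add: field_def domain_def)

lemma bit_add_self: "(a :: bit) + a = 0"
  by (cases a) auto

lemma tens_module: "module F2 (tens m)"
proof (rule Module.moduleI[OF cring_F2])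
  show "abelian_group (tens m)"
  proof (rule abelian_groupI)
    fix x assume "x \<in> carrier (tens m)"
    then show "\<exists>y\<in>carrier (tens m). y \<oplus>\<^bsub>tens m\<^esub> x = \<zero>\<^bsub>tens m\<^esub>"
      by (intro bexI[of _ x]) (auto simp: tens_def bit_add_self)
    show "x \<oplus>\<^bsub>tens m\<^esub> y \<oplus>\<^bsub>tens m\<^esub> z = x \<oplus>\<^bsub>tens m\<^esub> (y \<oplus>\<^bsub>tens m\<^esub> z)" for x y z
      by (simp only: tens_def ring_record_simps add.assoc)
    show "x \<oplus>\<^bsub>tens m\<^esub> y = y \<oplus>\<^bsub>tens m\<^esub> x" for x y
      by (simp only: tens_def ring_record_simps add.commute)
  qed (auto simp: tens_def)
  show "(a \<oplus>\<^bsub>F2\<^esub> b) \<odot>\<^bsub>tens m\<^esub> x = a \<odot>\<^bsub>tens m\<^esub> x \<oplus>\<^bsub>tens m\<^esub> b \<odot>\<^bsub>tens m\<^esub> x" for a b x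
    by (simp only: tens_def F2_def ring_record_simps module.simps distrib_right)
  show "a \<odot>\<^bsub>tens m\<^esub> (x \<oplus>\<^bsub>tens m\<^esub> y) = a \<odot>\<^bsub>tens m\<^esub> x \<oplus>\<^bsub>tens m\<^esub> a \<odot>\<^bsub>tens m\<^esub> y" for a x y
    by (simp only: tens_def ring_record_simps module.simps distrib_left)
qed (auto simp: tens_def F2_def)

lemma carrier_tens: "x \<in> carrier (tens m) \<longleftrightarrow> (\<forall>a. length a \<noteq> m \<longrightarrow> x a = 0)"
  and zero_tens: "\<zero>\<^bsub>tens m\<^esub> = (\<lambda>a. 0)"
  and add_tens: "x \<oplus>\<^bsub>tens m\<^esub> y = (\<lambda>a. x a + y a)"
  by (simp_all add: tens_def)

lemma lin_ext_hom:
  assumes "\<And>a. g a \<in> carrier (tens n)"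
  shows "lin_ext m g \<in> module_hom F2 (tens m) (tens n)"
proof (rule module_homI)
  show "lin_ext m g x \<in> carrier (tens n)" for x
    using assms by (simp add: lin_ext_def carrier_tens)
qed (auto simp: lin_ext_add lin_ext_smult)

lemma onehot_tens: "onehot b \<in> carrier (tens 1)"
  by (auto simp: carrier_tens onehot_def)

declare One_nat_def [simp del]

locale switching_circuit = loopless_ext_digraph G
  for G :: "('v, 'e) ext_digraph" +
  fixes C :: "('v, 'e) circuit"
  assumes logic_circuit: "logic_circuit G C"
begin

text \<open>The restriction from neighbourhoods of \<open>v\<close> to intervals on
  \<open>e\<close>. It depends on the vertex and the edge only, not on the basic sets.\<close>

definition edge_map :: "'v \<Rightarrow> 'e \<Rightarrow> (bit list \<Rightarrow> bit) \<Rightarrow> bit list \<Rightarrow> bit" where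
  "edge_map v e = (if e \<in> in_edges G v then contract (length (ins C v)) (index_of (ins C v) e)
    else gate_map C v (index_of (outs C v) e))"

abbreviation vspace :: "'v \<Rightarrow> (bit, bit list \<Rightarrow> bit) module" where
  "vspace v \<equiv> tens (length (ins C v))"

abbreviation P :: "(('v, 'e) point, bit, bit list \<Rightarrow> bit) presheaf" where
  "P \<equiv> switching_presheaf G C"

abbreviation X :: "('v, 'e) point topology" where
  "X \<equiv> graph_top G"

lemma edge_map_hom: "edge_map v e \<in> module_hom F2 (vspace v) (tens 1)"
  unfolding edge_map_def contract_def gate_map_def using lin_ext_hom[OF onehot_tens] by auto

lemma vertex_basic_unique: "vertex_basic G v U \<Longrightarrow> vertex_basic G w U \<Longrightarrow> v = w"
  by (auto simp: vertex_basic_def)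

lemma vertex_basic_mem: "vertex_basic G v U \<Longrightarrow> Vert w \<in> U \<longleftrightarrow> w = v"
  by (auto simp: vertex_basic_def)

lemma edge_basic_mem: "edge_basic G e U \<Longrightarrow> Vert w \<notin> U"
  by (auto simp: edge_basic_def)

lemma edge_basic_subset_unique:
  assumes "edge_basic G e U" "edge_basic G e' V" "V \<subseteq> U"
  shows "e' = e"
  using assms by (auto simp: edge_basic_def)

lemma the_vertex: "vertex_basic G v U \<Longrightarrow> (THE v. vertex_basic G v U) = v"
  using vertex_basic_unique by blast

lemma the_edge: "edge_basic G e U \<Longrightarrow> (THE e. edge_basic G e U) = e"
  using edge_basic_subset_unique[OF _ _ subset_refl] by (intro the_equality)

lemma P_opens_cases:
  assumes "U \<in> opens P"
  obtains (vertex) v where "v \<in> verts G" "vertex_basic G v U" | (edge) e where "e \<in> edges G" "edge_basic G e U"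
  using assms by (auto simp: switching_presheaf_def)

lemma vertex_basic_opens: "v \<in> verts G \<Longrightarrow> vertex_basic G v U \<Longrightarrow> U \<in> opens P"
  and edge_basic_opens: "e \<in> edges G \<Longrightarrow> edge_basic G e U \<Longrightarrow> U \<in> opens P"
  by (auto simp: switching_presheaf_def)

lemma sect_vertex_basic: "v \<in> verts G \<Longrightarrow> vertex_basic G v U \<Longrightarrow> sect P U = vspace v"
  by (auto simp: switching_presheaf_def the_vertex)

lemma sect_edge_basic:
  assumes "edge_basic G e U" shows "sect P U = tens 1"
proof -
  have "\<not> vertex_basic G v U" for v
    using assms vertex_basic_mem edge_basic_mem by blast
  then show ?thesis
    by (simp add: switching_presheaf_def)
qed

lemma restr_vertex_edge:
  "v \<in> verts G \<Longrightarrow> vertex_basic G v U \<Longrightarrow> e \<in> edges G \<Longrightarrow> edge_basic G e V \<Longrightarrow> restr P U V = edge_map v e"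
  unfolding switching_presheaf_def edge_map_def by (auto simp: the_vertex the_edge Let_def fun_eq_iff)

lemma restr_vertex_vertex:
  assumes "vertex_basic G w V" shows "restr P U V = (\<lambda>s. s)"
proof -
  have "\<not> edge_basic G e V" for e
    using assms vertex_basic_mem edge_basic_mem by blast
  then show ?thesis
    by (simp add: switching_presheaf_def fun_eq_iff)
qed

lemma restr_edge:
  assumes "edge_basic G e U" shows "restr P U V = (\<lambda>s. s)"
proof -
  have "\<not> vertex_basic G v U" for v
    using assms vertex_basic_mem edge_basic_mem by blast
  then show ?thesis
    by (simp add: switching_presheaf_def fun_eq_iff)
qed

lemma id_hom: "(\<lambda>s. s) \<in> module_hom R M M"
  by (intro module_homI) auto

text \<open>A basic set inside an edge contains no neighbourhood of a vertex. So in a chain of basic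
  sets at most one restriction passes from a vertex to an edge, the others are identities, and
  functoriality follows.\<close>

lemma P_presheaf: "module_presheaf F2 X P"
proof (rule module_presheaf.intro[OF cring_F2])
  fix U assume U: "U \<in> opens P"
  show "openin X U"
    using U by (cases rule: P_opens_cases) (auto simp: vertex_basic_def edge_basic_def)
  show "module F2 (sect P U)"
    using U by (cases rule: P_opens_cases) (auto simp: sect_vertex_basic sect_edge_basic tens_module)
  show "restr P U U s = s" for s
    using U by (cases rule: P_opens_cases) (auto simp: restr_vertex_vertex restr_edge)
  fix V assume V: "V \<in> opens P" "V \<subseteq> U"
  show "restr P U V \<in> module_hom F2 (sect P U) (sect P V)"
    using U
  proof (cases rule: P_opens_cases)
    case (vertex v)
    show ?thesis
      using V(1)
    proof (cases rule: P_opens_cases)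
      case v': (vertex w)
      then have "w = v"
        using vertex V(2) vertex_basic_mem by blast
      then show ?thesis
        using vertex v' by (simp add: sect_vertex_basic restr_vertex_vertex id_hom)
    next
      case (edge e)
      then show ?thesis
        using vertex by (simp add: sect_vertex_basic sect_edge_basic restr_vertex_edge edge_map_hom)
    qed
  next
    case (edge e)
    show ?thesis
      using V(1)
    proof (cases rule: P_opens_cases)
      case (vertex w)
      then show ?thesis
        using edge V(2) vertex_basic_mem edge_basic_mem by blast
    next
      case e': (edge e')
      then show ?thesis
        using edge by (simp add: sect_edge_basic restr_edge id_hom)
    qed
  qed
  fix W s assume W: "W \<in> opens P" "W \<subseteq> V"
  show "restr P V W (restr P U V s) = restr P U W s"
    using V(1)
  proof (cases rule: P_opens_cases)
    case (vertex v)
    then have v_U: "Vert v \<in> U"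
      using V(2) vertex_basic_mem[of v V v] by blast
    then have "\<not> edge_basic G e U" for e
      using edge_basic_mem by blast
    with U obtain v' where v': "v' \<in> verts G" "vertex_basic G v' U"
      by (cases rule: P_opens_cases) auto
    then have "v' = v"
      using v_U vertex_basic_mem[of v' U v] by simp
    show ?thesis
      using W(1)
    proof (cases rule: P_opens_cases)
      case (vertex w)
      then show ?thesis
        using \<open>vertex_basic G v V\<close> by (simp add: restr_vertex_vertex)
    next
      case (edge e)
      then show ?thesis
        using vertex v' \<open>v' = v\<close> by (simp add: restr_vertex_vertex restr_vertex_edge)
    qed
  next
    case (edge e)
    then have "\<not> vertex_basic G w W" for w
      using W(2) vertex_basic_mem edge_basic_mem by blast
    with W obtain e' where e': "e' \<in> edges G" "edge_basic G e' W"
      by (cases rule: P_opens_cases) auto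
    have [simp]: "e' = e"
      using edge_basic_subset_unique[OF edge(2) e'(2) W(2)] .
    show ?thesis
      using U
    proof (cases rule: P_opens_cases)
      case (vertex v)
      then show ?thesis
        using edge e' by (simp add: restr_edge restr_vertex_edge)
    next
      case e2: (edge e2)
      then show ?thesis
        using edge e' by (simp add: restr_edge)
    qed
  qed
next
  fix U x assume U: "openin X U" "x \<in> U"
  show "\<exists>B\<in>opens P. x \<in> B \<and> B \<subseteq> U"
  proof (cases x)
    case (Vert v)
    then have v: "v \<in> verts G"
      using U by (auto simp: openin_graph_top graph_space_def)
    obtain \<epsilon> where \<epsilon>: "0 < \<epsilon>" "\<epsilon> \<le> 1" "star v \<epsilon> \<subseteq> U"
      using star_nbhd[OF U(1)] U(2) unfolding Vert by blast
    then show ?thesis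
      using Vert v by (intro bexI[of _ "star v \<epsilon>"]) (auto intro: vertex_basic_opens vertex_basic_star)
  next
    case (Inner e t)
    obtain a b where "e \<in> edges G" "0 \<le> a" "a < t" "t < b" "b \<le> 1" "interval e a b \<subseteq> U"
      using interval_nbhd[OF U(1)] U(2) unfolding Inner by blast
    then show ?thesis
      using Inner by (intro bexI[of _ "interval e a b"]) (auto intro!: edge_basic_opens[of e] edge_basic_interval)
  qed
qed

end

section \<open>Sections and germs of the switching sheaf\<close>

context switching_circuit
begin

sublocale P: module_presheaf F2 X P
  by (rule P_presheaf)

abbreviation F :: "(('v, 'e) point, bit, ('v, 'e) point \<Rightarrow> (('v, 'e) point set \<times> (bit list \<Rightarrow> bit)) set) presheaf"
  where "F \<equiv> switching_sheaf G C"

sublocale F: module_sheaf F2 X F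
  unfolding switching_sheaf_def by (rule P.sheafify_sheaf)

lemma sect_F: "\<xi> \<in> carrier (sect F U) \<longleftrightarrow> \<xi> \<in> extensional U \<and>
    (\<forall>x\<in>U. \<exists>B\<in>opens P. x \<in> B \<and> B \<subseteq> U \<and> (\<exists>s\<in>carrier (sect P B). \<forall>y\<in>B. \<xi> y = germ P y B s))"
  unfolding switching_sheaf_def by (rule P.carrier_sheafify)

lemma section_obtain:
  assumes "\<xi> \<in> carrier (sect F U)" "x \<in> U"
  obtains B s where "B \<in> opens P" "x \<in> B" "B \<subseteq> U" "s \<in> carrier (sect P B)"
    "\<forall>y\<in>B. \<xi> y = germ P y B s"
proof -
  have "\<exists>B\<in>opens P. x \<in> B \<and> B \<subseteq> U \<and> (\<exists>s\<in>carrier (sect P B). \<forall>y\<in>B. \<xi> y = germ P y B s)"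
    using assms unfolding sect_F by (elim conjE bspec)
  then show thesis
    by (elim bexE conjE) (rule that)
qed

lemma germ_F_eq_iff:
  assumes "openin X U" "openin X V" "x \<in> U" "x \<in> V" "\<xi> \<in> carrier (sect F U)" "\<eta> \<in> carrier (sect F V)"
  shows "germ F x U \<xi> = germ F x V \<eta> \<longleftrightarrow> (\<exists>B. openin X B \<and> x \<in> B \<and> B \<subseteq> U \<inter> V \<and> (\<forall>y\<in>B. \<xi> y = \<eta> y))"
  using assms unfolding switching_sheaf_def by (rule P.sheafify_germ_eq_iff)

lemma germs_P_section:
  assumes "U \<in> opens P" "s \<in> carrier (sect P U)"
  shows "germs P U s \<in> carrier (sect F U)"
  unfolding sect_F
proof (intro conjI ballI)
  show "\<exists>B\<in>opens P. x \<in> B \<and> B \<subseteq> U \<and> (\<exists>t\<in>carrier (sect P B). \<forall>y\<in>B. germs P U s y = germ P y B t)"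
    if "x \<in> U" for x
    using assms that by (intro bexI[of _ U] conjI bexI[of _ s]) (auto simp: P.germs_apply)
qed (simp add: germs_def)

lemma germs_P_hom:
  assumes "U \<in> opens P"
  shows "germs P U \<in> module_hom F2 (sect P U) (sect F U)"
proof (rule module_homI)
  show "germs P U s \<in> carrier (sect F U)" if "s \<in> carrier (sect P U)" for s
    using germs_P_section[OF assms that] .
  note hom = P.germs_hom[OF assms]
  show "germs P U (s \<oplus>\<^bsub>sect P U\<^esub> t) = germs P U s \<oplus>\<^bsub>sect F U\<^esub> germs P U t"
    if "s \<in> carrier (sect P U)" "t \<in> carrier (sect P U)" for s t
    using module_hom_add[OF hom that] by (simp add: switching_sheaf_def sheafify_def)
  show "germs P U (c \<odot>\<^bsub>sect P U\<^esub> s) = c \<odot>\<^bsub>sect F U\<^esub> germs P U s"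
    if "c \<in> carrier F2" "s \<in> carrier (sect P U)" for c s
    using module_hom_smult[OF hom that] by (simp add: switching_sheaf_def sheafify_def)
qed

subsection \<open>Sections over intervals\<close>

abbreviation open_edge :: "'e \<Rightarrow> ('v, 'e) point set" where
  "open_edge e \<equiv> interval e 0 1"

lemma interval_opens: "e \<in> edges G \<Longrightarrow> 0 \<le> a \<Longrightarrow> a < b \<Longrightarrow> b \<le> 1 \<Longrightarrow> interval e a b \<in> opens P"
  and sect_interval: "e \<in> edges G \<Longrightarrow> 0 \<le> a \<Longrightarrow> a < b \<Longrightarrow> b \<le> 1 \<Longrightarrow> sect P (interval e a b) = tens 1"
  using edge_basic_opens edge_basic_interval sect_edge_basic by blast+

text \<open>The presheaf is constant along an edge, so a vector \<open>c\<close> has one germ at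
  each inner point. The open edge serves as the common reference neighbourhood.\<close>

definition edge_germ :: "'e \<Rightarrow> (bit list \<Rightarrow> bit) \<Rightarrow> real \<Rightarrow> (('v, 'e) point set \<times> (bit list \<Rightarrow> bit)) set" where
  "edge_germ e c t = germ P (Inner e t) (open_edge e) c"

lemma germ_edge_basic:
  assumes e: "e \<in> edges G" and U: "edge_basic G e U" "Inner e t \<in> U" and c: "c \<in> carrier (tens 1)"
  shows "germ P (Inner e t) U c = edge_germ e c t"
proof -
  have "U \<subseteq> open_edge e"
    using U(1) by (auto simp: edge_basic_def interval_def)
  then have "germ P (Inner e t) U (restr P (open_edge e) U c) = germ P (Inner e t) (open_edge e) c"
    using e U c by (intro P.germ_restr) (auto intro: interval_opens edge_basic_opens simp: sect_interval)
  then show ?thesis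
    using e edge_basic_interval[of e 0 1] by (simp add: restr_edge edge_germ_def)
qed

lemma germ_interval:
  "e \<in> edges G \<Longrightarrow> 0 \<le> a \<Longrightarrow> a < t \<Longrightarrow> t < b \<Longrightarrow> b \<le> 1 \<Longrightarrow> c \<in> carrier (tens 1) \<Longrightarrow>
    germ P (Inner e t) (interval e a b) c = edge_germ e c t"
  using germ_edge_basic edge_basic_interval[of e a b] by simp

text \<open>A small interval around the point lies in \<open>U\<close>, and there \<open>s\<close>
  restricts to the constant \<open>edge_map v e s\<close>.\<close>

lemma germ_vertex_basic:
  assumes v: "v \<in> verts G" and U: "vertex_basic G v U" "Inner e t \<in> U" and s: "s \<in> carrier (vspace v)"
  shows "germ P (Inner e t) U s = edge_germ e (edge_map v e s) t"
proof -
  have open_U: "openin X U"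
    using U by (simp add: vertex_basic_def)
  obtain a b where ab: "e \<in> edges G" "0 \<le> a" "a < t" "t < b" "b \<le> 1" "interval e a b \<subseteq> U"
    using U(2) by (rule interval_nbhd[OF open_U])
  then have basic: "edge_basic G e (interval e a b)"
    by (intro edge_basic_interval) auto
  have "germ P (Inner e t) (interval e a b) (restr P U (interval e a b) s) = germ P (Inner e t) U s"
    using v U s ab by (intro P.germ_restr) (auto intro: interval_opens vertex_basic_opens simp: sect_vertex_basic)
  then show ?thesis
    using ab v U(1) basic module_hom_mem[OF edge_map_hom s]
    by (simp add: restr_vertex_edge germ_interval)
qed

lemma edge_germ_inj:
  assumes "e \<in> edges G" "0 < t" "t < 1" "c \<in> carrier (tens 1)" "d \<in> carrier (tens 1)"
  shows "edge_germ e c t = edge_germ e d t \<longleftrightarrow> c = d"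
proof
  assume "edge_germ e c t = edge_germ e d t"
  then obtain B where "restr P (open_edge e) B c = restr P (open_edge e) B d"
    unfolding edge_germ_def using assms
    by (subst (asm) P.germ_eq_iff) (simp_all add: sect_interval interval_opens Bex_def, blast)
  then show "c = d"
    using assms(1) edge_basic_interval[of e 0 1] by (simp add: restr_edge)
qed simp

lemma section_edge_local:
  assumes \<xi>: "\<xi> \<in> carrier (sect F U)" and U: "openin X U" "Inner e t \<in> U"
  obtains a b c where "0 \<le> a" "a < t" "t < b" "b \<le> 1" "interval e a b \<subseteq> U" "c \<in> carrier (tens 1)"
    "\<And>s. a < s \<Longrightarrow> s < b \<Longrightarrow> \<xi> (Inner e s) = edge_germ e c s"
proof -
  have e: "e \<in> edges G"
    using U by (auto simp: openin_graph_top graph_space_def)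
  obtain B s where B: "B \<in> opens P" "Inner e t \<in> B" "B \<subseteq> U" "s \<in> carrier (sect P B)"
    "\<forall>y\<in>B. \<xi> y = germ P y B s"
    using section_obtain[OF \<xi> U(2)] .
  obtain a b where ab: "0 \<le> a" "a < t" "t < b" "b \<le> 1" "interval e a b \<subseteq> B"
    using B(2) by (rule interval_nbhd[OF P.opens_openin[OF B(1)]])
  have "\<exists>c\<in>carrier (tens 1). \<forall>r. Inner e r \<in> B \<longrightarrow> germ P (Inner e r) B s = edge_germ e c r"
    using B(1)
  proof (cases rule: P_opens_cases)
    case (vertex v)
    then show ?thesis
      using B(4) germ_vertex_basic[OF vertex] module_hom_mem[OF edge_map_hom]
      by (intro bexI[of _ "edge_map v e s"]) (auto simp: sect_vertex_basic)
  next
    case (edge e')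
    then have "e' = e"
      using B(2) by (auto simp: edge_basic_def)
    then show ?thesis
      using B(4) germ_edge_basic[OF e] edge by (intro bexI[of _ s]) (auto simp: sect_edge_basic)
  qed
  then obtain c where "c \<in> carrier (tens 1)" "\<And>r. Inner e r \<in> B \<Longrightarrow> germ P (Inner e r) B s = edge_germ e c r"
    by blast
  then show thesis
    using ab B(3,5) by (intro that[of a b c]) (auto simp: subset_iff)
qed

text \<open>By \<open>edge_germ_inj\<close> the germ at a point determines the constant that
  represents it. This constant is locally constant in the parameter, and an interval is
  connected.\<close>

lemma section_interval_constant:
  assumes \<xi>: "\<xi> \<in> carrier (sect F U)" and U: "openin X U" "interval e a b \<subseteq> U" and ab: "a < b"
  obtains c where "c \<in> carrier (tens 1)" "\<And>t. a < t \<Longrightarrow> t < b \<Longrightarrow> \<xi> (Inner e t) = edge_germ e c t"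
proof -
  have in_U: "Inner e t \<in> U" if "a < t" "t < b" for t
    using U(2) that by (auto simp: subset_iff)
  have et: "e \<in> edges G" "0 < t" "t < 1" if "a < t" "t < b" for t
    using in_U[OF that] U(1) by (auto simp: openin_graph_top graph_space_def)
  have "\<exists>c\<in>carrier (tens 1). \<xi> (Inner e t) = edge_germ e c t" if "a < t" "t < b" for t
    using section_edge_local[OF \<xi> U(1) in_U[OF that]] by metis
  then obtain f where f: "\<And>t. a < t \<Longrightarrow> t < b \<Longrightarrow> f t \<in> carrier (tens 1)"
    "\<And>t. a < t \<Longrightarrow> t < b \<Longrightarrow> \<xi> (Inner e t) = edge_germ e (f t) t"
    by metis
  have "f constant_on {a<..<b}"
  proof (rule locally_constant_imp_constant)
    fix t assume "t \<in> {a<..<b}"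
    then have t: "a < t" "t < b"
      by auto
    obtain l r c where lr: "l < t" "t < r" and c: "c \<in> carrier (tens 1)"
      "\<And>s. l < s \<Longrightarrow> s < r \<Longrightarrow> \<xi> (Inner e s) = edge_germ e c s"
      using section_edge_local[OF \<xi> U(1) in_U[OF t]] by metis
    have fc: "f s = c" if s: "a < s" "s < b" "l < s" "s < r" for s
      using edge_germ_inj[OF et[OF s(1,2)] f(1)[OF s(1,2)] c(1)] c(2)[OF s(3,4)] f(2)[OF s(1,2)] by simp
    have "openin (top_of_set {a<..<b}) ({a<..<b} \<inter> {l<..<r})"
      by (rule openin_open_Int) simp
    moreover have "t \<in> {a<..<b} \<inter> {l<..<r}" "\<forall>s\<in>{a<..<b} \<inter> {l<..<r}. f s = f t"
      using t lr fc by auto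
    ultimately show "\<exists>T. openin (top_of_set {a<..<b}) T \<and> t \<in> T \<and> (\<forall>x\<in>T. f x = f t)"
      by blast
  qed simp
  then obtain c where c: "\<And>t. a < t \<Longrightarrow> t < b \<Longrightarrow> f t = c"
    by (auto simp: constant_on_def)
  obtain t where t: "a < t" "t < b"
    using dense[OF ab] by blast
  show thesis
    using c f f(1)[OF t] t by (intro that[of c]) auto
qed

text \<open>The counterpart of \<open>edge_germ\<close> in the stalks of \<open>F\<close> instead of
  \<open>P\<close>; the cochains of the Godement resolution take their values in these.\<close>

definition stalk_germ :: "'e \<Rightarrow> (bit list \<Rightarrow> bit) \<Rightarrow> real \<Rightarrow>
    (('v, 'e) point set \<times> (('v, 'e) point \<Rightarrow> (('v, 'e) point set \<times> (bit list \<Rightarrow> bit)) set)) set" where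
  "stalk_germ e c t = germ F (Inner e t) (open_edge e) (germs P (open_edge e) c)"

context
  fixes e assumes e: "e \<in> edges G"
begin

lemma open_edge_facts:
  "openin X (open_edge e)" "open_edge e \<in> opens P" "sect P (open_edge e) = tens 1" "open_edge e \<in> opens F"
  using e by (auto simp: interval_opens sect_interval F.opens_iff intro: openin_interval)

lemma germ_F_edge:
  assumes \<xi>: "\<xi> \<in> carrier (sect F U)" and U: "openin X U" "interval e a b \<subseteq> U"
    and ab: "0 \<le> a" "a < t" "t < b" "b \<le> 1" and c: "c \<in> carrier (tens 1)"
    and eq: "\<And>s. a < s \<Longrightarrow> s < b \<Longrightarrow> \<xi> (Inner e s) = edge_germ e c s"
  shows "germ F (Inner e t) U \<xi> = stalk_germ e c t"
proof -
  have "Inner e t \<in> U"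
    using U(2) ab by (auto simp: subset_iff)
  moreover have "germs P (open_edge e) c \<in> carrier (sect F (open_edge e))"
    using c open_edge_facts by (intro germs_P_section) auto
  moreover have "\<forall>y\<in>interval e a b. \<xi> y = germs P (open_edge e) c y"
    using eq ab by (auto elim!: interval_cases simp: P.germs_apply edge_germ_def)
  moreover have "interval e a b \<subseteq> open_edge e"
    using ab by (auto elim!: interval_cases)
  ultimately show ?thesis
    unfolding stalk_germ_def using \<xi> U ab open_edge_facts openin_interval[OF e ab(1,4)]
    by (subst germ_F_eq_iff) (auto intro!: exI[of _ "interval e a b"])
qed

lemma stalk_germ_carrier:
  "0 < t \<Longrightarrow> t < 1 \<Longrightarrow> c \<in> carrier (tens 1) \<Longrightarrow> stalk_germ e c t \<in> carrier (stalk F (Inner e t))"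
  unfolding stalk_germ_def using open_edge_facts
  by (intro F.germ_in_stalk germs_P_section) auto

lemma stalk_germ_add:
  assumes "0 < t" "t < 1" "c \<in> carrier (tens 1)" "d \<in> carrier (tens 1)"
  shows "stalk_germ e (c \<oplus>\<^bsub>tens 1\<^esub> d) t = stalk_germ e c t \<oplus>\<^bsub>stalk F (Inner e t)\<^esub> stalk_germ e d t"
  unfolding stalk_germ_def
  using assms open_edge_facts module_hom_add[OF germs_P_hom[of "open_edge e"], of c d]
  by (subst F.stalk_add) (auto intro: germs_P_section)

lemma stalk_germ_inj:
  assumes t: "0 < t" "t < 1" and cd: "c \<in> carrier (tens 1)" "d \<in> carrier (tens 1)"
    and eq: "stalk_germ e c t = stalk_germ e d t"
  shows "c = d"
proof -
  have "Inner e t \<in> open_edge e"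
    using t by simp
  moreover have "germs P (open_edge e) b \<in> carrier (sect F (open_edge e))" if "b \<in> carrier (tens 1)" for b
    using that open_edge_facts by (intro germs_P_section) auto
  ultimately have "germs P (open_edge e) c (Inner e t) = germs P (open_edge e) d (Inner e t)"
    using eq cd open_edge_facts unfolding stalk_germ_def by (subst (asm) germ_F_eq_iff) auto
  then show ?thesis
    using t cd edge_germ_inj[OF e] by (simp add: P.germs_apply edge_germ_def)
qed

end

end

context switching_circuit
begin

subsection \<open>Lifts over edges\<close>

text \<open>Cochains over intervals are encoded by functions of the real parameter, so that a lift
  and its restrictions to smaller intervals are given by the same \<open>f\<close>.\<close>

definition edge_fun :: "'e \<Rightarrow> real \<Rightarrow> real \<Rightarrow> (real \<Rightarrow> 'c) \<Rightarrow> ('v, 'e) point \<Rightarrow> 'c" where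
  "edge_fun e a b f = (\<lambda>x\<in>interval e a b. case x of Vert v \<Rightarrow> undefined | Inner e' t \<Rightarrow> f t)"

definition edge_lifts where
  "edge_lifts z e a b f \<longleftrightarrow> F.lifts z (interval e a b) (edge_fun e a b f)"

lemma edge_fun_apply: "a < t \<Longrightarrow> t < b \<Longrightarrow> edge_fun e a b f (Inner e t) = f t"
  by (simp add: edge_fun_def)

lemma edge_fun_eqI:
  assumes "\<tau> \<in> extensional (interval e a b)" "\<And>t. a < t \<Longrightarrow> t < b \<Longrightarrow> \<tau> (Inner e t) = f t"
  shows "edge_fun e a b f = \<tau>"
proof (rule extensionalityI[OF _ assms(1)])
  show "edge_fun e a b f \<in> extensional (interval e a b)"
    by (simp add: edge_fun_def)
  show "edge_fun e a b f x = \<tau> x" if "x \<in> interval e a b" for x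
    using that assms(2) by (auto elim!: interval_cases simp: edge_fun_apply)
qed

lemma edge_fun_cong:
  "(\<And>t. a < t \<Longrightarrow> t < b \<Longrightarrow> f t = g t) \<Longrightarrow> edge_fun e a b f = edge_fun e a b g"
  by (rule edge_fun_eqI) (simp_all add: edge_fun_apply, simp add: edge_fun_def)

lemma edge_lifts_cong:
  assumes "\<And>t. a < t \<Longrightarrow> t < b \<Longrightarrow> f t = g t"
  shows "edge_lifts z e a b f \<longleftrightarrow> edge_lifts z e a b g"
  unfolding edge_lifts_def using edge_fun_cong[of a b f g e] assms by simp

lemma Inner_in_topspace: "e \<in> edges G \<Longrightarrow> 0 < t \<Longrightarrow> t < 1 \<Longrightarrow> Inner e t \<in> topspace X"
  unfolding topspace_graph_top graph_space_def by (intro UnI2 UN_I imageI) auto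

lemma interval_mono: "a \<le> a' \<Longrightarrow> b' \<le> b \<Longrightarrow> interval e a' b' \<subseteq> interval e a b"
  by (auto elim!: interval_cases)

context
  fixes e assumes e: "e \<in> edges G"
begin

lemma edge_lifts_of_lifts:
  assumes "F.lifts z U \<tau>" "interval e a b \<subseteq> U" "0 \<le> a" "b \<le> 1"
  shows "edge_lifts z e a b (\<lambda>t. \<tau> (Inner e t))"
proof -
  have "edge_fun e a b (\<lambda>t. \<tau> (Inner e t)) = restrict \<tau> (interval e a b)"
    by (rule edge_fun_eqI) auto
  then show ?thesis
    unfolding edge_lifts_def using F.lifts_restrict[OF assms(1) openin_interval[OF e assms(3,4)] assms(2)]
    by simp
qed

lemma edge_lifts_mono:
  assumes "edge_lifts z e a b f" "0 \<le> a'" "a \<le> a'" "b' \<le> b" "b' \<le> 1"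
  shows "edge_lifts z e a' b' f"
proof -
  have "edge_lifts z e a' b' (\<lambda>t. edge_fun e a b f (Inner e t))"
    using assms interval_mono[of a a' b' b e] unfolding edge_lifts_def[of z e a b]
    by (intro edge_lifts_of_lifts) auto
  then show ?thesis
    using assms by (subst edge_lifts_cong[where g = "\<lambda>t. edge_fun e a b f (Inner e t)"])
      (auto simp: edge_fun_apply)
qed

lemma edge_lifts_glue:
  assumes ab: "0 \<le> a" "b \<le> 1"
    and loc: "\<And>t. a < t \<Longrightarrow> t < b \<Longrightarrow> \<exists>a' b'. a \<le> a' \<and> a' < t \<and> t < b' \<and> b' \<le> b \<and> edge_lifts z e a' b' f"
  shows "edge_lifts z e a b f"
  unfolding edge_lifts_def
proof (rule F.lifts_glue[OF openin_interval[OF e ab]])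
  fix x assume "x \<in> interval e a b"
  then obtain t where t: "x = Inner e t" "a < t" "t < b"
    by (rule interval_cases)
  obtain a' b' where ab': "a \<le> a'" "a' < t" "t < b'" "b' \<le> b" "edge_lifts z e a' b' f"
    using loc[OF t(2,3)] by blast
  have "edge_fun e a' b' f = restrict (edge_fun e a b f) (interval e a' b')"
    using ab' by (intro edge_fun_eqI) (auto simp: edge_fun_apply)
  then have "F.lifts z (interval e a' b') (restrict (edge_fun e a b f) (interval e a' b'))"
    using ab'(5) by (simp add: edge_lifts_def)
  then show "\<exists>V. x \<in> V \<and> V \<subseteq> interval e a b \<and> F.lifts z V (restrict (edge_fun e a b f) V)"
    using ab' t interval_mono[of a a' b' b e] by (intro exI[of _ "interval e a' b'"]) auto
qed (simp add: edge_fun_def)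

text \<open>Sections of \<open>F\<close> over an interval are constants. Together with
  \<open>edge_lifts_add\<close> this makes the lifts over an interval a torsor under
  \<open>tens 1\<close>.\<close>

lemma edge_lifts_diff:
  assumes "0 \<le> a" "a < b" "b \<le> 1" "edge_lifts z e a b f" "edge_lifts z e a b g"
  obtains c where "c \<in> carrier (tens 1)"
    "\<And>t. a < t \<Longrightarrow> t < b \<Longrightarrow> f t = g t \<oplus>\<^bsub>stalk F (Inner e t)\<^esub> stalk_germ e c t"
proof -
  obtain s where s: "s \<in> carrier (sect F (interval e a b))" "\<And>x. x \<in> interval e a b \<Longrightarrow>
      edge_fun e a b f x = edge_fun e a b g x \<oplus>\<^bsub>stalk F x\<^esub> germ F x (interval e a b) s"
    using F.lifts_diff[OF assms(4,5)[unfolded edge_lifts_def]] by blast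
  note op = openin_interval[OF e assms(1,3)]
  obtain c where c: "c \<in> carrier (tens 1)" "\<And>t. a < t \<Longrightarrow> t < b \<Longrightarrow> s (Inner e t) = edge_germ e c t"
    using section_interval_constant[OF s(1) op subset_refl assms(2)] by blast
  have "germ F (Inner e t) (interval e a b) s = stalk_germ e c t" if "a < t" "t < b" for t
    using germ_F_edge[OF e s(1) op subset_refl assms(1) that assms(3) c] .
  then show thesis
    using c(1) s(2)[of "Inner e _"] by (intro that[of c]) (auto simp: edge_fun_apply)
qed

lemma edge_lifts_add:
  assumes "0 \<le> a" "a < b" "b \<le> 1" "edge_lifts z e a b f" and c: "c \<in> carrier (tens 1)"
  shows "edge_lifts z e a b (\<lambda>t. f t \<oplus>\<^bsub>stalk F (Inner e t)\<^esub> stalk_germ e c t)"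
proof -
  let ?I = "interval e a b"
  have s: "germs P ?I c \<in> carrier (sect F ?I)"
    using assms e by (intro germs_P_section) (auto simp: interval_opens sect_interval)
  have "germ F (Inner e t) ?I (germs P ?I c) = stalk_germ e c t" if "a < t" "t < b" for t
    using germ_F_edge[OF e s openin_interval[OF e assms(1,3)] subset_refl assms(1) that assms(3) c]
    using assms e by (simp add: P.germs_apply germ_interval)
  then have "edge_fun e a b (\<lambda>t. f t \<oplus>\<^bsub>stalk F (Inner e t)\<^esub> stalk_germ e c t) =
      (\<lambda>x\<in>?I. edge_fun e a b f x \<oplus>\<^bsub>stalk F x\<^esub> germ F x ?I (germs P ?I c))"
    by (intro edge_fun_eqI) (auto simp: edge_fun_apply)
  then show ?thesis
    using F.lifts_add[OF assms(4)[unfolded edge_lifts_def] s] by (simp add: edge_lifts_def)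
qed

lemma edge_lifts_carrier:
  "edge_lifts z e a b f \<Longrightarrow> a < t \<Longrightarrow> t < b \<Longrightarrow> f t \<in> carrier (stalk F (Inner e t))"
  using F.lifts_stalk[of z "interval e a b" "edge_fun e a b f" "Inner e t"]
  by (simp add: edge_lifts_def edge_fun_apply)

lemma stalk_abelian_group: "0 < t \<Longrightarrow> t < 1 \<Longrightarrow> abelian_group (stalk F (Inner e t))"
  using Module.module.axioms(2)[OF F.stalk_module[OF Inner_in_topspace[OF e]]] .

text \<open>Two lifts differ by the germs of one constant. If they agree at \<open>p\<close>, the
  constant has zero germ at \<open>p\<close> and is therefore zero.\<close>

lemma edge_lifts_unique:
  assumes ab: "0 \<le> a" "b \<le> 1" and fg: "edge_lifts z e a b f" "edge_lifts z e a b g"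
    and p: "a < p" "p < b" "f p = g p" and t: "a < t" "t < b"
  shows "f t = g t"
proof -
  obtain c where c: "c \<in> carrier (tens 1)"
    "\<And>t. a < t \<Longrightarrow> t < b \<Longrightarrow> f t = g t \<oplus>\<^bsub>stalk F (Inner e t)\<^esub> stalk_germ e c t"
    using edge_lifts_diff[of a b z f g] ab fg p by auto
  have zero: "\<zero>\<^bsub>tens 1\<^esub> \<in> carrier (tens 1)"
    by (simp add: zero_tens carrier_tens)
  have stalk_zero: "stalk_germ e \<zero>\<^bsub>tens 1\<^esub> s = \<zero>\<^bsub>stalk F (Inner e s)\<^esub>" if "a < s" "s < b" for s
  proof -
    interpret M: abelian_group "stalk F (Inner e s)"
      using that ab by (intro stalk_abelian_group) auto
    have "stalk_germ e \<zero>\<^bsub>tens 1\<^esub> s = stalk_germ e (\<zero>\<^bsub>tens 1\<^esub> \<oplus>\<^bsub>tens 1\<^esub> \<zero>\<^bsub>tens 1\<^esub>) s"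
      by (simp add: zero_tens add_tens)
    then show ?thesis
      using that ab stalk_germ_add[OF e _ _ zero zero, of s] stalk_germ_carrier[OF e _ _ zero, of s]
      by (simp add: M.add.r_cancel_one')
  qed
  have "stalk_germ e c p = stalk_germ e \<zero>\<^bsub>tens 1\<^esub> p"
  proof -
    interpret M: abelian_group "stalk F (Inner e p)"
      using p ab by (intro stalk_abelian_group) auto
    show ?thesis
      using c(2)[OF p(1,2)] p ab stalk_germ_carrier[OF e _ _ c(1), of p] edge_lifts_carrier[OF fg(2) p(1,2)]
      by (simp add: stalk_zero M.add.r_cancel_one')
  qed
  then have "c = \<zero>\<^bsub>tens 1\<^esub>"
    using p ab stalk_germ_inj[OF e, of p c "\<zero>\<^bsub>tens 1\<^esub>"] c(1) zero by simp
  then show ?thesis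
    using c(2)[OF t] stalk_zero[OF t] edge_lifts_carrier[OF fg(2) t] ab t
      abelian_groupE(3)[OF stalk_abelian_group[of t]] abelian_group.r_neg abelian_monoid.r_zero[OF abelian_group.axioms(1)[OF stalk_abelian_group[of t]]]
    by simp
qed

text \<open>Two lifts over overlapping intervals agree on the overlap after adding a constant to one of them.\<close>

lemma edge_lifts_join:
  assumes 1: "0 \<le> a" "a < p" "p < b" "b \<le> 1" "edge_lifts z e a b f"
    and 2: "0 \<le> a'" "a' < p" "p < b'" "b' \<le> 1" "edge_lifts z e a' b' f'"
  obtains g where "edge_lifts z e a b' g" "\<And>t. t < b \<Longrightarrow> g t = f t"
proof -
  let ?l = "max a a'" and ?r = "min b b'"
  have fl: "edge_lifts z e ?l ?r f" "edge_lifts z e ?l ?r f'"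
    using edge_lifts_mono[OF 1(5), of ?l ?r] edge_lifts_mono[OF 2(5), of ?l ?r] 1 2 by auto
  have lr: "0 \<le> ?l" "?l < ?r" "?r \<le> 1"
    using 1 2 by auto
  obtain c where c: "c \<in> carrier (tens 1)"
    "\<And>t. ?l < t \<Longrightarrow> t < ?r \<Longrightarrow> f t = f' t \<oplus>\<^bsub>stalk F (Inner e t)\<^esub> stalk_germ e c t"
    using edge_lifts_diff[OF lr fl] by blast
  define f'' where "f'' = (\<lambda>t. f' t \<oplus>\<^bsub>stalk F (Inner e t)\<^esub> stalk_germ e c t)"
  have f'': "edge_lifts z e a' b' f''"
    unfolding f''_def using 2 c(1) by (intro edge_lifts_add) auto
  define g where "g = (\<lambda>t. if t < b then f t else f'' t)"
  have "edge_lifts z e a b' g"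
  proof (rule edge_lifts_glue)
    fix t assume t: "a < t" "t < b'"
    show "\<exists>l r. a \<le> l \<and> l < t \<and> t < r \<and> r \<le> b' \<and> edge_lifts z e l r g"
    proof (cases "t < b")
      case True
      have "edge_lifts z e a ?r g"
        using edge_lifts_mono[OF 1(5), of a ?r] 1 2
        by (subst edge_lifts_cong[where g = f]) (auto simp: g_def)
      then show ?thesis
        using t True by (intro exI[of _ a] exI[of _ ?r]) auto
    next
      case False
      \<comment> \<open>Points of this interval below \<open>b\<close> lie in the overlap, where
        \<open>f\<close> and \<open>f''\<close> agree; so \<open>g\<close> coincides with
        \<open>f''\<close> throughout.\<close>
      have "edge_lifts z e ?l b' g"
        using edge_lifts_mono[OF f'', of ?l b'] 1 2 c(2)
        by (subst edge_lifts_cong[where g = f'']) (auto simp: g_def f''_def)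
      then show ?thesis
        using t False 1 2 by (intro exI[of _ ?l] exI[of _ b']) auto
    qed
  qed (use 1 2 in auto)
  then show thesis
    by (rule that) (simp add: g_def)
qed

context
  fixes z assumes z: "z \<in> carrier (sect (Z1 X F) (topspace X))"
begin

lemma edge_lifts_local:
  assumes "0 < t" "t < 1"
  obtains a b f where "0 \<le> a" "a < t" "t < b" "b \<le> 1" "edge_lifts z e a b f"
proof -
  have "Inner e t \<in> topspace X"
    using assms e by (intro Inner_in_topspace)
  then obtain V \<tau> where V: "Inner e t \<in> V" "F.lifts z V \<tau>"
    by (rule F.lifts_local[OF z])
  then have "openin X V"
    by (simp add: F.lifts_def)
  then obtain a b where "0 \<le> a" "a < t" "t < b" "b \<le> 1" "interval e a b \<subseteq> V"
    using V(1) by (rule interval_nbhd)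
  then show thesis
    using V(2) edge_lifts_of_lifts by (intro that[of a b "\<lambda>t. \<tau> (Inner e t)"]) auto
qed

text \<open>Bisection: lifts exist over all short intervals, and two lifts over adjacent intervals
  can be joined. The lift is required to reach beyond both end points so that adjacent ones overlap
  around the common point.\<close>

lemma edge_lifts_compact:
  assumes pq: "0 < p" "p \<le> q" "q < 1"
  shows "\<exists>a b f. 0 \<le> a \<and> a < p \<and> q < b \<and> b \<le> 1 \<and> edge_lifts z e a b f"
proof -
  \<comment> \<open>The bounds are made part of the property because the joining step of
    \<open>Bolzano\<close> ranges over arbitrary reals.\<close>
  have "0 < p \<and> q < 1 \<longrightarrow> (\<exists>a b f. 0 \<le> a \<and> a < p \<and> q < b \<and> b \<le> 1 \<and> edge_lifts z e a b f)"
    using pq(2)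
  proof (induction rule: Bolzano)
    case (trans p q r)
    show ?case
    proof
      assume "0 < p \<and> r < 1"
      then obtain a b f a' b' f' where 1: "0 \<le> a" "a < p" "q < b" "b \<le> 1" "edge_lifts z e a b f"
        and 2: "0 \<le> a'" "a' < q" "r < b'" "b' \<le> 1" "edge_lifts z e a' b' f'"
        using trans by auto
      moreover have "a < q" "q < b'"
        using 1 2 trans(3,4) by auto
      ultimately obtain g where "edge_lifts z e a b' g"
        using edge_lifts_join[of a q b z f a' b' f'] by metis
      then show "\<exists>a b f. 0 \<le> a \<and> a < p \<and> r < b \<and> b \<le> 1 \<and> edge_lifts z e a b f"
        using 1 2 by blast
    qed
  next
    case (local t)
    then have "0 < t" "t < 1"
      using pq by auto
    then obtain a b f where ab: "0 \<le> a" "a < t" "t < b" "b \<le> 1" "edge_lifts z e a b f"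
      by (rule edge_lifts_local)
    have "\<exists>a b f. 0 \<le> a \<and> a < l \<and> r < b \<and> b \<le> 1 \<and> edge_lifts z e a b f"
      if "l \<le> t" "t \<le> r" "r - l < min (t - a) (b - t)" for l r
      using ab that by (intro exI[of _ a] exI[of _ b] exI[of _ f]) auto
    moreover have "0 < min (t - a) (b - t)"
      using ab by simp
    ultimately show ?case
      by blast
  qed
  then show ?thesis
    using pq by blast
qed

text \<open>Prescribing the value at one point makes the lifts over compact subintervals compatible.\<close>

lemma edge_lifts_open_edge: "\<exists>f. edge_lifts z e 0 1 f"
proof -
  obtain p :: real where p: "0 < p" "p < 1"
    using dense[of "0::real" 1] by auto
  obtain a0 b0 f0 where 0: "0 \<le> a0" "a0 < p" "p < b0" "b0 \<le> 1" "edge_lifts z e a0 b0 f0"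
    using edge_lifts_local[OF p] by blast
  \<comment> \<open>An interval around both \<open>t\<close> and the base point \<open>p\<close>
    carries a lift, which a suitable constant normalizes to the value \<open>f0 p\<close> at
    \<open>p\<close>.\<close>
  have "\<exists>a b f. 0 \<le> a \<and> a < min t p \<and> max t p < b \<and> b \<le> 1 \<and> edge_lifts z e a b f \<and> f p = f0 p"
    if t: "0 < t" "t < 1" for t
  proof -
    have mM: "0 < min t p" "min t p \<le> max t p" "max t p < 1"
      using t p by auto
    obtain a b f where ab: "0 \<le> a" "a < min t p" "max t p < b" "b \<le> 1" "edge_lifts z e a b f"
      using edge_lifts_compact[of "min t p" "max t p"] mM by blast
    let ?l = "max a a0" and ?r = "min b b0"
    have fl: "edge_lifts z e ?l ?r f0" "edge_lifts z e ?l ?r f"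
      using edge_lifts_mono[OF 0(5), of ?l ?r] edge_lifts_mono[OF ab(5), of ?l ?r] 0 ab by auto
    have lr: "0 \<le> ?l" "?l < ?r" "?r \<le> 1"
      using 0 ab by auto
    obtain c where c: "c \<in> carrier (tens 1)"
      "\<And>t. ?l < t \<Longrightarrow> t < ?r \<Longrightarrow> f0 t = f t \<oplus>\<^bsub>stalk F (Inner e t)\<^esub> stalk_germ e c t"
      using edge_lifts_diff[OF lr fl] by blast
    have "edge_lifts z e a b (\<lambda>t. f t \<oplus>\<^bsub>stalk F (Inner e t)\<^esub> stalk_germ e c t)"
      using ab c(1) by (intro edge_lifts_add) auto
    moreover have "?l < p" "p < ?r"
      using 0 ab by auto
    then have "f p \<oplus>\<^bsub>stalk F (Inner e p)\<^esub> stalk_germ e c p = f0 p"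
      using c(2) by presburger
    ultimately show ?thesis
      using ab by blast
  qed
  then have "\<forall>t\<in>{0<..<1}. \<exists>a b f. 0 \<le> a \<and> a < min t p \<and> max t p < b \<and> b \<le> 1 \<and>
      edge_lifts z e a b f \<and> f p = f0 p"
    by simp
  then obtain l r f where lrf: "\<forall>t\<in>{0<..<1}. 0 \<le> l t \<and> l t < min t p \<and> max t p < r t \<and> r t \<le> 1 \<and>
      edge_lifts z e (l t) (r t) (f t) \<and> f t p = f0 p"
    unfolding bchoice_iff by blast
  \<comment> \<open>Each point uses the lift chosen for it. Any two of the normalized lifts agree
    where both are defined: the overlap is an interval that contains \<open>p\<close>, and they have
    the same value at \<open>p\<close>.\<close>
  define g where "g = (\<lambda>t. f t t)"
  have g: "g s = f t s" if t: "0 < t" "t < 1" and s: "l t < s" "s < r t" for s t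
  proof -
    have "0 \<le> l t" "r t \<le> 1"
      using lrf t by auto
    then have s': "0 < s" "s < 1"
      using s by auto
    have T: "0 \<le> l t" "l t < p" "p < r t" "r t \<le> 1" "edge_lifts z e (l t) (r t) (f t)" "f t p = f0 p"
      and S: "0 \<le> l s" "l s < p" "p < r s" "r s \<le> 1" "edge_lifts z e (l s) (r s) (f s)" "f s p = f0 p"
        "l s < s" "s < r s"
      using lrf s' t by auto
    let ?l = "max (l t) (l s)" and ?r = "min (r t) (r s)"
    have fl: "edge_lifts z e ?l ?r (f s)" "edge_lifts z e ?l ?r (f t)"
      using edge_lifts_mono[OF T(5), of ?l ?r] edge_lifts_mono[OF S(5), of ?l ?r] T S by auto
    have lr: "0 \<le> ?l" "?r \<le> 1" "?l < p" "p < ?r" "?l < s" "s < ?r"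
      using T(1-4) S(1-4,7,8) s by simp_all
    have "f s p = f t p"
      using T(6) S(6) by simp
    then show ?thesis
      unfolding g_def using edge_lifts_unique[OF lr(1,2) fl lr(3,4) _ lr(5,6)] by simp
  qed
  have "edge_lifts z e 0 1 g"
  proof (rule edge_lifts_glue)
    fix t :: real assume t: "0 < t" "t < 1"
    have "edge_lifts z e (l t) (r t) g \<longleftrightarrow> edge_lifts z e (l t) (r t) (f t)"
      using g[OF t] by (rule edge_lifts_cong)
    then show "\<exists>a b. 0 \<le> a \<and> a < t \<and> t < b \<and> b \<le> 1 \<and> edge_lifts z e a b g"
      using lrf t by (intro exI[of _ "l t"] exI[of _ "r t"]) auto
  qed auto
  then show ?thesis
    by blast
qed

end

end

end

section \<open>Gluing lifts over the whole graph\<close>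

context switching_circuit
begin

abbreviation incident :: "'v \<Rightarrow> 'e set" where
  "incident v \<equiv> in_edges G v \<union> out_edges G v"

lemma incident_edges: "e \<in> incident v \<Longrightarrow> e \<in> edges G"
  by (auto simp: in_edges_def out_edges_def)

definition branch :: "'v \<Rightarrow> real \<Rightarrow> 'e \<Rightarrow> real set" where
  "branch v \<epsilon> e = (if e \<in> out_edges G v then {0<..<\<epsilon>} else {1 - \<epsilon><..<1})"

lemma star_cases:
  assumes "x \<in> star v \<epsilon>"
  obtains "x = Vert v" | e t where "x = Inner e t" "e \<in> incident v" "t \<in> branch v \<epsilon> e"
proof (cases x)
  case (Vert w)
  then show ?thesis
    using assms that(1) by simp
next
  case (Inner e t)
  have "e \<in> in_edges G v \<Longrightarrow> e \<notin> out_edges G v"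
    using in_out_disjoint[of v] by blast
  then show ?thesis
    using assms that(2)[OF Inner] unfolding Inner Inner_in_star branch_def by auto
qed

lemma Inner_star_iff: "e \<in> incident v \<Longrightarrow> Inner e t \<in> star v \<epsilon> \<longleftrightarrow> t \<in> branch v \<epsilon> e"
  using in_out_disjoint[of v] by (auto simp: Inner_in_star branch_def)

lemma branch_interval:
  assumes "0 < \<epsilon>" "\<epsilon> \<le> 1"
  obtains a b where "0 \<le> a" "a < b" "b \<le> 1" "branch v \<epsilon> e = {a<..<b}"
proof (cases "e \<in> out_edges G v")
  case True
  then show thesis
    using assms by (intro that[of 0 \<epsilon>]) (simp_all add: branch_def)
next
  case False
  then show thesis
    using assms by (intro that[of "1 - \<epsilon>" 1]) (simp_all add: branch_def)
qed

lemma star_opens: "v \<in> verts G \<Longrightarrow> 0 < \<epsilon> \<Longrightarrow> \<epsilon> \<le> 1 \<Longrightarrow> star v \<epsilon> \<in> opens P"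
  and sect_star: "v \<in> verts G \<Longrightarrow> 0 < \<epsilon> \<Longrightarrow> \<epsilon> \<le> 1 \<Longrightarrow> sect P (star v \<epsilon>) = vspace v"
  using vertex_basic_opens vertex_basic_star sect_vertex_basic by blast+

lemma edge_map_carrier: "s \<in> carrier (vspace v) \<Longrightarrow> edge_map v e s \<in> carrier (tens 1)"
  using module_hom_mem[OF edge_map_hom] .

lemma germ_F_star:
  assumes v: "v \<in> verts G" and \<epsilon>: "0 < \<epsilon>" "\<epsilon> \<le> 1" and s: "s \<in> carrier (vspace v)"
    and e: "e \<in> incident v" and t: "t \<in> branch v \<epsilon> e"
  shows "germ F (Inner e t) (star v \<epsilon>) (germs P (star v \<epsilon>) s) = stalk_germ e (edge_map v e s) t"
proof -
  obtain a b where ab: "0 \<le> a" "a < b" "b \<le> 1" "branch v \<epsilon> e = {a<..<b}"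
    using branch_interval[OF \<epsilon>] by blast
  have sub: "interval e a b \<subseteq> star v \<epsilon>"
    using ab(4) by (auto elim!: interval_cases simp: Inner_star_iff[OF e])
  show ?thesis
  proof (rule germ_F_edge[OF incident_edges[OF e] _ _ sub ab(1) _ _ ab(3)])
    show "germs P (star v \<epsilon>) s \<in> carrier (sect F (star v \<epsilon>))"
      using v \<epsilon> s by (intro germs_P_section) (auto simp: star_opens sect_star)
    show "openin X (star v \<epsilon>)"
      using openin_star[OF v \<epsilon>] .
    show "germs P (star v \<epsilon>) s (Inner e r) = edge_germ e (edge_map v e s) r" if "a < r" "r < b" for r
    proof -
      have "Inner e r \<in> star v \<epsilon>"
        using sub that by (auto simp: subset_iff)
      then show ?thesis
        using germ_vertex_basic[OF v vertex_basic_star[OF v \<epsilon>] _ s] by (simp add: P.germs_apply)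
    qed
  qed (use t ab edge_map_carrier[OF s] in auto)
qed

text \<open>The condition under which lifts near the vertices and over the edges can be corrected so that
  they fit together.\<close>

definition cech_trivial :: bool where
  "cech_trivial \<longleftrightarrow> (\<forall>y. (\<forall>v e. y v e \<in> carrier (tens 1)) \<longrightarrow>
    (\<exists>s c. (\<forall>v\<in>verts G. s v \<in> carrier (vspace v)) \<and> (\<forall>e\<in>edges G. c e \<in> carrier (tens 1)) \<and>
      (\<forall>v\<in>verts G. \<forall>e\<in>incident v. edge_map v e (s v) = y v e \<oplus>\<^bsub>tens 1\<^esub> c e)))"

lemma star_lifts:
  assumes z: "z \<in> carrier (sect (Z1 X F) (topspace X))" and v: "v \<in> verts G"
  obtains \<epsilon> \<beta> where "0 < \<epsilon>" "\<epsilon> \<le> 1" "F.lifts z (star v \<epsilon>) \<beta>"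
proof -
  have "Vert v \<in> topspace X"
    using v by (simp add: topspace_graph_top graph_space_def)
  then obtain V \<tau> where V: "Vert v \<in> V" "F.lifts z V \<tau>"
    by (rule F.lifts_local[OF z])
  then have "openin X V"
    by (simp add: F.lifts_def)
  then obtain \<epsilon> where "0 < \<epsilon>" "\<epsilon> \<le> 1" "star v \<epsilon> \<subseteq> V"
    using V(1) by (rule star_nbhd)
  then show thesis
    using F.lifts_restrict[OF V(2) openin_star[OF v]] by (intro that[of \<epsilon>]) auto
qed

text \<open>Lifts \<open>\<beta>\<close> near the vertices and \<open>\<mu>\<close> over the open
  edges differ by a constant \<open>y v e\<close> on each branch of a star. Correcting
  \<open>\<beta>\<close> by \<open>s\<close> and \<open>\<mu>\<close> by \<open>c\<close> makes them
  agree there. The global cochain uses \<open>\<beta>\<close> only at the vertices and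
  \<open>\<mu>\<close> at all inner points, so stars are compared with edges and never with each
  other.\<close>

lemma global_lifts:
  assumes triv: cech_trivial and z: "z \<in> carrier (sect (Z1 X F) (topspace X))"
  shows "\<exists>\<tau>. F.lifts z (topspace X) \<tau>"
proof -
  have "\<forall>v\<in>verts G. \<exists>\<epsilon> \<beta>. 0 < \<epsilon> \<and> \<epsilon> \<le> 1 \<and> F.lifts z (star v \<epsilon>) \<beta>"
    using star_lifts[OF z] by blast
  then obtain \<epsilon> \<beta> where \<beta>: "\<forall>v\<in>verts G. 0 < \<epsilon> v \<and> \<epsilon> v \<le> 1 \<and> F.lifts z (star v (\<epsilon> v)) (\<beta> v)"
    unfolding bchoice_iff by blast
  have "\<forall>e\<in>edges G. \<exists>f. edge_lifts z e 0 1 f"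
    using edge_lifts_open_edge[OF _ z] by blast
  then obtain \<mu> where \<mu>: "\<forall>e\<in>edges G. edge_lifts z e 0 1 (\<mu> e)"
    unfolding bchoice_iff by blast
  have "\<exists>y\<in>carrier (tens 1). v \<in> verts G \<longrightarrow> e \<in> incident v \<longrightarrow> (\<forall>t\<in>branch v (\<epsilon> v) e.
      \<mu> e t = \<beta> v (Inner e t) \<oplus>\<^bsub>stalk F (Inner e t)\<^esub> stalk_germ e y t)" for v e
  proof (cases "v \<in> verts G \<and> e \<in> incident v")
    case True
    then have v: "v \<in> verts G" and e: "e \<in> incident v"
      by auto
    have \<epsilon>: "0 < \<epsilon> v" "\<epsilon> v \<le> 1" and lift: "F.lifts z (star v (\<epsilon> v)) (\<beta> v)"
      using \<beta> v by auto
    obtain a b where ab: "0 \<le> a" "a < b" "b \<le> 1" "branch v (\<epsilon> v) e = {a<..<b}"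
      using branch_interval[OF \<epsilon>] by blast
    note eG = incident_edges[OF e]
    have sub: "interval e a b \<subseteq> star v (\<epsilon> v)"
      using ab(4) by (auto elim!: interval_cases simp: Inner_star_iff[OF e])
    have 1: "edge_lifts z e a b (\<lambda>t. \<beta> v (Inner e t))"
      by (rule edge_lifts_of_lifts[OF eG lift sub ab(1,3)])
    have 2: "edge_lifts z e a b (\<mu> e)"
      using edge_lifts_mono[OF eG, of z 0 1 "\<mu> e" a b] \<mu> eG ab by auto
    obtain y where "y \<in> carrier (tens 1)"
      "\<And>t. a < t \<Longrightarrow> t < b \<Longrightarrow> \<mu> e t = \<beta> v (Inner e t) \<oplus>\<^bsub>stalk F (Inner e t)\<^esub> stalk_germ e y t"
      using edge_lifts_diff[OF eG ab(1-3) 2 1] by blast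
    then show ?thesis
      using ab(4) by (intro bexI[of _ y]) auto
  next
    case False
    \<comment> \<open>A default value: \<open>cech_trivial\<close> expects \<open>y v e\<close> in
      \<open>tens 1\<close> for all pairs, incident or not.\<close>
    have "\<zero>\<^bsub>tens 1\<^esub> \<in> carrier (tens 1)"
      by (simp add: zero_tens carrier_tens)
    then show ?thesis
      using False by blast
  qed
  then obtain y where y: "\<And>v e. y v e \<in> carrier (tens 1)" "\<And>v e t. v \<in> verts G \<Longrightarrow> e \<in> incident v \<Longrightarrow>
      t \<in> branch v (\<epsilon> v) e \<Longrightarrow> \<mu> e t = \<beta> v (Inner e t) \<oplus>\<^bsub>stalk F (Inner e t)\<^esub> stalk_germ e (y v e) t"
    by metis
  have "\<exists>s c. (\<forall>v\<in>verts G. s v \<in> carrier (vspace v)) \<and> (\<forall>e\<in>edges G. c e \<in> carrier (tens 1)) \<and>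
      (\<forall>v\<in>verts G. \<forall>e\<in>incident v. edge_map v e (s v) = y v e \<oplus>\<^bsub>tens 1\<^esub> c e)"
    using spec[OF triv[unfolded cech_trivial_def], of y] y(1) by simp
  then obtain s c where sc0: "\<forall>v\<in>verts G. s v \<in> carrier (vspace v)"
      "\<forall>e\<in>edges G. c e \<in> carrier (tens 1)"
      "\<forall>v\<in>verts G. \<forall>e\<in>incident v. edge_map v e (s v) = y v e \<oplus>\<^bsub>tens 1\<^esub> c e"
    by (elim exE conjE) (rule that)
  note s = bspec[OF sc0(1)] and c = bspec[OF sc0(2)] and sc = bspec[OF bspec[OF sc0(3)]]
  \<comment> \<open>On a branch this also equals the lift \<open>\<beta>\<close> corrected by
    \<open>s\<close>, because \<open>edge_map v e (s v)\<close> is the sum of \<open>y v e\<close>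
    and \<open>c e\<close>.\<close>
  define \<tau> where "\<tau> = (\<lambda>x\<in>topspace X. case x of
      Vert v \<Rightarrow> \<beta> v (Vert v) \<oplus>\<^bsub>stalk F (Vert v)\<^esub> germ F (Vert v) (star v (\<epsilon> v)) (germs P (star v (\<epsilon> v)) (s v))
    | Inner e t \<Rightarrow> \<mu> e t \<oplus>\<^bsub>stalk F (Inner e t)\<^esub> stalk_germ e (c e) t)"
  have "F.lifts z (topspace X) \<tau>"
  proof (rule F.lifts_glue)
    show "openin X (topspace X)" "\<tau> \<in> extensional (topspace X)"
      by (simp_all add: \<tau>_def)
    fix x assume x: "x \<in> topspace X"
    show "\<exists>V. x \<in> V \<and> V \<subseteq> topspace X \<and> F.lifts z V (restrict \<tau> V)"
    proof (cases x)
      case (Inner e t)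
      then have e: "e \<in> edges G" "0 < t" "t < 1"
        using x by (auto simp: topspace_graph_top graph_space_def)
      have op: "open_edge e \<subseteq> topspace X"
        using openin_interval[OF e(1), of 0 1] openin_subset by auto
      have "edge_lifts z e 0 1 (\<lambda>t. \<mu> e t \<oplus>\<^bsub>stalk F (Inner e t)\<^esub> stalk_germ e (c e) t)"
        using \<mu> e(1) c by (intro edge_lifts_add) auto
      moreover have "edge_fun e 0 1 (\<lambda>t. \<mu> e t \<oplus>\<^bsub>stalk F (Inner e t)\<^esub> stalk_germ e (c e) t) =
          restrict \<tau> (open_edge e)"
        using Inner_in_topspace[OF e(1)] by (intro edge_fun_eqI) (auto simp: \<tau>_def)
      ultimately have "F.lifts z (open_edge e) (restrict \<tau> (open_edge e))"
        by (simp add: edge_lifts_def)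
      then show ?thesis
        using op Inner e by (intro exI[of _ "open_edge e"]) auto
    next
      case (Vert v)
      then have v: "v \<in> verts G"
        using x by (auto simp: topspace_graph_top graph_space_def)
      have \<epsilon>: "0 < \<epsilon> v" "\<epsilon> v \<le> 1" and lift: "F.lifts z (star v (\<epsilon> v)) (\<beta> v)"
        using \<beta> v by auto
      let ?V = "star v (\<epsilon> v)"
      have op: "?V \<subseteq> topspace X"
        using openin_subset[OF openin_star[OF v \<epsilon>]] .
      have "germs P ?V (s v) \<in> carrier (sect F ?V)"
        using v \<epsilon> s by (intro germs_P_section) (auto simp: star_opens sect_star)
      then have "F.lifts z ?V (\<lambda>x\<in>?V. \<beta> v x \<oplus>\<^bsub>stalk F x\<^esub> germ F x ?V (germs P ?V (s v)))"
        by (rule F.lifts_add[OF lift])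
      moreover have "\<tau> x = \<beta> v x \<oplus>\<^bsub>stalk F x\<^esub> germ F x ?V (germs P ?V (s v))" if x: "x \<in> ?V" for x
        using x
      proof (cases rule: star_cases)
        case 1
        then show ?thesis
          using subsetD[OF op x] by (simp add: \<tau>_def)
      next
        case (2 e t)
        note eG = incident_edges[OF 2(2)]
        have t: "0 < t" "t < 1"
          using 2(3) \<epsilon> by (auto simp: branch_def split: if_splits)
        interpret M: abelian_group "stalk F (Inner e t)"
          using stalk_abelian_group[OF eG t] .
        have \<beta>t: "\<beta> v (Inner e t) \<in> carrier (stalk F (Inner e t))"
          using F.lifts_stalk[OF lift x] 2(1) by simp
        have "\<tau> x = \<beta> v x \<oplus>\<^bsub>stalk F x\<^esub> stalk_germ e (y v e) t \<oplus>\<^bsub>stalk F x\<^esub> stalk_germ e (c e) t"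
          using y(2)[OF v 2(2,3)] subsetD[OF op x] 2(1) by (simp add: \<tau>_def)
        also have "\<dots> = \<beta> v x \<oplus>\<^bsub>stalk F x\<^esub> stalk_germ e (edge_map v e (s v)) t"
          using sc[OF v 2(2)] 2(1) \<beta>t y(1) c[OF eG] stalk_germ_carrier[OF eG t] stalk_germ_add[OF eG t]
          by (simp add: M.a_assoc)
        also have "stalk_germ e (edge_map v e (s v)) t = germ F x ?V (germs P ?V (s v))"
          unfolding 2(1) using germ_F_star[OF v \<epsilon> s[OF v] 2(2,3)] by simp
        finally show ?thesis .
      qed
      then have "restrict \<tau> ?V = (\<lambda>x\<in>?V. \<beta> v x \<oplus>\<^bsub>stalk F x\<^esub> germ F x ?V (germs P ?V (s v)))"
        by (rule restrict_ext)
      ultimately have "F.lifts z ?V (restrict \<tau> ?V)"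
        by simp
      then show ?thesis
        using op Vert by (intro exI[of _ ?V]) auto
    qed
  qed
  then show ?thesis
    by blast
qed

lemma sheaf_H1_switching:
  assumes cech_trivial
  shows "carrier (sheaf_H1 X F) = {\<zero>\<^bsub>sheaf_H1 X F\<^esub>}"
  using global_lifts[OF assms] by (rule F.sheaf_H1_trivial_lifts)

subsection \<open>Global sections\<close>

text \<open>Global sections in coordinates: one tensor per vertex, such that the ends of an edge
  induce the same vector on it. An external edge has a single end and imposes no condition.\<close>

definition compatible :: "('v \<Rightarrow> bit list \<Rightarrow> bit) set" where
  "compatible = {s \<in> (\<Pi>\<^sub>E v\<in>verts G. carrier (vspace v)).
    \<exists>c. \<forall>v\<in>verts G. \<forall>e\<in>incident v. edge_map v e (s v) = c e}"

text \<open>Every edge has an end at some vertex, from which its value can be read off; for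
  compatible families the choice is immaterial.\<close>

definition edge_value :: "('v \<Rightarrow> bit list \<Rightarrow> bit) \<Rightarrow> 'e \<Rightarrow> bit list \<Rightarrow> bit" where
  "edge_value s e = (let v = (SOME v. v \<in> verts G \<and> e \<in> incident v) in edge_map v e (s v))"

definition glued_section where
  "glued_section s = (\<lambda>x\<in>topspace X. case x of
    Vert v \<Rightarrow> germ P (Vert v) (star v 1) (s v) | Inner e t \<Rightarrow> edge_germ e (edge_value s e) t)"

lemma edge_incident:
  assumes "e \<in> edges G" obtains v where "v \<in> verts G" "e \<in> incident v"
proof -
  have "src G e \<noteq> None \<or> tgt G e \<noteq> None"
    using finite_ext_digraph assms by (auto simp: finite_ext_digraph_def)
  then show thesis
    using assms src_verts tgt_verts that by (fastforce simp: in_edges_def out_edges_def)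
qed

lemma edge_value_eq:
  assumes "s \<in> compatible" "v \<in> verts G" "e \<in> incident v"
  shows "edge_value s e = edge_map v e (s v)"
proof -
  have "(SOME v. v \<in> verts G \<and> e \<in> incident v) \<in> verts G \<and> e \<in> incident (SOME v. v \<in> verts G \<and> e \<in> incident v)"
    by (rule someI[of _ v]) (use assms in auto)
  then show ?thesis
    using assms unfolding compatible_def edge_value_def Let_def by fastforce
qed

lemma edge_value_carrier:
  assumes s: "s \<in> compatible" and e: "e \<in> edges G"
  shows "edge_value s e \<in> carrier (tens 1)"
proof -
  obtain v where v: "v \<in> verts G" "e \<in> incident v"
    using e by (rule edge_incident)
  then have "s v \<in> carrier (vspace v)"
    using s by (auto simp: compatible_def)
  then show ?thesis
    using edge_value_eq[OF s v] edge_map_carrier by simp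
qed

text \<open>A basic set that contains the vertex is a neighbourhood of type
  \<open>vertex_basic\<close>, and restrictions between these are identities. So the stalk at
  \<open>v\<close> is a copy of \<open>vspace v\<close>.\<close>

lemma germ_vertex_inj:
  assumes v: "v \<in> verts G" and U: "U \<in> opens P" "Vert v \<in> U" and V: "V \<in> opens P" "Vert v \<in> V"
    and st: "s \<in> carrier (vspace v)" "t \<in> carrier (vspace v)"
  shows "germ P (Vert v) U s = germ P (Vert v) V t \<longleftrightarrow> s = t"
proof -
  have basic: "vertex_basic G v W" if "W \<in> opens P" "Vert v \<in> W" for W
    using that(1)
  proof (cases rule: P_opens_cases)
    case (vertex w)
    then show ?thesis
      using that(2) vertex_basic_mem by metis
  qed (use that(2) edge_basic_mem in blast)
  have sects: "s \<in> carrier (sect P U)" "t \<in> carrier (sect P V)"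
    using st v basic U V by (auto simp: sect_vertex_basic)
  obtain B where B: "B \<in> opens P" "Vert v \<in> B" "B \<subseteq> U" "B \<subseteq> V"
    using P.opens_refine U V by metis
  show ?thesis
    unfolding P.germ_eq_iff[OF U(1) V(1) U(2) V(2) sects]
  proof
    assume "\<exists>W\<in>opens P. Vert v \<in> W \<and> W \<subseteq> U \<inter> V \<and> restr P U W s = restr P V W t"
    then obtain W where "W \<in> opens P" "Vert v \<in> W" "restr P U W s = restr P V W t"
      by blast
    then show "s = t"
      using restr_vertex_vertex[OF basic[of W]] by simp
  next
    assume "s = t"
    then show "\<exists>W\<in>opens P. Vert v \<in> W \<and> W \<subseteq> U \<inter> V \<and> restr P U W s = restr P V W t"
      using B restr_vertex_vertex[OF basic[of B]] by (intro bexI[of _ B]) auto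
  qed
qed

lemma glued_section:
  assumes s: "s \<in> compatible"
  shows "glued_section s \<in> carrier (sect F (topspace X))"
  unfolding sect_F
proof (intro conjI ballI)
  fix x assume x: "x \<in> topspace X"
  show "\<exists>B\<in>opens P. x \<in> B \<and> B \<subseteq> topspace X \<and> (\<exists>t\<in>carrier (sect P B). \<forall>y\<in>B. glued_section s y = germ P y B t)"
  proof (cases x)
    case (Vert v)
    then have v: "v \<in> verts G"
      using x by (auto simp: topspace_graph_top graph_space_def)
    then have sv: "s v \<in> carrier (vspace v)"
      using s by (auto simp: compatible_def)
    have op: "star v 1 \<subseteq> topspace X"
      using openin_subset[OF openin_star[OF v]] by auto
    have "glued_section s y = germ P y (star v 1) (s v)" if y: "y \<in> star v 1" for y
      using y
    proof (cases rule: star_cases)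
      case 1
      then show ?thesis
        using subsetD[OF op y] by (simp add: glued_section_def)
    next
      case (2 e t)
      then show ?thesis
        using op y edge_value_eq[OF s v 2(2)] germ_vertex_basic[OF v vertex_basic_star[OF v], of 1 e t "s v"] sv
        by (auto simp: glued_section_def)
    qed
    then show ?thesis
      using op Vert v sv by (intro bexI[of _ "star v 1"] conjI bexI[of _ "s v"]) (auto simp: star_opens sect_star)
  next
    case (Inner e t)
    then have e: "e \<in> edges G" "0 < t" "t < 1"
      using x by (auto simp: topspace_graph_top graph_space_def)
    have op: "open_edge e \<subseteq> topspace X"
      using openin_interval[OF e(1), of 0 1] openin_subset by auto
    have "glued_section s y = germ P y (open_edge e) (edge_value s e)" if "y \<in> open_edge e" for y
      using that op by (auto elim!: interval_cases simp: glued_section_def edge_germ_def Inner_in_topspace[OF e(1)])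
    then show ?thesis
      using op Inner e edge_value_carrier[OF s e(1)] interval_opens[OF e(1), of 0 1] sect_interval[OF e(1), of 0 1]
      by (intro bexI[of _ "open_edge e"] conjI bexI[of _ "edge_value s e"]) auto
  qed
qed (simp add: glued_section_def)

lemma glued_section_inj: "inj_on glued_section compatible"
proof (rule inj_onI)
  fix s t assume st: "s \<in> compatible" "t \<in> compatible" and eq: "glued_section s = glued_section t"
  have "s v = t v" if v: "v \<in> verts G" for v
  proof -
    have "Vert v \<in> topspace X"
      using v by (simp add: topspace_graph_top graph_space_def)
    then have "germ P (Vert v) (star v 1) (s v) = germ P (Vert v) (star v 1) (t v)"
      using fun_cong[OF eq, of "Vert v"] by (simp add: glued_section_def)
    then show ?thesis
      using st v star_opens[OF v, of 1] by (subst (asm) germ_vertex_inj) (auto simp: compatible_def)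
  qed
  then show "s = t"
    using st by (intro extensionalityI[of s "verts G" t]) (simp_all add: compatible_def PiE_iff)
qed

text \<open>The tensor found at \<open>v\<close> also controls the incident edges: near
  \<open>v\<close> the section is represented by it, and comparing germs at a single point of a
  branch identifies the constant along the edge.\<close>

lemma section_vertex:
  assumes \<xi>: "\<xi> \<in> carrier (sect F (topspace X))" and v: "v \<in> verts G"
  obtains s where "s \<in> carrier (vspace v)" "\<xi> (Vert v) = germ P (Vert v) (star v 1) s"
    "\<And>e c. e \<in> incident v \<Longrightarrow> c \<in> carrier (tens 1) \<Longrightarrow>
      (\<And>t. 0 < t \<Longrightarrow> t < 1 \<Longrightarrow> \<xi> (Inner e t) = edge_germ e c t) \<Longrightarrow> c = edge_map v e s"
proof -
  have "Vert v \<in> topspace X"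
    using v by (simp add: topspace_graph_top graph_space_def)
  then obtain B s where B: "B \<in> opens P" "Vert v \<in> B" "B \<subseteq> topspace X" "s \<in> carrier (sect P B)"
    "\<forall>y\<in>B. \<xi> y = germ P y B s"
    by (rule section_obtain[OF \<xi>])
  have basic: "vertex_basic G v B"
    using B(1)
  proof (cases rule: P_opens_cases)
    case (vertex w)
    then show ?thesis
      using B(2) vertex_basic_mem by metis
  qed (use B(2) edge_basic_mem in blast)
  have s: "s \<in> carrier (vspace v)"
    using B(4) sect_vertex_basic[OF v basic] by simp
  show thesis
  proof (rule that[OF s])
    show "\<xi> (Vert v) = germ P (Vert v) (star v 1) s"
      using B s v star_opens[OF v, of 1] germ_vertex_inj[OF v B(1,2), of "star v 1" s s] by simp
    fix e c assume e: "e \<in> incident v" and c: "c \<in> carrier (tens 1)"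
      and eq: "\<And>t. 0 < t \<Longrightarrow> t < 1 \<Longrightarrow> \<xi> (Inner e t) = edge_germ e c t"
    obtain \<epsilon> where \<epsilon>: "0 < \<epsilon>" "\<epsilon> \<le> 1" "star v \<epsilon> \<subseteq> B"
      using B(2) by (rule star_nbhd[OF P.opens_openin[OF B(1)]])
    obtain a b where ab: "0 \<le> a" "a < b" "b \<le> 1" "branch v \<epsilon> e = {a<..<b}"
      using branch_interval[OF \<epsilon>(1,2)] by blast
    obtain t where t: "a < t" "t < b"
      using dense[OF ab(2)] by blast
    then have "Inner e t \<in> B"
      using \<epsilon>(3) ab(4) by (auto simp: subset_iff Inner_star_iff[OF e])
    then have "edge_germ e (edge_map v e s) t = edge_germ e c t"
      using B(5) eq[of t] t ab germ_vertex_basic[OF v basic _ s] by auto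
    then show "c = edge_map v e s"
      using t ab edge_germ_inj[OF incident_edges[OF e] _ _ edge_map_carrier[OF s] c, of t] by simp
  qed
qed

lemma glued_section_surj:
  assumes \<xi>: "\<xi> \<in> carrier (sect F (topspace X))"
  shows "\<xi> \<in> glued_section ` compatible"
proof -
  have openin_top: "openin X (topspace X)" and zero_lt_one: "(0::real) < 1"
    by simp_all
  have "\<exists>c. c \<in> carrier (tens 1) \<and> (\<forall>t. 0 < t \<and> t < 1 \<longrightarrow> \<xi> (Inner e t) = edge_germ e c t)"
    if e: "e \<in> edges G" for e
  proof -
    have op: "open_edge e \<subseteq> topspace X"
      using openin_interval[OF e, of 0 1] openin_subset by auto
    obtain c where "c \<in> carrier (tens 1)" "\<And>t. 0 < t \<Longrightarrow> t < 1 \<Longrightarrow> \<xi> (Inner e t) = edge_germ e c t"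
      using section_interval_constant[OF \<xi> openin_top op zero_lt_one] by blast
    then show ?thesis
      by blast
  qed
  then obtain c where c: "\<And>e. e \<in> edges G \<Longrightarrow> c e \<in> carrier (tens 1)"
    "\<And>e t. e \<in> edges G \<Longrightarrow> 0 < t \<Longrightarrow> t < 1 \<Longrightarrow> \<xi> (Inner e t) = edge_germ e (c e) t"
    by metis
  have "\<exists>s. s \<in> carrier (vspace v) \<and> \<xi> (Vert v) = germ P (Vert v) (star v 1) s \<and>
      (\<forall>e\<in>incident v. edge_map v e s = c e)" if v: "v \<in> verts G" for v
  proof -
    obtain s where s: "s \<in> carrier (vspace v)" "\<xi> (Vert v) = germ P (Vert v) (star v 1) s"
      "\<And>e c. e \<in> incident v \<Longrightarrow> c \<in> carrier (tens 1) \<Longrightarrow>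
        (\<And>t. 0 < t \<Longrightarrow> t < 1 \<Longrightarrow> \<xi> (Inner e t) = edge_germ e c t) \<Longrightarrow> c = edge_map v e s"
      using section_vertex[OF \<xi> v] by blast
    have "edge_map v e s = c e" if "e \<in> incident v" for e
      using s(3)[OF that c(1)[OF incident_edges[OF that]] c(2)[OF incident_edges[OF that]]] by simp
    then show ?thesis
      using s by blast
  qed
  then obtain s where s: "\<And>v. v \<in> verts G \<Longrightarrow> s v \<in> carrier (vspace v)"
    "\<And>v. v \<in> verts G \<Longrightarrow> \<xi> (Vert v) = germ P (Vert v) (star v 1) (s v)"
    "\<And>v e. v \<in> verts G \<Longrightarrow> e \<in> incident v \<Longrightarrow> edge_map v e (s v) = c e"
    by metis
  let ?s = "restrict s (verts G)"
  have comp: "?s \<in> compatible"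
    unfolding compatible_def using s(1,3) by auto
  have "\<xi> x = glued_section ?s x" if x: "x \<in> topspace X" for x
  proof (cases x)
    case (Vert v)
    then have "v \<in> verts G"
      using x by (auto simp: topspace_graph_top graph_space_def)
    then show ?thesis
      using x Vert s(2) by (simp add: glued_section_def)
  next
    case (Inner e t)
    then have e: "e \<in> edges G" "0 < t" "t < 1"
      using x by (auto simp: topspace_graph_top graph_space_def)
    obtain v where v: "v \<in> verts G" "e \<in> incident v"
      using e(1) by (rule edge_incident)
    have "edge_value ?s e = c e"
      using edge_value_eq[OF comp v] s(3)[OF v] v(1) by simp
    then show ?thesis
      using x Inner c(2)[OF e] by (simp add: glued_section_def)
  qed
  moreover have "\<xi> \<in> extensional (topspace X)" "glued_section ?s \<in> extensional (topspace X)"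
    using \<xi> by (simp_all add: sect_F glued_section_def)
  ultimately have "\<xi> = glued_section ?s"
    by (intro extensionalityI[of _ "topspace X"]) auto
  then show ?thesis
    using comp by blast
qed

text \<open>Only sizes are transported. A finite space over the field of two elements has its
  dimension determined by its number of elements, so a bijection serves the purpose.\<close>

lemma card_sheaf_H0: "card (carrier (sheaf_H0 X F)) = card compatible"
  and finite_sheaf_H0: "finite compatible \<Longrightarrow> finite (carrier (sheaf_H0 X F))"
proof -
  have img: "glued_section ` compatible = carrier (sect F (topspace X))"
    using glued_section glued_section_surj by blast
  have H0: "carrier (sheaf_H0 X F) = germs F (topspace X) ` carrier (sect F (topspace X))"
    by (simp add: sheaf_H0_def F.carrier_godement_cocycles)
  have "inj_on (germs F (topspace X)) (carrier (sect F (topspace X)))"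
    using F.germs_inj[OF openin_topspace] by (intro inj_onI) blast
  then have "card (carrier (sheaf_H0 X F)) = card (carrier (sect F (topspace X)))"
    unfolding H0 by (rule card_image)
  then show "card (carrier (sheaf_H0 X F)) = card compatible"
    unfolding img[symmetric] by (simp add: card_image glued_section_inj)
  show "finite (carrier (sheaf_H0 X F))" if "finite compatible"
    unfolding H0 img[symmetric] using that by simp
qed

end

section \<open>Tensors with prescribed contractions\<close>

lemma UNIV_bit: "(UNIV :: bit set) = {0, 1}"
proof -
  have "b \<in> {0, 1}" for b :: bit
    by (cases b) simp_all
  then show ?thesis
    by auto
qed

lemma finite_UNIV_bit: "finite (UNIV :: bit set)" and card_UNIV_bit: "card (UNIV :: bit set) = 2"
  unfolding UNIV_bit by simp_all

lemma bit_lists_Suc: "{a :: bit list. length a = Suc m} = (\<lambda>(b, a). b # a) ` (UNIV \<times> {a. length a = m})"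
  by (auto simp: length_Suc_conv image_iff)

lemma sum_bit_lists_0:
  fixes f :: "bit list \<Rightarrow> 'b :: comm_monoid_add"
  shows "(\<Sum>a | length a = 0. f a) = f []"
  by simp

lemma sum_bit_lists_Suc:
  fixes f :: "bit list \<Rightarrow> 'b :: comm_monoid_add"
  shows "(\<Sum>a | length a = Suc m. f a) = (\<Sum>b\<in>UNIV. \<Sum>a | length a = m. f (b # a))"
proof -
  have "inj_on (\<lambda>(b, a). b # a) (UNIV \<times> {a :: bit list. length a = m})"
    by (auto simp: inj_on_def)
  then have "(\<Sum>a | length a = Suc m. f a) = (\<Sum>(b, a)\<in>UNIV \<times> {a. length a = m}. f (b # a))"
    unfolding bit_lists_Suc by (subst sum.reindex) (simp_all add: case_prod_unfold)
  then show ?thesis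
    by (simp add: sum.cartesian_product finite_UNIV_bit finite_bit_lists)
qed

text \<open>Distributivity. It is the reason why totals and contractions of pure tensors
  factor.\<close>

lemma sum_bit_lists_prod:
  fixes f :: "nat \<Rightarrow> bit \<Rightarrow> bit"
  shows "(\<Sum>a | length a = m. \<Prod>i<m. f i (a ! i)) = (\<Prod>i<m. \<Sum>b\<in>UNIV. f i b)"
proof (induction m arbitrary: f)
  case (Suc m)
  have "(\<Sum>a | length a = Suc m. \<Prod>i<Suc m. f i (a ! i)) =
      (\<Sum>b\<in>UNIV. \<Sum>a | length a = m. f 0 b * (\<Prod>i<m. f (Suc i) (a ! i)))"
    unfolding sum_bit_lists_Suc by (simp only: prod.lessThan_Suc_shift nth_Cons_0 nth_Cons_Suc)
  also have "\<dots> = (\<Sum>b\<in>UNIV. f 0 b) * (\<Prod>i<m. \<Sum>b\<in>UNIV. f (Suc i) b)"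
    by (simp only: Suc.IH[of "\<lambda>i. f (Suc i)"] flip: sum_distrib_left sum_distrib_right)
  finally show ?case
    by (simp only: prod.lessThan_Suc_shift)
qed simp

text \<open>The linear form with value 1 on every basis tensor
  \<open>T a\<^sub>1 \<otimes> \<cdots> \<otimes> T a\<^sub>m\<close>.\<close>

definition total :: "nat \<Rightarrow> (bit list \<Rightarrow> bit) \<Rightarrow> bit" where
  "total m x = (\<Sum>a | length a = m. x a)"

lemma total_add: "total m (x \<oplus>\<^bsub>tens n\<^esub> y) = total m x + total m y"
  by (simp only: total_def add_tens sum.distrib)

lemma total_one: "total 1 x = (\<Sum>b\<in>UNIV. x [b])"
  unfolding total_def One_nat_def sum_bit_lists_Suc sum_bit_lists_0 ..

lemma total_onehot: "total 1 (onehot b) = 1"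
  by (cases b) (simp_all add: total_one onehot_def UNIV_bit)

text \<open>All the restriction maps of the switching sheaf preserve the sum of the coordinates.\<close>

lemma total_lin_ext: "total 1 (lin_ext m (\<lambda>a. onehot (\<phi> a)) x) = total m x"
proof -
  have eq: "total 1 (lin_ext m (\<lambda>a. onehot (\<phi> a)) x) = (\<Sum>a | length a = m. x a * total 1 (onehot (\<phi> a)))"
    unfolding total_one lin_ext_def by (subst sum.swap) (simp only: sum_distrib_left)
  show ?thesis
    unfolding eq total_onehot mult_1_right by (simp only: total_def)
qed

lemma tens_one_eqI:
  assumes "x \<in> carrier (tens 1)" "y \<in> carrier (tens 1)" "\<And>b. x [b] = y [b]"
  shows "x = y"
proof
  fix a show "x a = y a"
    using assms by (cases "length a = 1") (auto simp: carrier_tens length_Suc_conv One_nat_def)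
qed

lemma contract_carrier: "contract m i x \<in> carrier (tens 1)"
  unfolding contract_def lin_ext_def using onehot_tens by (simp add: carrier_tens)

lemma contract_apply: "contract m i x [b] = (\<Sum>a | length a = m. if a ! i = b then x a else 0)"
  unfolding contract_def lin_ext_def onehot_def by (intro sum.cong) auto

lemma pure_tensor_carrier: "pure_tensor ys \<in> carrier (tens (length ys))"
  by (simp add: carrier_tens pure_tensor_def)

lemma total_pure_tensor:
  assumes "\<And>i. i < length ys \<Longrightarrow> total 1 (ys ! i) = 1"
  shows "total (length ys) (pure_tensor ys) = 1"
proof -
  have "total (length ys) (pure_tensor ys) = (\<Sum>a | length a = length ys. \<Prod>i<length ys. (ys ! i) [a ! i])"
    unfolding total_def pure_tensor_def by (intro sum.cong) auto
  also have "\<dots> = (\<Prod>i<length ys. total 1 (ys ! i))"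
    by (simp only: sum_bit_lists_prod[of "\<lambda>i b. (ys ! i) [b]"] total_one)
  finally show ?thesis
    using assms by simp
qed

text \<open>Contractions are marginal sums, and a pure tensor behaves like a product distribution:
  its \<open>i\<close>-th marginal is the \<open>i\<close>-th factor times the totals of the other
  factors, which are 1.\<close>

lemma contract_pure_tensor:
  assumes tot: "\<And>j. j < length ys \<Longrightarrow> total 1 (ys ! j) = 1" and i: "i < length ys"
    and y: "ys ! i \<in> carrier (tens 1)"
  shows "contract (length ys) i (pure_tensor ys) = ys ! i"
proof (rule tens_one_eqI[OF contract_carrier y])
  fix b
  \<comment> \<open>The condition \<open>a ! i = b\<close> is absorbed into the \<open>i\<close>-th
    factor, so that the restricted sum still factors.\<close>
  let ?f = "\<lambda>j c. if j = i then (if c = b then (ys ! i) [b] else 0) else (ys ! j) [c]"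
  have prod: "(if a ! i = b then pure_tensor ys a else 0) = (\<Prod>j<length ys. ?f j (a ! j))"
    if "length a = length ys" for a
  proof (cases "a ! i = b")
    case True
    then show ?thesis
      using that by (auto simp: pure_tensor_def intro!: prod.cong)
  next
    case False
    then have "(\<Prod>j<length ys. ?f j (a ! j)) = 0"
      using i by (intro prod_zero) auto
    then show ?thesis
      using False by simp
  qed
  have "contract (length ys) i (pure_tensor ys) [b] = (\<Sum>a | length a = length ys. \<Prod>j<length ys. ?f j (a ! j))"
    unfolding contract_apply using prod by (intro sum.cong) auto
  also have "\<dots> = (\<Prod>j<length ys. \<Sum>c\<in>UNIV. ?f j c)"
    by (rule sum_bit_lists_prod)
  also have "\<dots> = (\<Prod>j<length ys. if j = i then (ys ! i) [b] else 1)"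
  proof (rule prod.cong[OF refl])
    fix j assume "j \<in> {..<length ys}"
    then have "(\<Sum>c\<in>UNIV. (ys ! j) [c]) = 1"
      using tot[of j] by (simp only: total_one lessThan_iff)
    then show "(\<Sum>c\<in>UNIV. ?f j c) = (if j = i then (ys ! i) [b] else 1)"
      using finite_UNIV_bit by (cases "j = i") simp_all
  qed
  also have "\<dots> = (ys ! i) [b]"
    using i by (subst prod.delta) auto
  finally show "contract (length ys) i (pure_tensor ys) [b] = (ys ! i) [b]" .
qed

lemma contract_add:
  "contract m i (x \<oplus>\<^bsub>tens m\<^esub> y) = contract m i x \<oplus>\<^bsub>tens 1\<^esub> contract m i y"
  unfolding contract_def by (rule lin_ext_add)

text \<open>Tensors of total 1 with prescribed contractions of total 1 are given by pure tensors; the case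
  of total 0 is reduced to this one by adding the contractions of \<open>T 0 \<otimes> \<cdots> \<otimes> T 0\<close>.\<close>

lemma tensor_with_contractions:
  assumes y: "\<And>i. i < m \<Longrightarrow> y i \<in> carrier (tens 1)" and tot: "\<And>i. i < m \<Longrightarrow> total 1 (y i) = \<epsilon>"
  obtains s where "s \<in> carrier (tens m)" "total m s = \<epsilon>" "\<And>i. i < m \<Longrightarrow> contract m i s = y i"
proof (cases "\<epsilon> = 1")
  case True
  let ?ys = "map y [0..<m]"
  have "total 1 (?ys ! i) = 1" "?ys ! i \<in> carrier (tens 1)" if "i < length ?ys" for i
    using that y tot True by simp_all
  \<comment> \<open>For \<open>m = 0\<close> the pure tensor is the scalar 1. There are no
    contractions in this case, so its total has to be asserted separately.\<close>
  then show thesis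
    using that[of "pure_tensor ?ys"] pure_tensor_carrier[of ?ys] total_pure_tensor[of ?ys]
      contract_pure_tensor[of ?ys] True by simp
next
  case False
  then have \<epsilon>: "\<epsilon> = 0"
    by (cases \<epsilon>) simp_all
  let ?o = "map (\<lambda>i. onehot 0) [0..<m]" and ?ys = "map (\<lambda>i. y i \<oplus>\<^bsub>tens 1\<^esub> onehot 0) [0..<m]"
  have o: "total 1 (?o ! i) = 1" "?o ! i \<in> carrier (tens 1)" if "i < length ?o" for i
    using that total_onehot onehot_tens by simp_all
  have ys: "total 1 (?ys ! i) = 1" "?ys ! i \<in> carrier (tens 1)" if "i < length ?ys" for i
    using that y tot \<epsilon> total_onehot onehot_tens abelian_groupE(1)[OF Module.module.axioms(2)[OF tens_module[of 1]]]
    by (simp_all add: total_add)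
  have cancel: "y i \<oplus>\<^bsub>tens 1\<^esub> onehot 0 \<oplus>\<^bsub>tens 1\<^esub> onehot 0 = y i" for i
    by (simp only: add_tens add.assoc bit_add_self add_0_right)
  let ?s = "pure_tensor ?ys \<oplus>\<^bsub>tens m\<^esub> pure_tensor ?o"
  show thesis
  proof (rule that[of ?s])
    show "?s \<in> carrier (tens m)"
      using pure_tensor_carrier[of ?ys] pure_tensor_carrier[of ?o]
        abelian_groupE(1)[OF Module.module.axioms(2)[OF tens_module[of m]]] by simp
    show "total m ?s = \<epsilon>"
      using total_pure_tensor[of ?ys, OF ys(1)] total_pure_tensor[of ?o, OF o(1)] \<epsilon>
      by (simp add: total_add)
    show "contract m i ?s = y i" if "i < m" for i
      using contract_pure_tensor[of ?ys i, OF ys(1)] contract_pure_tensor[of ?o i, OF o(1)] ys(2)[of i] o(2)[of i] that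
      by (simp add: contract_add cancel)
  qed
qed

section \<open>Counting\<close>

text \<open>All fibres are translates of the kernel. This counting form of rank-nullity yields the
  dimension formula.\<close>

lemma card_module_hom:
  assumes M: "module R M" and N: "module R N" and f: "f \<in> module_hom R M N"
    and surj: "f ` carrier M = carrier N" and fin: "finite (carrier M)"
  shows "card (carrier M) = card {a \<in> carrier M. f a = \<zero>\<^bsub>N\<^esub>} * card (carrier N)"
proof -
  interpret M: Module.module R M by fact
  interpret N: Module.module R N by fact
  have fibre: "card {a \<in> carrier M. f a = b} = card {a \<in> carrier M. f a = \<zero>\<^bsub>N\<^esub>}" if b: "b \<in> carrier N" for b
  proof -
    have "b \<in> f ` carrier M"
      using b surj by simp
    then obtain a0 where a0: "a0 \<in> carrier M" "f a0 = b"
      by blast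
    have "bij_betw (\<lambda>a. a \<oplus>\<^bsub>M\<^esub> a0) {a \<in> carrier M. f a = \<zero>\<^bsub>N\<^esub>} {a \<in> carrier M. f a = b}"
    proof (rule bij_betw_byWitness[where f' = "\<lambda>a. a \<ominus>\<^bsub>M\<^esub> a0"])
      show "\<forall>a\<in>{a \<in> carrier M. f a = \<zero>\<^bsub>N\<^esub>}. (a \<oplus>\<^bsub>M\<^esub> a0) \<ominus>\<^bsub>M\<^esub> a0 = a"
        using a0 by (auto simp: a_minus_def M.M.a_assoc M.M.r_neg)
      show "\<forall>a\<in>{a \<in> carrier M. f a = b}. (a \<ominus>\<^bsub>M\<^esub> a0) \<oplus>\<^bsub>M\<^esub> a0 = a"
        using a0 by (auto simp: a_minus_def M.M.a_assoc M.M.l_neg)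
      show "(\<lambda>a. a \<oplus>\<^bsub>M\<^esub> a0) ` {a \<in> carrier M. f a = \<zero>\<^bsub>N\<^esub>} \<subseteq> {a \<in> carrier M. f a = b}"
        using a0 b by (auto simp: module_hom_add[OF f])
      show "(\<lambda>a. a \<ominus>\<^bsub>M\<^esub> a0) ` {a \<in> carrier M. f a = b} \<subseteq> {a \<in> carrier M. f a = \<zero>\<^bsub>N\<^esub>}"
        using a0 b by (auto simp: module_hom_minus[OF M N f] a_minus_def[of N] N.M.r_neg)
    qed
    then show ?thesis
      by (rule bij_betw_same_card[symmetric])
  qed
  have "(\<Sum>b\<in>carrier N. card {a \<in> carrier M. f a = b}) =
      (\<Sum>b\<in>carrier N. card {a \<in> carrier M. f a = \<zero>\<^bsub>N\<^esub>})"
    by (rule sum.cong[OF refl fibre])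
  also have "\<dots> = card {a \<in> carrier M. f a = \<zero>\<^bsub>N\<^esub>} * card (carrier N)"
    by (simp add: mult.commute)
  finally have "(\<Sum>b\<in>carrier N. card {a \<in> carrier M. f a = b}) = \<dots>" .
  moreover have "(\<Sum>b\<in>carrier N. card {a \<in> carrier M. f a = b}) = card (carrier M)"
    using sum.group[OF fin, of "carrier N" f "\<lambda>_. 1 :: nat"] fin surj finite_imageI[OF fin, of f] by simp
  ultimately show ?thesis
    by simp
qed

lemma carrier_prod_module: "carrier (prod_module I M) = (\<Pi>\<^sub>E i\<in>I. carrier (M i))"
  by (simp add: prod_module_def)

lemma prod_module_projection: "i \<in> I \<Longrightarrow> (\<lambda>s. s i) \<in> module_hom R (prod_module I M) (M i)"
  by (rule module_homI) (auto simp: prod_module_def)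

lemma prod_module_hom:
  assumes "\<And>j. j \<in> J \<Longrightarrow> f j \<in> module_hom R M (N j)"
  shows "(\<lambda>s. \<lambda>j\<in>J. f j s) \<in> module_hom R M (prod_module J N)"
  using module_hom_mem[OF assms] module_hom_add[OF assms] module_hom_smult[OF assms]
  by (intro module_homI) (auto simp: prod_module_def fun_eq_iff)

lemma module_hom_sum:
  assumes N: "module R N" and f: "f \<in> module_hom R M N" and g: "g \<in> module_hom R M N"
  shows "(\<lambda>s. f s \<oplus>\<^bsub>N\<^esub> g s) \<in> module_hom R M N"
proof -
  interpret N: Module.module R N by fact
  show ?thesis
    using module_hom_mem[OF f] module_hom_mem[OF g]
    by (intro module_homI) (simp_all add: module_hom_add[OF f] module_hom_add[OF g]
        module_hom_smult[OF f] module_hom_smult[OF g] N.smult_r_distr N.M.a_ac)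
qed

lemma tens_add_eq_zero_iff: "x \<oplus>\<^bsub>tens m\<^esub> y = \<zero>\<^bsub>tens m\<^esub> \<longleftrightarrow> x = y"
proof -
  have "a + b = 0 \<longleftrightarrow> a = b" for a b :: bit
    by (cases a; cases b) simp_all
  then show ?thesis
    unfolding add_tens zero_tens fun_eq_iff by simp
qed

lemma card_tens: "card (carrier (tens m)) = 2 ^ (2 ^ m)" and finite_tens: "finite (carrier (tens m))"
proof -
  let ?L = "{a :: bit list. length a = m}"
  have "bij_betw (\<lambda>x. restrict x ?L) (carrier (tens m)) (?L \<rightarrow>\<^sub>E UNIV)"
    by (rule bij_betw_byWitness[where f' = "\<lambda>y a. if length a = m then y a else 0"])
      (auto simp: carrier_tens fun_eq_iff PiE_iff extensional_def split: if_splits)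
  moreover have "card ?L = 2 ^ m"
    using card_lists_length_eq[OF finite_UNIV_bit, of m] by (simp add: card_UNIV_bit)
  then have "card (?L \<rightarrow>\<^sub>E (UNIV :: bit set)) = 2 ^ (2 ^ m)"
    by (simp add: card_PiE finite_bit_lists card_UNIV_bit)
  moreover have "finite (?L \<rightarrow>\<^sub>E (UNIV :: bit set))"
    by (simp add: finite_PiE finite_bit_lists finite_UNIV_bit)
  ultimately show "card (carrier (tens m)) = 2 ^ (2 ^ m)" "finite (carrier (tens m))"
    using bij_betw_same_card bij_betw_finite by metis+
qed

text \<open>Coordinates with respect to a basis identify the space with the functions from the basis
  to the two scalars.\<close>

lemma vectorspace_F2_card:
  assumes "vectorspace F2 V" and fin: "finite (carrier V)"
  shows "vectorspace.fin_dim F2 V \<and> card (carrier V) = 2 ^ vectorspace.dim F2 V"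
proof -
  interpret V: vectorspace F2 V by fact
  have fd: "V.fin_dim"
    unfolding V.fin_dim_def using fin V.span_is_subset2 V.in_own_span by (intro exI[of _ "carrier V"]) auto
  then obtain A where A: "finite A" "V.basis A"
    using V.finite_basis_exists by blast
  then have AV: "A \<subseteq> carrier V"
    by (simp add: V.basis_def)
  have "bij_betw (\<lambda>a. V.lincomb a A) (A \<rightarrow>\<^sub>E carrier F2) (carrier V)"
  proof -
    have ex: "\<forall>v. v \<in> carrier V \<longrightarrow> (\<exists>!a. a \<in> A \<rightarrow>\<^sub>E carrier F2 \<and> V.lincomb a A = v)"
      using A(2) V.basis_criterion[OF A(1) AV] by blast
    have cl: "V.lincomb a A \<in> carrier V" if "a \<in> A \<rightarrow>\<^sub>E carrier F2" for a
      using that AV by (intro V.lincomb_closed) auto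
    show ?thesis
      unfolding bij_betw_def inj_on_def using ex cl by blast
  qed
  then have "card (carrier V) = card (A \<rightarrow>\<^sub>E carrier F2)"
    using bij_betw_same_card by metis
  also have "\<dots> = 2 ^ card A"
    using A(1) by (simp add: card_PiE F2_def card_UNIV_bit)
  finally show ?thesis
    using fd V.dim_basis[OF A] by simp
qed

section \<open>Switching sheaves on trees\<close>

locale switching_tree = switching_circuit G C
  for G :: "('v, 'e) ext_digraph" and C :: "('v, 'e) circuit" +
  assumes tree: "is_tree G" and verts_nonempty: "verts G \<noteq> {}"
begin

abbreviation source :: "'e \<Rightarrow> 'v" where "source e \<equiv> the (src G e)"
abbreviation target :: "'e \<Rightarrow> 'v" where "target e \<equiv> the (tgt G e)"

lemma internal_edgeD:
  assumes "e \<in> internal_edges G"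
  shows "e \<in> edges G" "src G e = Some (source e)" "tgt G e = Some (target e)"
    "source e \<in> verts G" "target e \<in> verts G" "e \<in> out_edges G (source e)" "e \<in> in_edges G (target e)"
  using assms src_verts tgt_verts by (auto simp: internal_edges_def out_edges_def in_edges_def)

lemma finite_internal_edges: "finite (internal_edges G)"
  using finite_edges by (simp add: internal_edges_def)

lemma potential:
  fixes h :: "'e \<Rightarrow> 'c :: ab_group_add"
  obtains g where "\<And>e. e \<in> internal_edges G \<Longrightarrow> g (target e) = g (source e) + h e"
proof -
  obtain g where "\<forall>e\<in>edges G. \<forall>u w. src G e = Some u \<longrightarrow> tgt G e = Some w \<longrightarrow> g w = g u + h e"
    using forest_potential[OF finite_edges, of h] tree unfolding is_tree_def by blast
  then show thesis
    using internal_edgeD(1-3) by (intro that[of g]) blast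
qed

lemma total_edge_map: "total 1 (edge_map v e x) = total (length (ins C v)) x"
  unfolding edge_map_def contract_def gate_map_def by (simp only: total_lin_ext if_distrib if_distribR if_cancel)

lemma index_of_nth: "distinct es \<Longrightarrow> i < length es \<Longrightarrow> index_of es (es ! i) = i"
  unfolding index_of_def by (intro the_equality) (auto simp: nth_eq_iff_index_eq)

text \<open>The values on all internal edges into \<open>w\<close> can be prescribed at once,
  provided that their totals agree. Outgoing edges then receive whatever the gate produces, and the
  total of the tensor is all that is known about them.\<close>

lemma vertex_tensor:
  assumes w: "w \<in> verts G" and y: "\<And>e. e \<in> internal_edges G \<Longrightarrow> target e = w \<Longrightarrow> y e \<in> carrier (tens 1)"
    and tot: "\<And>e. e \<in> internal_edges G \<Longrightarrow> target e = w \<Longrightarrow> total 1 (y e) = \<epsilon>"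
  obtains x where "x \<in> carrier (vspace w)" "total (length (ins C w)) x = \<epsilon>"
    "\<And>e. e \<in> internal_edges G \<Longrightarrow> target e = w \<Longrightarrow> edge_map w e x = y e"
proof -
  let ?m = "length (ins C w)"
  have ins: "distinct (ins C w)" "set (ins C w) = in_edges G w"
    using logic_circuit w by (auto simp: logic_circuit_def)
  \<comment> \<open>A filler for the external incoming edges. It must have total
    \<open>\<epsilon>\<close> as well, because all contractions of one tensor have the same
    total.\<close>
  define d where "d = (if \<epsilon> = 1 then onehot 0 else \<zero>\<^bsub>tens 1\<^esub>)"
  have d: "d \<in> carrier (tens 1)" "total 1 d = \<epsilon>"
    using onehot_tens total_onehot by (cases \<epsilon>; simp add: d_def zero_tens carrier_tens total_def)+
  define y' where "y' i = (if ins C w ! i \<in> internal_edges G then y (ins C w ! i) else d)" for i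
  have target: "target (ins C w ! i) = w" if "i < ?m" for i
    using that ins(2) nth_mem[OF that] by (auto simp: in_edges_def)
  have y': "y' i \<in> carrier (tens 1)" "total 1 (y' i) = \<epsilon>" if "i < ?m" for i
    using y tot d target[OF that] by (simp_all add: y'_def)
  obtain x where x: "x \<in> carrier (tens ?m)" "total ?m x = \<epsilon>" "\<And>i. i < ?m \<Longrightarrow> contract ?m i x = y' i"
    using tensor_with_contractions[of ?m y' \<epsilon>] y' by blast
  show thesis
  proof (rule that[OF x(1,2)])
    fix e assume e: "e \<in> internal_edges G" "target e = w"
    then have "e \<in> in_edges G w"
      using internal_edgeD(7) by blast
    then obtain i where i: "i < ?m" "ins C w ! i = e"
      using ins(2) by (metis in_set_conv_nth)
    then show "edge_map w e x = y e"
      using x(3)[OF i(1)] index_of_nth[OF ins(1) i(1)] e \<open>e \<in> in_edges G w\<close>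
      by (simp add: edge_map_def y'_def)
  qed
qed

text \<open>First the totals are determined from the undirected tree, then the tensors themselves by
  going through the vertices along the directions of the edges.\<close>

lemma coboundary_surjective:
  assumes h: "\<And>e. e \<in> internal_edges G \<Longrightarrow> h e \<in> carrier (tens 1)"
  obtains s where "\<And>v. v \<in> verts G \<Longrightarrow> s v \<in> carrier (vspace v)"
    "\<And>e. e \<in> internal_edges G \<Longrightarrow>
      edge_map (target e) e (s (target e)) = edge_map (source e) e (s (source e)) \<oplus>\<^bsub>tens 1\<^esub> h e"
proof -
  obtain \<epsilon> where \<epsilon>: "\<And>e. e \<in> internal_edges G \<Longrightarrow> \<epsilon> (target e) = \<epsilon> (source e) + total 1 (h e)"
    using potential[of "\<lambda>e. total 1 (h e)"] by blast
  \<comment> \<open>Increment 1 on every internal edge grades the vertices along the directions. The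
    potential lives in a group, hence the integers; \<open>level\<close> shifts it to natural
    numbers starting at 0.\<close>
  obtain N :: "'v \<Rightarrow> int" where N: "\<And>e. e \<in> internal_edges G \<Longrightarrow> N (target e) = N (source e) + 1"
    using potential[of "\<lambda>_. 1"] by blast
  define level where "level v = nat (N v - Min (N ` verts G))" for v
  have level: "level (target e) = Suc (level (source e))" if e: "e \<in> internal_edges G" for e
  proof -
    have "Min (N ` verts G) \<le> N (source e)"
      using internal_edgeD(4)[OF e] finite_verts by simp
    then show ?thesis
      using N[OF e] by (simp add: level_def nat_diff_distrib' Suc_nat_eq_nat_zadd1)
  qed
  let ?good = "\<lambda>s. \<forall>v\<in>verts G. s v \<in> carrier (vspace v) \<and> total (length (ins C v)) (s v) = \<epsilon> v"
  let ?eq = "\<lambda>s e. edge_map (target e) e (s (target e)) = edge_map (source e) e (s (source e)) \<oplus>\<^bsub>tens 1\<^esub> h e"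
  \<comment> \<open>The values demanded on the edges into \<open>w\<close> have total
    \<open>\<epsilon> w\<close>, since restriction maps preserve totals and
    \<open>\<epsilon>\<close> absorbs the total of \<open>h e\<close>. So
    \<open>vertex_tensor\<close> applies.\<close>
  have step: "\<exists>x. x \<in> carrier (vspace w) \<and> total (length (ins C w)) x = \<epsilon> w \<and>
      (\<forall>e\<in>internal_edges G. target e = w \<longrightarrow>
        edge_map w e x = edge_map (source e) e (s (source e)) \<oplus>\<^bsub>tens 1\<^esub> h e)"
    if s: "?good s" and w: "w \<in> verts G" for s w
  proof -
    have "edge_map (source e) e (s (source e)) \<oplus>\<^bsub>tens 1\<^esub> h e \<in> carrier (tens 1)"
      "total 1 (edge_map (source e) e (s (source e)) \<oplus>\<^bsub>tens 1\<^esub> h e) = \<epsilon> w"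
      if e: "e \<in> internal_edges G" "target e = w" for e
      using abelian_groupE(1)[OF Module.module.axioms(2)[OF tens_module[of 1]]] h[OF e(1)] \<epsilon>[OF e(1)] e(2)
        s internal_edgeD(4)[OF e(1)] edge_map_carrier total_edge_map by (simp_all add: total_add)
    then show ?thesis
      using vertex_tensor[OF w, of "\<lambda>e. edge_map (source e) e (s (source e)) \<oplus>\<^bsub>tens 1\<^esub> h e" "\<epsilon> w"] by metis
  qed
  \<comment> \<open>Induction over levels; correct totals are kept at every vertex, including those
    not yet adjusted, so that the next step stays solvable.\<close>
  have "\<exists>s. ?good s \<and> (\<forall>e\<in>internal_edges G. level (target e) \<le> k \<longrightarrow> ?eq s e)" for k
  proof (induction k)
    case 0
    have "\<exists>x. x \<in> carrier (vspace w) \<and> total (length (ins C w)) x = \<epsilon> w" if "w \<in> verts G" for w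
    proof -
      define d where "d = (if \<epsilon> w = 1 then onehot 0 else \<zero>\<^bsub>tens 1\<^esub>)"
      have "d \<in> carrier (tens 1)" "total 1 d = \<epsilon> w"
        using onehot_tens total_onehot by (cases "\<epsilon> w"; simp add: d_def zero_tens carrier_tens total_def)+
      then show ?thesis
        using vertex_tensor[OF that, of "\<lambda>_. d" "\<epsilon> w"] by metis
    qed
    then obtain s where "?good s"
      by metis
    \<comment> \<open>No internal edge ends at level 0.\<close>
    then show ?case
      using level by auto
  next
    case (Suc k)
    then obtain s where s: "?good s" "\<And>e. e \<in> internal_edges G \<Longrightarrow> level (target e) \<le> k \<Longrightarrow> ?eq s e"
      by blast
    have "\<forall>w\<in>verts G. \<exists>x. x \<in> carrier (vspace w) \<and> total (length (ins C w)) x = \<epsilon> w \<and>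
        (\<forall>e\<in>internal_edges G. target e = w \<longrightarrow>
          edge_map w e x = edge_map (source e) e (s (source e)) \<oplus>\<^bsub>tens 1\<^esub> h e)"
      using step[OF s(1)] by blast
    then obtain x where x: "\<forall>w\<in>verts G. x w \<in> carrier (vspace w) \<and> total (length (ins C w)) (x w) = \<epsilon> w \<and>
        (\<forall>e\<in>internal_edges G. target e = w \<longrightarrow>
          edge_map w e (x w) = edge_map (source e) e (s (source e)) \<oplus>\<^bsub>tens 1\<^esub> h e)"
      unfolding bchoice_iff by blast
    \<comment> \<open>Only level \<open>Suc k\<close> changes. Edges into it start at level
      \<open>k\<close>, whose tensors are kept; edges out of it end one level higher, where nothing
      is claimed yet.\<close>
    define s' where "s' v = (if level v = Suc k then x v else s v)" for v
    have "?good s'"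
      using s(1) x by (simp add: s'_def)
    moreover have "?eq s' e" if e: "e \<in> internal_edges G" "level (target e) \<le> Suc k" for e
      using e level[OF e(1)] s(2)[OF e(1)] x internal_edgeD(5)[OF e(1)] by (simp add: s'_def)
    ultimately show ?case
      by blast
  qed
  then obtain s where s: "?good s" "\<And>e. e \<in> internal_edges G \<Longrightarrow>
      level (target e) \<le> Max (level ` verts G) \<Longrightarrow> ?eq s e"
    by blast
  have "level (target e) \<le> Max (level ` verts G)" if "e \<in> internal_edges G" for e
    using internal_edgeD(5)[OF that] finite_verts by simp
  then show thesis
    using s by (intro that[of s]) auto
qed

lemma incident_cases:
  assumes "e \<in> incident v" "e \<in> incident w"
  obtains "v = w" | "e \<in> internal_edges G" "v = target e" "w = source e"
    | "e \<in> internal_edges G" "v = source e" "w = target e"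
proof -
  have "e \<in> edges G" "tgt G e = Some v \<or> src G e = Some v" "tgt G e = Some w \<or> src G e = Some w"
    using assms by (auto simp: in_edges_def out_edges_def)
  then consider "v = w" | "e \<in> internal_edges G" "tgt G e = Some v" "src G e = Some w"
    | "e \<in> internal_edges G" "src G e = Some v" "tgt G e = Some w"
    unfolding internal_edges_def by fastforce
  then show thesis
    by cases (use that in simp_all)
qed

text \<open>Only an internal edge has two different incident vertices, so agreement along internal
  edges makes the value depend on the edge alone.\<close>

lemma edge_values_agree:
  assumes "\<And>e. e \<in> internal_edges G \<Longrightarrow> q (target e) e = q (source e) e"
  obtains c where "\<And>v e. v \<in> verts G \<Longrightarrow> e \<in> incident v \<Longrightarrow> q v e = c e"
proof (rule that)
  fix v e assume v: "v \<in> verts G" and e: "e \<in> incident v"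
  have "e \<in> incident (SOME v. e \<in> incident v)"
    using e by (rule someI)
  from e this show "q v e = q (SOME v. e \<in> incident v) e"
  proof (cases rule: incident_cases)
    case 1
    then show ?thesis
      by (rule arg_cong[where f = "\<lambda>v. q v e"])
  next
    case 2
    show ?thesis
      unfolding 2(3) by (subst 2(2)) (rule assms[OF 2(1)])
  next
    case 3
    show ?thesis
      unfolding 3(3) by (subst 3(2)) (rule assms[OF 3(1), symmetric])
  qed
qed

text \<open>Eliminating \<open>c e\<close> from the two conditions at the ends of an internal edge
  leaves the equation of \<open>coboundary_surjective\<close> with \<open>h e\<close> the sum of
  \<open>y\<close> at both ends, as signs disappear in characteristic 2. The vector
  \<open>c e\<close> is then recovered as the common value at the ends of \<open>e\<close>.\<close>

lemma switching_cech_trivial: cech_trivial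
  unfolding cech_trivial_def
proof (intro allI impI)
  fix y :: "'v \<Rightarrow> 'e \<Rightarrow> bit list \<Rightarrow> bit"
  assume y: "\<forall>v e. y v e \<in> carrier (tens 1)"
  interpret T: Module.module F2 "tens 1"
    by (rule tens_module)
  have self: "a \<oplus>\<^bsub>tens 1\<^esub> a = \<zero>\<^bsub>tens 1\<^esub>" for a
    by (simp only: tens_add_eq_zero_iff)
  obtain s where s: "\<And>v. v \<in> verts G \<Longrightarrow> s v \<in> carrier (vspace v)"
    "\<And>e. e \<in> internal_edges G \<Longrightarrow> edge_map (target e) e (s (target e)) =
      edge_map (source e) e (s (source e)) \<oplus>\<^bsub>tens 1\<^esub> (y (source e) e \<oplus>\<^bsub>tens 1\<^esub> y (target e) e)"
    using coboundary_surjective[of "\<lambda>e. y (source e) e \<oplus>\<^bsub>tens 1\<^esub> y (target e) e"] y by auto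
  let ?q = "\<lambda>v e. y v e \<oplus>\<^bsub>tens 1\<^esub> edge_map v e (s v)"
  have "?q (target e) e = ?q (source e) e" if e: "e \<in> internal_edges G" for e
  proof -
    let ?a = "y (target e) e" and ?b = "y (source e) e" and ?m = "edge_map (source e) e (s (source e))"
    have cl: "?a \<in> carrier (tens 1)" "?b \<in> carrier (tens 1)" "?m \<in> carrier (tens 1)"
      using y edge_map_carrier[OF s(1)[OF internal_edgeD(4)[OF e]]] by auto
    have "?q (target e) e = (?a \<oplus>\<^bsub>tens 1\<^esub> ?a) \<oplus>\<^bsub>tens 1\<^esub> (?b \<oplus>\<^bsub>tens 1\<^esub> ?m)"
      unfolding s(2)[OF e] using cl by (simp add: T.M.a_ac)
    then show ?thesis
      using cl by (simp add: self)
  qed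
  then obtain c where c: "\<And>v e. v \<in> verts G \<Longrightarrow> e \<in> incident v \<Longrightarrow> ?q v e = c e"
    using edge_values_agree[of ?q] by blast
  have "c e \<in> carrier (tens 1)" if eG: "e \<in> edges G" for e
  proof -
    obtain v where v: "v \<in> verts G" "e \<in> incident v"
      using eG by (rule edge_incident)
    then show ?thesis
      using c[OF v, symmetric] y edge_map_carrier[OF s(1)[OF v(1)]] by simp
  qed
  moreover have "edge_map v e (s v) = y v e \<oplus>\<^bsub>tens 1\<^esub> c e" if v: "v \<in> verts G" "e \<in> incident v" for v e
  proof -
    have cl: "y v e \<in> carrier (tens 1)" "edge_map v e (s v) \<in> carrier (tens 1)"
      using y edge_map_carrier[OF s(1)[OF v(1)]] by auto
    have "y v e \<oplus>\<^bsub>tens 1\<^esub> c e = (y v e \<oplus>\<^bsub>tens 1\<^esub> y v e) \<oplus>\<^bsub>tens 1\<^esub> edge_map v e (s v)"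
      unfolding c[OF v, symmetric] using cl by (simp add: T.M.a_assoc)
    then show ?thesis
      using cl by (simp add: self)
  qed
  ultimately show "\<exists>s c. (\<forall>v\<in>verts G. s v \<in> carrier (vspace v)) \<and> (\<forall>e\<in>edges G. c e \<in> carrier (tens 1)) \<and>
      (\<forall>v\<in>verts G. \<forall>e\<in>incident v. edge_map v e (s v) = y v e \<oplus>\<^bsub>tens 1\<^esub> c e)"
    using s(1) by blast
qed

text \<open>A difference, written as a sum in characteristic 2. The parameters allow two uses:
  \<open>k = 1\<close> with the restriction maps of the circuit, and \<open>k = 0\<close> with
  constant coefficients.\<close>

definition coboundary where
  "coboundary k \<phi> s = (\<lambda>e\<in>internal_edges G.
    \<phi> (target e) e (s (target e)) \<oplus>\<^bsub>tens k\<^esub> \<phi> (source e) e (s (source e)))"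

lemma coboundary_hom:
  fixes M :: "'v \<Rightarrow> (bit, 'c) module"
  assumes "\<And>v e. \<phi> v e \<in> module_hom F2 (M v) (tens k)"
  shows "coboundary k \<phi> \<in> module_hom F2 (prod_module (verts G) M) (prod_module (internal_edges G) (\<lambda>_. tens k))"
  unfolding coboundary_def
proof (rule prod_module_hom)
  fix e assume e: "e \<in> internal_edges G"
  show "(\<lambda>s. \<phi> (target e) e (s (target e)) \<oplus>\<^bsub>tens k\<^esub> \<phi> (source e) e (s (source e)))
      \<in> module_hom F2 (prod_module (verts G) M) (tens k)"
    using internal_edgeD(4,5)[OF e] assms
    by (intro module_hom_sum tens_module module_hom_comp[OF prod_module_projection])
qed

text \<open>The coboundary is onto by hypothesis, so the number of vertex families is the size of
  its kernel times that of its target, which has one copy of \<open>tens k\<close> for each internal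
  edge.\<close>

lemma card_kernel_coboundary:
  fixes M :: "'v \<Rightarrow> (bit, 'c) module"
  assumes M: "\<And>v. v \<in> verts G \<Longrightarrow> module F2 (M v)" and fin: "\<And>v. v \<in> verts G \<Longrightarrow> finite (carrier (M v))"
    and \<phi>: "\<And>v e. \<phi> v e \<in> module_hom F2 (M v) (tens k)"
    and surj: "\<And>h. (\<And>e. e \<in> internal_edges G \<Longrightarrow> h e \<in> carrier (tens k)) \<Longrightarrow>
      \<exists>s. (\<forall>v\<in>verts G. s v \<in> carrier (M v)) \<and> (\<forall>e\<in>internal_edges G.
        \<phi> (target e) e (s (target e)) = \<phi> (source e) e (s (source e)) \<oplus>\<^bsub>tens k\<^esub> h e)"
  shows "(\<Prod>v\<in>verts G. card (carrier (M v))) =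
    card {s \<in> (\<Pi>\<^sub>E v\<in>verts G. carrier (M v)). \<forall>e\<in>internal_edges G.
      \<phi> (target e) e (s (target e)) = \<phi> (source e) e (s (source e))} * (2 ^ 2 ^ k) ^ card (internal_edges G)"
proof -
  let ?A = "prod_module (verts G) M" and ?B = "prod_module (internal_edges G) (\<lambda>_. tens k)"
  interpret T: Module.module F2 "tens k"
    by (rule tens_module)
  have A: "module F2 ?A"
    using M by (rule prod_module_module[OF cring_F2])
  have B: "module F2 ?B"
    by (rule prod_module_module[OF cring_F2 tens_module])
  have hom: "coboundary k \<phi> \<in> module_hom F2 ?A ?B"
    using \<phi> by (rule coboundary_hom)
  have "carrier ?B \<subseteq> coboundary k \<phi> ` carrier ?A"
  proof
    fix h assume "h \<in> carrier ?B"
    then have h: "h \<in> extensional (internal_edges G)" "\<And>e. e \<in> internal_edges G \<Longrightarrow> h e \<in> carrier (tens k)"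
      by (auto simp: carrier_prod_module PiE_iff)
    obtain s where s: "\<And>v. v \<in> verts G \<Longrightarrow> s v \<in> carrier (M v)" "\<And>e. e \<in> internal_edges G \<Longrightarrow>
        \<phi> (target e) e (s (target e)) = \<phi> (source e) e (s (source e)) \<oplus>\<^bsub>tens k\<^esub> h e"
      using surj[of h] h(2) by blast
    have "coboundary k \<phi> (restrict s (verts G)) e = h e" if e: "e \<in> internal_edges G" for e
    proof -
      let ?a = "\<phi> (source e) e (s (source e))"
      have "?a \<in> carrier (tens k)"
        using module_hom_mem[OF \<phi> s(1)] internal_edgeD(4)[OF e] by blast
      moreover have "?a \<oplus>\<^bsub>tens k\<^esub> ?a = \<zero>\<^bsub>tens k\<^esub>"
        by (simp only: tens_add_eq_zero_iff)
      ultimately have "?a \<oplus>\<^bsub>tens k\<^esub> h e \<oplus>\<^bsub>tens k\<^esub> ?a = h e"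
        using h(2)[OF e] T.M.a_comm[of "?a \<oplus>\<^bsub>tens k\<^esub> h e" ?a] by (simp flip: T.M.a_assoc)
      then show ?thesis
        using e s(2)[OF e] internal_edgeD(4,5)[OF e] by (simp add: coboundary_def)
    qed
    then have "h = coboundary k \<phi> (restrict s (verts G))"
      using h(1) by (intro extensionalityI[of _ "internal_edges G"]) (auto simp: coboundary_def)
    moreover have "restrict s (verts G) \<in> carrier ?A"
      using s(1) by (simp add: carrier_prod_module)
    ultimately show "h \<in> coboundary k \<phi> ` carrier ?A"
      by blast
  qed
  then have "coboundary k \<phi> ` carrier ?A = carrier ?B"
    using module_hom_mem[OF hom] by blast
  moreover have "finite (carrier ?A)"
    using fin finite_verts by (simp add: carrier_prod_module finite_PiE)
  ultimately have "card (carrier ?A) = card {s \<in> carrier ?A. coboundary k \<phi> s = \<zero>\<^bsub>?B\<^esub>} * card (carrier ?B)"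
    by (rule card_module_hom[OF A B hom])
  moreover have "coboundary k \<phi> s = \<zero>\<^bsub>?B\<^esub> \<longleftrightarrow> (\<forall>e\<in>internal_edges G.
      \<phi> (target e) e (s (target e)) = \<phi> (source e) e (s (source e)))" for s
    by (auto simp: coboundary_def prod_module_def fun_eq_iff[of "restrict _ _"] tens_add_eq_zero_iff)
  ultimately show ?thesis
    using finite_verts finite_internal_edges by (simp add: carrier_prod_module card_PiE card_tens)
qed

text \<open>The same count with constant coefficients: potentials make the coboundary surjective,
  and by connectedness its kernel consists of the two constant families. So 2 to the number of
  vertices is twice 2 to the number of internal edges.\<close>

lemma card_internal_edges: "card (verts G) = Suc (card (internal_edges G))"
proof -
  let ?K = "{s \<in> (\<Pi>\<^sub>E v\<in>verts G. carrier (tens 0)). \<forall>e\<in>internal_edges G. s (target e) = s (source e)}"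
  obtain v0 where v0: "v0 \<in> verts G"
    using verts_nonempty by blast
  have "\<exists>s. (\<forall>v\<in>verts G. s v \<in> carrier (tens 0)) \<and>
      (\<forall>e\<in>internal_edges G. s (target e) = s (source e) \<oplus>\<^bsub>tens 0\<^esub> h e)"
    if h: "\<And>e. e \<in> internal_edges G \<Longrightarrow> h e \<in> carrier (tens 0)" for h
  proof -
    obtain g where g: "\<And>e. e \<in> internal_edges G \<Longrightarrow> g (target e) = g (source e) + h e []"
      using potential[of "\<lambda>e. h e []"] by blast
    show ?thesis
      using g h by (intro exI[of _ "\<lambda>v a. if a = [] then g v else 0"])
        (auto simp: carrier_tens add_tens fun_eq_iff)
  qed
  then have count: "(\<Prod>v\<in>verts G. card (carrier (tens 0))) = card ?K * (2 ^ 2 ^ 0) ^ card (internal_edges G)"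
    using card_kernel_coboundary[of "\<lambda>_. tens 0" "\<lambda>v e s. s" 0] tens_module finite_tens
      id_hom[of F2 "tens 0"] by simp
  have const: "s v = s v0" if s: "s \<in> ?K" and v: "v \<in> verts G" for s v
  proof -
    have "(v0, v) \<in> {(a, b). \<exists>e. joins G e a b}\<^sup>*"
      using tree v v0 by (auto simp: is_tree_def connected_graph_def)
    then show ?thesis
    proof (induction rule: rtrancl_induct)
      case (step a b)
      then obtain e where e: "joins G e a b"
        by auto
      then have "e \<in> internal_edges G"
        by (auto simp: joins_def internal_edges_def)
      then have "s (target e) = s (source e)"
        using s by blast
      then show ?case
        using e step.IH by (auto simp: joins_def)
    qed simp
  qed
  have "bij_betw (\<lambda>s. s v0) ?K (carrier (tens 0))"
  proof (rule bij_betw_byWitness[where f' = "\<lambda>x. \<lambda>v\<in>verts G. x"])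
    show "\<forall>s\<in>?K. (\<lambda>v\<in>verts G. s v0) = s"
    proof
      fix s assume s: "s \<in> ?K"
      show "(\<lambda>v\<in>verts G. s v0) = s"
      proof (rule extensionalityI[of _ "verts G"])
        show "s \<in> extensional (verts G)"
          using s by (simp add: PiE_iff)
        show "(\<lambda>v\<in>verts G. s v0) v = s v" if "v \<in> verts G" for v
          using const[OF s that] that by simp
      qed simp
    qed
    show "(\<lambda>x. \<lambda>v\<in>verts G. x) ` carrier (tens 0) \<subseteq> ?K"
      using internal_edgeD(4,5) by auto
  qed (use v0 in auto)
  then have "card ?K = 2"
    using bij_betw_same_card card_tens[of 0] by fastforce
  then have "(2 :: nat) ^ card (verts G) = 2 ^ Suc (card (internal_edges G))"
    using count by (simp add: card_tens)
  then show ?thesis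
    by (simp only: power_inject_exp one_less_numeral_iff semiring_norm)
qed

lemma compatible_iff:
  "compatible = {s \<in> (\<Pi>\<^sub>E v\<in>verts G. carrier (vspace v)). \<forall>e\<in>internal_edges G.
    edge_map (target e) e (s (target e)) = edge_map (source e) e (s (source e))}"
proof -
  have "(\<exists>c. \<forall>v\<in>verts G. \<forall>e\<in>incident v. edge_map v e (s v) = c e) \<longleftrightarrow>
      (\<forall>e\<in>internal_edges G. edge_map (target e) e (s (target e)) = edge_map (source e) e (s (source e)))" for s
  proof
    assume "\<exists>c. \<forall>v\<in>verts G. \<forall>e\<in>incident v. edge_map v e (s v) = c e"
    then show "\<forall>e\<in>internal_edges G. edge_map (target e) e (s (target e)) = edge_map (source e) e (s (source e))"
      using internal_edgeD(4-7) by fastforce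
  next
    assume "\<forall>e\<in>internal_edges G. edge_map (target e) e (s (target e)) = edge_map (source e) e (s (source e))"
    then show "\<exists>c. \<forall>v\<in>verts G. \<forall>e\<in>incident v. edge_map v e (s v) = c e"
      using edge_values_agree[of "\<lambda>v e. edge_map v e (s v)"] by metis
  qed
  then show ?thesis
    by (simp add: compatible_def)
qed

lemma length_ins: "v \<in> verts G \<Longrightarrow> length (ins C v) = in_degree G v"
  using logic_circuit distinct_card by (fastforce simp: logic_circuit_def)

text \<open>The factor 4 is the number of elements of \<open>tens 1\<close>: each internal edge
  costs two dimensions.\<close>

lemma card_compatible:
  "2 ^ (\<Sum>v\<in>verts G. 2 ^ in_degree G v) = card compatible * 4 ^ card (internal_edges G)"
proof -
  have "(\<Prod>v\<in>verts G. card (carrier (vspace v))) = card compatible * (2 ^ 2 ^ 1) ^ card (internal_edges G)"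
    unfolding compatible_iff
  proof (rule card_kernel_coboundary)
    fix h assume "\<And>e. e \<in> internal_edges G \<Longrightarrow> h e \<in> carrier (tens 1)"
    then show "\<exists>s. (\<forall>v\<in>verts G. s v \<in> carrier (vspace v)) \<and> (\<forall>e\<in>internal_edges G.
        edge_map (target e) e (s (target e)) = edge_map (source e) e (s (source e)) \<oplus>\<^bsub>tens 1\<^esub> h e)"
      using coboundary_surjective[of h] by metis
  qed (rule tens_module finite_tens edge_map_hom)+
  moreover have "(\<Prod>v\<in>verts G. card (carrier (vspace v))) = 2 ^ (\<Sum>v\<in>verts G. 2 ^ in_degree G v)"
    by (simp add: card_tens power_sum length_ins)
  ultimately show ?thesis
    by simp
qed

lemma finite_compatible: "finite compatible"
  by (rule finite_subset[of _ "\<Pi>\<^sub>E v\<in>verts G. carrier (vspace v)"])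
    (auto simp: compatible_def finite_tens finite_verts intro: finite_PiE)

lemma vectorspace_H0: "vectorspace F2 (sheaf_H0 X F)"
  using F.godement_cocycles_module field_F2 by (simp add: sheaf_H0_def vectorspace_def)

text \<open>The exponents of 2 in \<open>card_compatible\<close> are compared. The additive form
  keeps the dimension out of a truncated subtraction.\<close>

lemma dim_H0:
  "vectorspace.fin_dim F2 (sheaf_H0 X F)"
  "(\<Sum>v\<in>verts G. 2 ^ in_degree G v) = vectorspace.dim F2 (sheaf_H0 X F) + 2 * (card (verts G) - 1)"
proof -
  have H0: "vectorspace.fin_dim F2 (sheaf_H0 X F)"
    "card (carrier (sheaf_H0 X F)) = 2 ^ vectorspace.dim F2 (sheaf_H0 X F)"
    using vectorspace_F2_card[OF vectorspace_H0 finite_sheaf_H0[OF finite_compatible]] by auto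
  show "vectorspace.fin_dim F2 (sheaf_H0 X F)"
    by (rule H0(1))
  have "(2 :: nat) ^ (\<Sum>v\<in>verts G. 2 ^ in_degree G v) =
      2 ^ (vectorspace.dim F2 (sheaf_H0 X F) + 2 * card (internal_edges G))"
    using card_compatible H0(2) card_sheaf_H0 by (simp add: power_add power_mult)
  then show "(\<Sum>v\<in>verts G. 2 ^ in_degree G v) =
      vectorspace.dim F2 (sheaf_H0 X F) + 2 * (card (verts G) - 1)"
    unfolding card_internal_edges by (simp add: power_inject_exp)
qed

end

text \<open>Equal ends cannot both be open by \<open>finite_ext_digraph\<close>, so they would be
  one vertex, and a loop is a cycle of length 1.\<close>

lemma tree_loopless:
  assumes "finite_ext_digraph G" "is_tree G" "e \<in> edges G"
  shows "src G e \<noteq> tgt G e"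
proof
  assume eq: "src G e = tgt G e"
  have "src G e \<noteq> None \<or> tgt G e \<noteq> None"
    using assms(1,3) by (simp add: finite_ext_digraph_def)
  then obtain v where "src G e = Some v" "tgt G e = Some v"
    unfolding eq by blast
  then have "is_cycle G [v] [e]"
    using assms(3) by (simp add: is_cycle_def joins_def)
  then show False
    using assms(2) by (auto simp: is_tree_def)
qed

theorem mainTheorem3:
  fixes G :: "('v, 'e) ext_digraph" and C :: "('v, 'e) circuit" and n :: nat
  assumes "finite_ext_digraph G"
    and "card (verts G) = n" and "n \<ge> 1"
    and "is_tree G"
    and "logic_circuit G C"
  shows "carrier (sheaf_H1 (graph_top G) (switching_sheaf G C)) =
           {\<zero>\<^bsub>sheaf_H1 (graph_top G) (switching_sheaf G C)\<^esub>} \<and>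
         vectorspace F2 (sheaf_H0 (graph_top G) (switching_sheaf G C)) \<and>
         vectorspace.fin_dim F2 (sheaf_H0 (graph_top G) (switching_sheaf G C)) \<and>
         int (vectorspace.dim F2 (sheaf_H0 (graph_top G) (switching_sheaf G C))) =
           (\<Sum>v\<in>verts G. 2 ^ in_degree G v) - 2 * (int n - 1)"
proof -
  interpret switching_tree G C
  proof
    show "src G e \<noteq> tgt G e" if "e \<in> edges G" for e
      using tree_loopless[OF assms(1,4) that] .
    show "verts G \<noteq> {}"
      using assms(2,3) by auto
  qed (use assms in auto)
  \<comment> \<open>Since \<open>n \<ge> 1\<close>, the natural number
    \<open>card (verts G) - 1\<close> becomes the integer \<open>n - 1\<close>.\<close>
  have "int (\<Sum>v\<in>verts G. 2 ^ in_degree G v) =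
      int (vectorspace.dim F2 (sheaf_H0 X F)) + 2 * (int n - 1)"
    using dim_H0(2) assms(2,3) by (simp add: of_nat_diff)
  then show ?thesis
    using sheaf_H1_switching[OF switching_cech_trivial] vectorspace_H0 dim_H0(1) by simp
qed

end
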